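(* Let $\mathcal{C}$ be a pretriangulated dg category over $\mathbf{k}$, let $$A \xrightarrow{\;x\;} B \xrightarrow{\;y\;} C \rightsquigarrow$$ be a triangle in $\mathcal{C}$ (with some connecting morphism $C\to\Sigma A$), and let $\mathcal{B}$ be the full dg subcategory of $\mathcal{C}$ on the single object $B$. Then there are weak equivalences $$\mathcal{C}/\mathcal{B} \simeq (\mathcal{C}/x)/y \simeq (\mathcal{C}/y)/x$$ in the under category $\mathcal{C}\downarrow\mathrm{dgCat}$, where $\mathcal{C}/\mathcal{B}$ is Drinfeld's dg quotient.
   Context: Fix a commutative ring $\mathbf{k}$. Dg modules are homologically graded (the differential lowers degree by one) and $\Sigma$ is the homological suspension. A dg category is a category enriched over dg $\mathbf{k}$-modules. $\mathrm{dgCat}$ is the category of dg categories and dg functors with Tabuada's model structure, whose weak equivalences are the quasi-equivalences. All dg categories are assumed flat over $\mathbf{k}$. $\mathcal{C}\downarrow\mathrm{dgCat}$ is the category of dg categories equipped with a dg functor from $\mathcal{C}$ (maps are commutative triangles), with the induced model structure. "$\simeq$ in $\mathcal{C}\downarrow\mathrm{dgCat}$" means being connected by a zigzag of quasi-equivalences under $\mathcal{C}$, i.e. isomorphic in the homotopy category of $\mathcal{C}\downarrow\mathrm{dgCat}$. A triangle in a pretriangulated dg category $\mathcal{C}$ consists of closed degree $0$ morphisms whose classes form an exact triangle in the triangulated category $H_0(\mathcal{C})$. Killing: for a closed morphism $v:O_1\to O_2$ of degree $n$ in a dg category $\mathcal{C}$, $\mathcal{C}/v$ is the dg category with the same objects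 as $\mathcal{C}$, obtained from $\mathcal{C}$ by freely adjoining a morphism $w:O_1\to O_2$ of degree $n+1$ with $d(w)=v$. In $(\mathcal{C}/x)/y$ the morphism $y$ is regarded as a morphism of $\mathcal{C}/x$ via $\mathcal{C}\to\mathcal{C}/x$; similarly for $(\mathcal{C}/y)/x$. Drinfeld's quotient $\mathcal{C}/\mathcal{B}$ is the dg category obtained from $\mathcal{C}$ by freely adjoining a degree $1$ endomorphism $\varepsilon:B\to B$ with $d(\varepsilon)=1_B$ (that is, killing the morphism $1_B$). *)

theory Defs
  imports "HOL-Algebra.Module" "HOL-Algebra.AbelCoset"
begin

section \<open>Dg categories\<close>

text \<open>
  Morphisms carry no source, target or degree, so every operation is indexed by them.
  In \<open>dg_comp C X Y Z m n g f\<close>, \<open>f : X \<rightarrow> Y\<close> has degree \<open>n\<close> and \<open>g : Y \<rightarrow> Z\<close> has degree \<open>m\<close>.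
  The \<open>module\<close> record inherits the fields \<open>mult\<close> and \<open>one\<close> from rings; they play no role.
\<close>

record ('k, 'o, 'm) dgcat =
  dg_ob :: "'o set"
  dg_hom :: "'o \<Rightarrow> 'o \<Rightarrow> int \<Rightarrow> ('k, 'm) module"
  dg_diff :: "'o \<Rightarrow> 'o \<Rightarrow> int \<Rightarrow> 'm \<Rightarrow> 'm"
  dg_comp :: "'o \<Rightarrow> 'o \<Rightarrow> 'o \<Rightarrow> int \<Rightarrow> int \<Rightarrow> 'm \<Rightarrow> 'm \<Rightarrow> 'm"
  dg_id :: "'o \<Rightarrow> 'm"

definition module_hom :: "('k, 'r) ring_scheme \<Rightarrow> ('k, 'a) module \<Rightarrow> ('k, 'b) module \<Rightarrow> ('a \<Rightarrow> 'b) set"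
  where "module_hom R M N =
    {\<phi>. \<phi> \<in> carrier M \<rightarrow> carrier N
      \<and> (\<forall>x\<in>carrier M. \<forall>y\<in>carrier M. \<phi> (x \<oplus>\<^bsub>M\<^esub> y) = \<phi> x \<oplus>\<^bsub>N\<^esub> \<phi> y)
      \<and> (\<forall>a\<in>carrier R. \<forall>x\<in>carrier M. \<phi> (a \<odot>\<^bsub>M\<^esub> x) = a \<odot>\<^bsub>N\<^esub> \<phi> x)}"

text \<open>\<open>ksgn M n x\<close> is \<open>(-1)\<^sup>n x\<close>.\<close>

definition ksgn :: "('k, 'a) module \<Rightarrow> int \<Rightarrow> 'a \<Rightarrow> 'a"
  where "ksgn M n x = (if even n then x else \<ominus>\<^bsub>M\<^esub> x)"

locale dg_category = cring R for R :: "('k, 'r) ring_scheme" (structure) +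
  fixes C :: "('k, 'o, 'm) dgcat"
  assumes hom_module: "\<And>X Y n. X \<in> dg_ob C \<Longrightarrow> Y \<in> dg_ob C \<Longrightarrow> module R (dg_hom C X Y n)"
    and diff_hom: "\<And>X Y n. X \<in> dg_ob C \<Longrightarrow> Y \<in> dg_ob C \<Longrightarrow>
      dg_diff C X Y n \<in> module_hom R (dg_hom C X Y n) (dg_hom C X Y (n - 1))"
    and diff_diff: "\<And>X Y n f. X \<in> dg_ob C \<Longrightarrow> Y \<in> dg_ob C \<Longrightarrow> f \<in> carrier (dg_hom C X Y n) \<Longrightarrow>
      dg_diff C X Y (n - 1) (dg_diff C X Y n f) = \<zero>\<^bsub>dg_hom C X Y (n - 2)\<^esub>"
    and comp_hom_left: "\<And>X Y Z m n f. X \<in> dg_ob C \<Longrightarrow> Y \<in> dg_ob C \<Longrightarrow> Z \<in> dg_ob C \<Longrightarrow>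
      f \<in> carrier (dg_hom C X Y n) \<Longrightarrow>
      (\<lambda>g. dg_comp C X Y Z m n g f) \<in> module_hom R (dg_hom C Y Z m) (dg_hom C X Z (m + n))"
    and comp_hom_right: "\<And>X Y Z m n g. X \<in> dg_ob C \<Longrightarrow> Y \<in> dg_ob C \<Longrightarrow> Z \<in> dg_ob C \<Longrightarrow>
      g \<in> carrier (dg_hom C Y Z m) \<Longrightarrow>
      (\<lambda>f. dg_comp C X Y Z m n g f) \<in> module_hom R (dg_hom C X Y n) (dg_hom C X Z (m + n))"
    and leibniz: "\<And>X Y Z m n g f. X \<in> dg_ob C \<Longrightarrow> Y \<in> dg_ob C \<Longrightarrow> Z \<in> dg_ob C \<Longrightarrow>
      g \<in> carrier (dg_hom C Y Z m) \<Longrightarrow> f \<in> carrier (dg_hom C X Y n) \<Longrightarrow>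
      dg_diff C X Z (m + n) (dg_comp C X Y Z m n g f) =
        dg_comp C X Y Z (m - 1) n (dg_diff C Y Z m g) f
        \<oplus>\<^bsub>dg_hom C X Z (m + n - 1)\<^esub>
        ksgn (dg_hom C X Z (m + n - 1)) m (dg_comp C X Y Z m (n - 1) g (dg_diff C X Y n f))"
    and comp_assoc: "\<And>W X Y Z l m n h g f. W \<in> dg_ob C \<Longrightarrow> X \<in> dg_ob C \<Longrightarrow> Y \<in> dg_ob C \<Longrightarrow>
      Z \<in> dg_ob C \<Longrightarrow> h \<in> carrier (dg_hom C Y Z l) \<Longrightarrow> g \<in> carrier (dg_hom C X Y m) \<Longrightarrow>
      f \<in> carrier (dg_hom C W X n) \<Longrightarrow>
      dg_comp C W X Z (l + m) n (dg_comp C X Y Z l m h g) f =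
        dg_comp C W Y Z l (m + n) h (dg_comp C W X Y m n g f)"
    and id_closed: "\<And>X. X \<in> dg_ob C \<Longrightarrow> dg_id C X \<in> carrier (dg_hom C X X 0)"
    and diff_id: "\<And>X. X \<in> dg_ob C \<Longrightarrow> dg_diff C X X 0 (dg_id C X) = \<zero>\<^bsub>dg_hom C X X (-1)\<^esub>"
    and comp_id_right: "\<And>X Y n f. X \<in> dg_ob C \<Longrightarrow> Y \<in> dg_ob C \<Longrightarrow>
      f \<in> carrier (dg_hom C X Y n) \<Longrightarrow> dg_comp C X X Y n 0 f (dg_id C X) = f"
    and comp_id_left: "\<And>X Y n f. X \<in> dg_ob C \<Longrightarrow> Y \<in> dg_ob C \<Longrightarrow>
      f \<in> carrier (dg_hom C X Y n) \<Longrightarrow> dg_comp C X Y Y 0 n (dg_id C Y) f = f"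

definition full_dg_sub :: "('k, 'o, 'm) dgcat \<Rightarrow> 'o set \<Rightarrow> ('k, 'o, 'm) dgcat"
  where "full_dg_sub C S = C\<lparr>dg_ob := S\<rparr>"


section \<open>Flatness\<close>

text \<open>
  Elements of the tensor product of \<open>N\<close> and \<open>M\<close> are represented by lists of pairs, that is by formal
  sums of pure tensors; \<open>tensor_eq\<close> is equality in the tensor product.
\<close>

inductive tensor_eq ::
  "('k, 'r) ring_scheme \<Rightarrow> ('k, 'n) module \<Rightarrow> ('k, 'm) module \<Rightarrow> ('n \<times> 'm) list \<Rightarrow> ('n \<times> 'm) list \<Rightarrow> bool"
  for R N M
  where
    refl: "set xs \<subseteq> carrier N \<times> carrier M \<Longrightarrow> tensor_eq R N M xs xs"
  | sym: "tensor_eq R N M xs ys \<Longrightarrow> tensor_eq R N M ys xs"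
  | trans: "tensor_eq R N M xs ys \<Longrightarrow> tensor_eq R N M ys zs \<Longrightarrow> tensor_eq R N M xs zs"
  | append: "tensor_eq R N M xs ys \<Longrightarrow> tensor_eq R N M xs' ys' \<Longrightarrow> tensor_eq R N M (xs @ xs') (ys @ ys')"
  | comm: "set xs \<subseteq> carrier N \<times> carrier M \<Longrightarrow> set ys \<subseteq> carrier N \<times> carrier M \<Longrightarrow>
      tensor_eq R N M (xs @ ys) (ys @ xs)"
  | zero: "m \<in> carrier M \<Longrightarrow> tensor_eq R N M [(\<zero>\<^bsub>N\<^esub>, m)] []"
  | add_left: "n \<in> carrier N \<Longrightarrow> n' \<in> carrier N \<Longrightarrow> m \<in> carrier M \<Longrightarrow>
      tensor_eq R N M [(n \<oplus>\<^bsub>N\<^esub> n', m)] [(n, m), (n', m)]"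
  | add_right: "n \<in> carrier N \<Longrightarrow> m \<in> carrier M \<Longrightarrow> m' \<in> carrier M \<Longrightarrow>
      tensor_eq R N M [(n, m \<oplus>\<^bsub>M\<^esub> m')] [(n, m), (n, m')]"
  | balanced: "a \<in> carrier R \<Longrightarrow> n \<in> carrier N \<Longrightarrow> m \<in> carrier M \<Longrightarrow>
      tensor_eq R N M [(a \<odot>\<^bsub>N\<^esub> n, m)] [(n, a \<odot>\<^bsub>M\<^esub> m)]"

text \<open>
  Tensoring with \<open>M\<close> preserves injections. It suffices to test injections between finitely generated
  modules. Each of these is isomorphic to a quotient of some \<open>R\<^sup>n\<close>, whose elements are sets of lists
  over \<open>R\<close>; so the type of the test modules is no restriction.
\<close>

definition flat_module :: "('k, 'r) ring_scheme \<Rightarrow> ('k, 'm) module \<Rightarrow> bool"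
  where "flat_module R M \<longleftrightarrow>
    (\<forall>(N :: ('k, 'k list set) module) (N' :: ('k, 'k list set) module) \<phi>.
      module R N \<longrightarrow> module R N' \<longrightarrow> \<phi> \<in> module_hom R N N' \<longrightarrow> inj_on \<phi> (carrier N) \<longrightarrow>
      (\<forall>xs ys. set xs \<subseteq> carrier N \<times> carrier M \<longrightarrow> set ys \<subseteq> carrier N \<times> carrier M \<longrightarrow>
        tensor_eq R N' M (map (map_prod \<phi> id) xs) (map (map_prod \<phi> id) ys) \<longrightarrow>
        tensor_eq R N M xs ys))"

definition flat_dgcat :: "('k, 'r) ring_scheme \<Rightarrow> ('k, 'o, 'm) dgcat \<Rightarrow> bool"
  where "flat_dgcat R C \<longleftrightarrow> (\<forall>X\<in>dg_ob C. \<forall>Y\<in>dg_ob C. \<forall>n. flat_module R (dg_hom C X Y n))"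


section \<open>Homology\<close>

definition cycles :: "('k, 'o, 'm) dgcat \<Rightarrow> 'o \<Rightarrow> 'o \<Rightarrow> int \<Rightarrow> 'm set"
  where "cycles C X Y n = {f \<in> carrier (dg_hom C X Y n). dg_diff C X Y n f = \<zero>\<^bsub>dg_hom C X Y (n - 1)\<^esub>}"

definition boundaries :: "('k, 'o, 'm) dgcat \<Rightarrow> 'o \<Rightarrow> 'o \<Rightarrow> int \<Rightarrow> 'm set"
  where "boundaries C X Y n = dg_diff C X Y (n + 1) ` carrier (dg_hom C X Y (n + 1))"

definition hclass :: "('k, 'o, 'm) dgcat \<Rightarrow> 'o \<Rightarrow> 'o \<Rightarrow> int \<Rightarrow> 'm \<Rightarrow> 'm set"
  where "hclass C X Y n f = boundaries C X Y n +>\<^bsub>dg_hom C X Y n\<^esub> f"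

definition homology :: "('k, 'o, 'm) dgcat \<Rightarrow> 'o \<Rightarrow> 'o \<Rightarrow> int \<Rightarrow> 'm set set"
  where "homology C X Y n = hclass C X Y n ` cycles C X Y n"

definition homologous :: "('k, 'o, 'm) dgcat \<Rightarrow> 'o \<Rightarrow> 'o \<Rightarrow> int \<Rightarrow> 'm \<Rightarrow> 'm \<Rightarrow> bool"
  where "homologous C X Y n f g \<longleftrightarrow>
    f \<in> cycles C X Y n \<and> g \<in> cycles C X Y n \<and> hclass C X Y n f = hclass C X Y n g"

definition H0_iso :: "('k, 'o, 'm) dgcat \<Rightarrow> 'o \<Rightarrow> 'o \<Rightarrow> 'm \<Rightarrow> bool"
  where "H0_iso C X Y f \<longleftrightarrow> f \<in> cycles C X Y 0 \<and>
    (\<exists>g\<in>cycles C Y X 0. homologous C X X 0 (dg_comp C X Y X 0 0 g f) (dg_id C X)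
                      \<and> homologous C Y Y 0 (dg_comp C Y X Y 0 0 f g) (dg_id C Y))"


section \<open>Dg functors and quasi-equivalences\<close>

record ('o, 'm, 'p, 'n) dgfun =
  fun_ob :: "'o \<Rightarrow> 'p"
  fun_mor :: "'o \<Rightarrow> 'o \<Rightarrow> int \<Rightarrow> 'm \<Rightarrow> 'n"

definition dg_functor ::
  "('k, 'r) ring_scheme \<Rightarrow> ('k, 'o, 'm) dgcat \<Rightarrow> ('k, 'p, 'n) dgcat \<Rightarrow> ('o, 'm, 'p, 'n) dgfun \<Rightarrow> bool"
  where "dg_functor R C D F \<longleftrightarrow>
    fun_ob F \<in> dg_ob C \<rightarrow> dg_ob D
    \<and> (\<forall>X\<in>dg_ob C. \<forall>Y\<in>dg_ob C. \<forall>n.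
        fun_mor F X Y n \<in> module_hom R (dg_hom C X Y n) (dg_hom D (fun_ob F X) (fun_ob F Y) n))
    \<and> (\<forall>X\<in>dg_ob C. \<forall>Y\<in>dg_ob C. \<forall>n. \<forall>f\<in>carrier (dg_hom C X Y n).
        fun_mor F X Y (n - 1) (dg_diff C X Y n f)
          = dg_diff D (fun_ob F X) (fun_ob F Y) n (fun_mor F X Y n f))
    \<and> (\<forall>X\<in>dg_ob C. \<forall>Y\<in>dg_ob C. \<forall>Z\<in>dg_ob C. \<forall>m n.
        \<forall>g\<in>carrier (dg_hom C Y Z m). \<forall>f\<in>carrier (dg_hom C X Y n).
        fun_mor F X Z (m + n) (dg_comp C X Y Z m n g f)
          = dg_comp D (fun_ob F X) (fun_ob F Y) (fun_ob F Z) m n (fun_mor F Y Z m g) (fun_mor F X Y n f))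
    \<and> (\<forall>X\<in>dg_ob C. fun_mor F X X 0 (dg_id C X) = dg_id D (fun_ob F X))"

definition dgfun_comp :: "('p, 'n, 'q, 'l) dgfun \<Rightarrow> ('o, 'm, 'p, 'n) dgfun \<Rightarrow> ('o, 'm, 'q, 'l) dgfun"
  where "dgfun_comp G F = \<lparr>fun_ob = fun_ob G \<circ> fun_ob F,
    fun_mor = (\<lambda>X Y n f. fun_mor G (fun_ob F X) (fun_ob F Y) n (fun_mor F X Y n f))\<rparr>"

definition dgfun_eq :: "('k, 'o, 'm) dgcat \<Rightarrow> ('o, 'm, 'p, 'n) dgfun \<Rightarrow> ('o, 'm, 'p, 'n) dgfun \<Rightarrow> bool"
  where "dgfun_eq C F G \<longleftrightarrow>
    (\<forall>X\<in>dg_ob C. fun_ob F X = fun_ob G X)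
    \<and> (\<forall>X\<in>dg_ob C. \<forall>Y\<in>dg_ob C. \<forall>n. \<forall>f\<in>carrier (dg_hom C X Y n). fun_mor F X Y n f = fun_mor G X Y n f)"

definition quasi_equivalence ::
  "('k, 'r) ring_scheme \<Rightarrow> ('k, 'o, 'm) dgcat \<Rightarrow> ('k, 'p, 'n) dgcat \<Rightarrow> ('o, 'm, 'p, 'n) dgfun \<Rightarrow> bool"
  where "quasi_equivalence R C D F \<longleftrightarrow>
    dg_functor R C D F
    \<and> (\<forall>X\<in>dg_ob C. \<forall>Y\<in>dg_ob C. \<forall>n. \<exists>\<phi>.
        (\<forall>f\<in>cycles C X Y n. \<phi> (hclass C X Y n f) = hclass D (fun_ob F X) (fun_ob F Y) n (fun_mor F X Y n f))
        \<and> bij_betw \<phi> (homology C X Y n) (homology D (fun_ob F X) (fun_ob F Y) n))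
    \<and> (\<forall>Z\<in>dg_ob D. \<exists>X\<in>dg_ob C. \<exists>u. H0_iso D (fun_ob F X) Z u)"


section \<open>The under category\<close>

type_synonym ('k, 'o, 'm, 'p, 'n) under = "('k, 'p, 'n) dgcat \<times> ('o, 'm, 'p, 'n) dgfun"

definition under_object :: "('k, 'r) ring_scheme \<Rightarrow> ('k, 'o, 'm) dgcat \<Rightarrow> ('k, 'o, 'm, 'p, 'n) under \<Rightarrow> bool"
  where "under_object R C U \<longleftrightarrow> dg_category R (fst U) \<and> dg_functor R C (fst U) (snd U)"

definition weq_under :: "('k, 'r) ring_scheme \<Rightarrow> ('k, 'o, 'm) dgcat \<Rightarrow>
    ('k, 'o, 'm, 'p, 'n) under \<Rightarrow> ('k, 'o, 'm, 'q, 'l) under \<Rightarrow> bool"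
  where "weq_under R C U V \<longleftrightarrow> under_object R C U \<and> under_object R C V \<and>
    (\<exists>F. quasi_equivalence R (fst U) (fst V) F \<and> dgfun_eq C (dgfun_comp F (snd U)) (snd V))"

definition link_under :: "('k, 'r) ring_scheme \<Rightarrow> ('k, 'o, 'm) dgcat \<Rightarrow>
    ('k, 'o, 'm, 'p, 'n) under \<Rightarrow> ('k, 'o, 'm, 'q, 'l) under \<Rightarrow> bool"
  where "link_under R C U V \<longleftrightarrow> weq_under R C U V \<or> weq_under R C V U"

text \<open>
  Zigzags of quasi-equivalences under \<open>C\<close> of any length, through flat dg categories. (The two ends
  used below are obtained from a flat \<open>C\<close> by freely adjoining morphisms, so they are flat as well.)
  The two ends may have different types. The intermediate dg categories have the types of the right
  end; as they are existentially quantified, fixing their types can only strengthen the relation.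
\<close>

definition weakly_equivalent_under :: "('k, 'r) ring_scheme \<Rightarrow> ('k, 'o, 'm) dgcat \<Rightarrow>
    ('k, 'o, 'm, 'p, 'n) under \<Rightarrow> ('k, 'o, 'm, 'q, 'l) under \<Rightarrow> bool"
  where "weakly_equivalent_under R C U V \<longleftrightarrow>
    link_under R C U V \<or>
    (\<exists>(E :: ('k, 'o, 'm, 'q, 'l) under) E'. flat_dgcat R (fst E) \<and> link_under R C U E \<and>
      (\<lambda>D D'. flat_dgcat R (fst D') \<and> link_under R C D D')\<^sup>*\<^sup>* E E' \<and> link_under R C E' V)"


section \<open>Freely adjoining morphisms; killing; Drinfeld quotient\<close>

text \<open>
  \<open>adjoin R C V\<close> adjoins to \<open>C\<close>, for every \<open>(O1, O2, n, v) \<in> V\<close>, a new morphism \<open>w : O1 \<rightarrow> O2\<close> of degree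
  \<open>n + 1\<close> with \<open>d w = v\<close>. It is given by generators and relations. Generators are the morphisms of
  \<open>C\<close> (\<open>Old X Y n f\<close>) and the new ones (\<open>New O1 O2 n v\<close>). The relations are the axioms of an
  \<open>R\<close>-linear graded category and those making \<open>Old\<close> a functor.
\<close>

datatype ('k, 'o, 'm) expr =
    Old 'o 'o int 'm
  | New 'o 'o int 'm
  | Add "('k, 'o, 'm) expr" "('k, 'o, 'm) expr"
  | Scal 'k "('k, 'o, 'm) expr"
  | Comp "('k, 'o, 'm) expr" "('k, 'o, 'm) expr"

inductive is_expr :: "('k, 'r) ring_scheme \<Rightarrow> ('k, 'o, 'm) dgcat \<Rightarrow> ('o \<times> 'o \<times> int \<times> 'm) set \<Rightarrow>
    'o \<Rightarrow> 'o \<Rightarrow> int \<Rightarrow> ('k, 'o, 'm) expr \<Rightarrow> bool"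
  for R C V
  where
    Old: "X \<in> dg_ob C \<Longrightarrow> Y \<in> dg_ob C \<Longrightarrow> f \<in> carrier (dg_hom C X Y n) \<Longrightarrow>
      is_expr R C V X Y n (Old X Y n f)"
  | New: "(X, Y, n, v) \<in> V \<Longrightarrow> is_expr R C V X Y (n + 1) (New X Y n v)"
  | Add: "is_expr R C V X Y n s \<Longrightarrow> is_expr R C V X Y n t \<Longrightarrow> is_expr R C V X Y n (Add s t)"
  | Scal: "a \<in> carrier R \<Longrightarrow> is_expr R C V X Y n s \<Longrightarrow> is_expr R C V X Y n (Scal a s)"
  | Comp: "is_expr R C V Y Z m t \<Longrightarrow> is_expr R C V X Y n s \<Longrightarrow> is_expr R C V X Z (m + n) (Comp t s)"

inductive expr_eq :: "('k, 'r) ring_scheme \<Rightarrow> ('k, 'o, 'm) dgcat \<Rightarrow> ('o \<times> 'o \<times> int \<times> 'm) set \<Rightarrow>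
    'o \<Rightarrow> 'o \<Rightarrow> int \<Rightarrow> ('k, 'o, 'm) expr \<Rightarrow> ('k, 'o, 'm) expr \<Rightarrow> bool"
  for R C V
  where
    refl: "is_expr R C V X Y n s \<Longrightarrow> expr_eq R C V X Y n s s"
  | sym: "expr_eq R C V X Y n s t \<Longrightarrow> expr_eq R C V X Y n t s"
  | trans: "expr_eq R C V X Y n s t \<Longrightarrow> expr_eq R C V X Y n t u \<Longrightarrow> expr_eq R C V X Y n s u"
  | Add_cong: "expr_eq R C V X Y n s s' \<Longrightarrow> expr_eq R C V X Y n t t' \<Longrightarrow>
      expr_eq R C V X Y n (Add s t) (Add s' t')"
  | Scal_cong: "a \<in> carrier R \<Longrightarrow> expr_eq R C V X Y n s s' \<Longrightarrow> expr_eq R C V X Y n (Scal a s) (Scal a s')"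
  | Comp_cong: "expr_eq R C V Y Z m t t' \<Longrightarrow> expr_eq R C V X Y n s s' \<Longrightarrow>
      expr_eq R C V X Z (m + n) (Comp t s) (Comp t' s')"
  | add_assoc: "is_expr R C V X Y n s \<Longrightarrow> is_expr R C V X Y n t \<Longrightarrow> is_expr R C V X Y n u \<Longrightarrow>
      expr_eq R C V X Y n (Add (Add s t) u) (Add s (Add t u))"
  | add_comm: "is_expr R C V X Y n s \<Longrightarrow> is_expr R C V X Y n t \<Longrightarrow>
      expr_eq R C V X Y n (Add s t) (Add t s)"
  | add_zero: "is_expr R C V X Y n s \<Longrightarrow> expr_eq R C V X Y n (Add (Old X Y n \<zero>\<^bsub>dg_hom C X Y n\<^esub>) s) s"
  | scal_zero: "is_expr R C V X Y n s \<Longrightarrow>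
      expr_eq R C V X Y n (Scal \<zero>\<^bsub>R\<^esub> s) (Old X Y n \<zero>\<^bsub>dg_hom C X Y n\<^esub>)"
  | scal_one: "is_expr R C V X Y n s \<Longrightarrow> expr_eq R C V X Y n (Scal \<one>\<^bsub>R\<^esub> s) s"
  | scal_add_left: "a \<in> carrier R \<Longrightarrow> b \<in> carrier R \<Longrightarrow> is_expr R C V X Y n s \<Longrightarrow>
      expr_eq R C V X Y n (Scal (a \<oplus>\<^bsub>R\<^esub> b) s) (Add (Scal a s) (Scal b s))"
  | scal_add_right: "a \<in> carrier R \<Longrightarrow> is_expr R C V X Y n s \<Longrightarrow> is_expr R C V X Y n t \<Longrightarrow>
      expr_eq R C V X Y n (Scal a (Add s t)) (Add (Scal a s) (Scal a t))"
  | scal_mult: "a \<in> carrier R \<Longrightarrow> b \<in> carrier R \<Longrightarrow> is_expr R C V X Y n s \<Longrightarrow>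
      expr_eq R C V X Y n (Scal (a \<otimes>\<^bsub>R\<^esub> b) s) (Scal a (Scal b s))"
  | comp_add_left: "is_expr R C V Y Z m t \<Longrightarrow> is_expr R C V Y Z m t' \<Longrightarrow> is_expr R C V X Y n s \<Longrightarrow>
      expr_eq R C V X Z (m + n) (Comp (Add t t') s) (Add (Comp t s) (Comp t' s))"
  | comp_add_right: "is_expr R C V Y Z m t \<Longrightarrow> is_expr R C V X Y n s \<Longrightarrow> is_expr R C V X Y n s' \<Longrightarrow>
      expr_eq R C V X Z (m + n) (Comp t (Add s s')) (Add (Comp t s) (Comp t s'))"
  | comp_scal_left: "a \<in> carrier R \<Longrightarrow> is_expr R C V Y Z m t \<Longrightarrow> is_expr R C V X Y n s \<Longrightarrow>
      expr_eq R C V X Z (m + n) (Comp (Scal a t) s) (Scal a (Comp t s))"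
  | comp_scal_right: "a \<in> carrier R \<Longrightarrow> is_expr R C V Y Z m t \<Longrightarrow> is_expr R C V X Y n s \<Longrightarrow>
      expr_eq R C V X Z (m + n) (Comp t (Scal a s)) (Scal a (Comp t s))"
  | comp_assoc: "is_expr R C V Y Z l u \<Longrightarrow> is_expr R C V X Y m t \<Longrightarrow> is_expr R C V W X n s \<Longrightarrow>
      expr_eq R C V W Z (l + m + n) (Comp (Comp u t) s) (Comp u (Comp t s))"
  | comp_id_right: "is_expr R C V X Y n s \<Longrightarrow> expr_eq R C V X Y n (Comp s (Old X X 0 (dg_id C X))) s"
  | comp_id_left: "is_expr R C V X Y n s \<Longrightarrow> expr_eq R C V X Y n (Comp (Old Y Y 0 (dg_id C Y)) s) s"
  | Old_add: "X \<in> dg_ob C \<Longrightarrow> Y \<in> dg_ob C \<Longrightarrow> f \<in> carrier (dg_hom C X Y n) \<Longrightarrow>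
      g \<in> carrier (dg_hom C X Y n) \<Longrightarrow>
      expr_eq R C V X Y n (Old X Y n (f \<oplus>\<^bsub>dg_hom C X Y n\<^esub> g)) (Add (Old X Y n f) (Old X Y n g))"
  | Old_scal: "X \<in> dg_ob C \<Longrightarrow> Y \<in> dg_ob C \<Longrightarrow> a \<in> carrier R \<Longrightarrow> f \<in> carrier (dg_hom C X Y n) \<Longrightarrow>
      expr_eq R C V X Y n (Old X Y n (a \<odot>\<^bsub>dg_hom C X Y n\<^esub> f)) (Scal a (Old X Y n f))"
  | Old_comp: "X \<in> dg_ob C \<Longrightarrow> Y \<in> dg_ob C \<Longrightarrow> Z \<in> dg_ob C \<Longrightarrow>
      g \<in> carrier (dg_hom C Y Z m) \<Longrightarrow> f \<in> carrier (dg_hom C X Y n) \<Longrightarrow>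
      expr_eq R C V X Z (m + n) (Old X Z (m + n) (dg_comp C X Y Z m n g f)) (Comp (Old Y Z m g) (Old X Y n f))"

definition expr_class :: "('k, 'r) ring_scheme \<Rightarrow> ('k, 'o, 'm) dgcat \<Rightarrow> ('o \<times> 'o \<times> int \<times> 'm) set \<Rightarrow>
    'o \<Rightarrow> 'o \<Rightarrow> int \<Rightarrow> ('k, 'o, 'm) expr \<Rightarrow> ('k, 'o, 'm) expr set"
  where "expr_class R C V X Y n s = {t. expr_eq R C V X Y n s t}"

primrec expr_deg :: "('k, 'o, 'm) expr \<Rightarrow> int"
  where
    "expr_deg (Old X Y n f) = n"
  | "expr_deg (New X Y n v) = n + 1"
  | "expr_deg (Add s t) = expr_deg s"
  | "expr_deg (Scal a s) = expr_deg s"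
  | "expr_deg (Comp t s) = expr_deg t + expr_deg s"

primrec expr_diff :: "('k, 'r) ring_scheme \<Rightarrow> ('k, 'o, 'm) dgcat \<Rightarrow> ('k, 'o, 'm) expr \<Rightarrow> ('k, 'o, 'm) expr"
  where
    "expr_diff R C (Old X Y n f) = Old X Y (n - 1) (dg_diff C X Y n f)"
  | "expr_diff R C (New X Y n v) = Old X Y n v"
  | "expr_diff R C (Add s t) = Add (expr_diff R C s) (expr_diff R C t)"
  | "expr_diff R C (Scal a s) = Scal a (expr_diff R C s)"
  | "expr_diff R C (Comp t s) = Add (Comp (expr_diff R C t) s)
      (Scal (if even (expr_deg t) then \<one>\<^bsub>R\<^esub> else \<ominus>\<^bsub>R\<^esub> \<one>\<^bsub>R\<^esub>) (Comp t (expr_diff R C s)))"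

definition adjoin :: "('k, 'r) ring_scheme \<Rightarrow> ('k, 'o, 'm) dgcat \<Rightarrow> ('o \<times> 'o \<times> int \<times> 'm) set \<Rightarrow>
    ('k, 'o, ('k, 'o, 'm) expr set) dgcat"
  where "adjoin R C V =
    \<lparr>dg_ob = dg_ob C,
     dg_hom = (\<lambda>X Y n.
       \<lparr>carrier = expr_class R C V X Y n ` {s. is_expr R C V X Y n s},
        mult = undefined, one = undefined,
        zero = expr_class R C V X Y n (Old X Y n \<zero>\<^bsub>dg_hom C X Y n\<^esub>),
        add = (\<lambda>S T. \<Union>s\<in>S. \<Union>t\<in>T. expr_class R C V X Y n (Add s t)),
        smult = (\<lambda>a S. \<Union>s\<in>S. expr_class R C V X Y n (Scal a s))\<rparr>),
     dg_diff = (\<lambda>X Y n S. \<Union>s\<in>S. expr_class R C V X Y (n - 1) (expr_diff R C s)),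
     dg_comp = (\<lambda>X Y Z m n T S. \<Union>t\<in>T. \<Union>s\<in>S. expr_class R C V X Z (m + n) (Comp t s)),
     dg_id = (\<lambda>X. expr_class R C V X X 0 (Old X X 0 (dg_id C X)))\<rparr>"

definition adjoin_incl :: "('k, 'r) ring_scheme \<Rightarrow> ('k, 'o, 'm) dgcat \<Rightarrow> ('o \<times> 'o \<times> int \<times> 'm) set \<Rightarrow>
    ('o, 'm, 'o, ('k, 'o, 'm) expr set) dgfun"
  where "adjoin_incl R C V =
    \<lparr>fun_ob = (\<lambda>X. X), fun_mor = (\<lambda>X Y n f. expr_class R C V X Y n (Old X Y n f))\<rparr>"

definition adjoin_under :: "('k, 'r) ring_scheme \<Rightarrow> ('k, 'o, 'm) dgcat \<Rightarrow> ('o \<times> 'o \<times> int \<times> 'm) set \<Rightarrow>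
    ('k, 'o, 'm, 'o, ('k, 'o, 'm) expr set) under"
  where "adjoin_under R C V = (adjoin R C V, adjoin_incl R C V)"

text \<open>\<open>kill R C X Y n v\<close> is \<open>C/v\<close> for \<open>v : X \<rightarrow> Y\<close> of degree \<open>n\<close>, as an object under \<open>C\<close>.\<close>

definition kill :: "('k, 'r) ring_scheme \<Rightarrow> ('k, 'o, 'm) dgcat \<Rightarrow> 'o \<Rightarrow> 'o \<Rightarrow> int \<Rightarrow> 'm \<Rightarrow>
    ('k, 'o, 'm, 'o, ('k, 'o, 'm) expr set) under"
  where "kill R C X Y n v = adjoin_under R C {(X, Y, n, v)}"

text \<open>
  \<open>kill2 R C X Y n v X' Y' n' v'\<close> is \<open>(C/v)/v'\<close>, as an object under \<open>C\<close>; here \<open>v'\<close> is a morphism of \<open>C\<close>.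
\<close>

definition kill2 :: "('k, 'r) ring_scheme \<Rightarrow> ('k, 'o, 'm) dgcat \<Rightarrow> 'o \<Rightarrow> 'o \<Rightarrow> int \<Rightarrow> 'm \<Rightarrow>
    'o \<Rightarrow> 'o \<Rightarrow> int \<Rightarrow> 'm \<Rightarrow>
    ('k, 'o, 'm, 'o, ('k, 'o, ('k, 'o, 'm) expr set) expr set) under"
  where "kill2 R C X Y n v X' Y' n' v' =
    (let (D, I) = kill R C X Y n v;
         (E, J) = kill R D (fun_ob I X') (fun_ob I Y') n' (fun_mor I X' Y' n' v')
     in (E, dgfun_comp J I))"

text \<open>The second argument \<open>B\<close> is a full dg subcategory of \<open>C\<close>.\<close>

definition drinfeld_quotient :: "('k, 'r) ring_scheme \<Rightarrow> ('k, 'o, 'm) dgcat \<Rightarrow> ('k, 'o, 'm) dgcat \<Rightarrow>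
    ('k, 'o, 'm, 'o, ('k, 'o, 'm) expr set) under"
  where "drinfeld_quotient R C B = adjoin_under R C {(X, X, 0, dg_id C X) | X. X \<in> dg_ob B}"


section \<open>Pretriangulated dg categories and exact triangles\<close>

text \<open>
  One-sided twisted complexes (Bondal--Kapranov). A twisted complex is a finite formal sum of shifted
  objects \<open>\<Sigma>\<^sup>r E\<close>, given as a list of pairs \<open>(E, r)\<close>, with a strictly upper triangular matrix \<open>q\<close>
  of degree \<open>-1\<close>. A morphism of degree \<open>n\<close> from \<open>\<Sigma>\<^sup>r E\<close> to \<open>\<Sigma>\<^sup>s F\<close> is an element of
  \<open>Hom(E, F)\<close> of degree \<open>n + r - s\<close>; under this identification composition acquires no sign, and the
  differential acquires the sign \<open>(-1)\<^sup>s\<close>. The entry \<open>f i j\<close> of a matrix goes from the \<open>j\<close>-th to the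
  \<open>i\<close>-th summand; entries out of range are \<open>undefined\<close>.
\<close>

type_synonym ('o, 'm) twc = "('o \<times> int) list \<times> (nat \<Rightarrow> nat \<Rightarrow> 'm)"

abbreviation tw_len :: "('o, 'm) twc \<Rightarrow> nat" where "tw_len T \<equiv> length (fst T)"
abbreviation tw_ob :: "('o, 'm) twc \<Rightarrow> nat \<Rightarrow> 'o" where "tw_ob T i \<equiv> fst (fst T ! i)"
abbreviation tw_sh :: "('o, 'm) twc \<Rightarrow> nat \<Rightarrow> int" where "tw_sh T i \<equiv> snd (fst T ! i)"

definition matrix :: "nat \<Rightarrow> nat \<Rightarrow> (nat \<Rightarrow> nat \<Rightarrow> 'm) \<Rightarrow> nat \<Rightarrow> nat \<Rightarrow> 'm"
  where "matrix a b f = (\<lambda>i j. if i < a \<and> j < b then f i j else undefined)"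

definition entry_hom :: "('k, 'o, 'm) dgcat \<Rightarrow> ('o, 'm) twc \<Rightarrow> ('o, 'm) twc \<Rightarrow> int \<Rightarrow>
    nat \<Rightarrow> nat \<Rightarrow> ('k, 'm) module"
  where "entry_hom C S T n i j = dg_hom C (tw_ob S j) (tw_ob T i) (n + tw_sh S j - tw_sh T i)"

definition tw_hom :: "('k, 'o, 'm) dgcat \<Rightarrow> ('o, 'm) twc \<Rightarrow> ('o, 'm) twc \<Rightarrow> int \<Rightarrow>
    ('k, nat \<Rightarrow> nat \<Rightarrow> 'm) module"
  where "tw_hom C S T n =
    \<lparr>carrier = {f. f = matrix (tw_len T) (tw_len S) f \<and>
       (\<forall>i<tw_len T. \<forall>j<tw_len S. f i j \<in> carrier (entry_hom C S T n i j))},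
     mult = undefined, one = undefined,
     zero = matrix (tw_len T) (tw_len S) (\<lambda>i j. \<zero>\<^bsub>entry_hom C S T n i j\<^esub>),
     add = (\<lambda>f g. matrix (tw_len T) (tw_len S) (\<lambda>i j. f i j \<oplus>\<^bsub>entry_hom C S T n i j\<^esub> g i j)),
     smult = (\<lambda>a f. matrix (tw_len T) (tw_len S) (\<lambda>i j. a \<odot>\<^bsub>entry_hom C S T n i j\<^esub> f i j))\<rparr>"

definition tw_comp :: "('k, 'o, 'm) dgcat \<Rightarrow> ('o, 'm) twc \<Rightarrow> ('o, 'm) twc \<Rightarrow> ('o, 'm) twc \<Rightarrow> int \<Rightarrow> int \<Rightarrow>
    (nat \<Rightarrow> nat \<Rightarrow> 'm) \<Rightarrow> (nat \<Rightarrow> nat \<Rightarrow> 'm) \<Rightarrow> nat \<Rightarrow> nat \<Rightarrow> 'm"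
  where "tw_comp C S T U m n g f = matrix (tw_len U) (tw_len S)
    (\<lambda>i j. \<Oplus>\<^bsub>entry_hom C S U (m + n) i j\<^esub> l\<in>{..<tw_len T}.
      dg_comp C (tw_ob S j) (tw_ob T l) (tw_ob U i)
        (m + tw_sh T l - tw_sh U i) (n + tw_sh S j - tw_sh T l) (g i l) (f l j))"

text \<open>The differential without the contribution of the twists.\<close>

definition tw_diff0 :: "('k, 'o, 'm) dgcat \<Rightarrow> ('o, 'm) twc \<Rightarrow> ('o, 'm) twc \<Rightarrow> int \<Rightarrow>
    (nat \<Rightarrow> nat \<Rightarrow> 'm) \<Rightarrow> nat \<Rightarrow> nat \<Rightarrow> 'm"
  where "tw_diff0 C S T n f = matrix (tw_len T) (tw_len S)
    (\<lambda>i j. ksgn (entry_hom C S T (n - 1) i j) (tw_sh T i)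
      (dg_diff C (tw_ob S j) (tw_ob T i) (n + tw_sh S j - tw_sh T i) (f i j)))"

definition twisted_complex :: "('k, 'o, 'm) dgcat \<Rightarrow> ('o, 'm) twc \<Rightarrow> bool"
  where "twisted_complex C T \<longleftrightarrow>
    fst ` set (fst T) \<subseteq> dg_ob C
    \<and> snd T \<in> carrier (tw_hom C T T (-1))
    \<and> (\<forall>i<tw_len T. \<forall>j<tw_len T. j \<le> i \<longrightarrow> snd T i j = \<zero>\<^bsub>entry_hom C T T (-1) i j\<^esub>)
    \<and> tw_diff0 C T T (-1) (snd T) \<oplus>\<^bsub>tw_hom C T T (-2)\<^esub> tw_comp C T T T (-1) (-1) (snd T) (snd T)
        = \<zero>\<^bsub>tw_hom C T T (-2)\<^esub>"

definition pretr :: "('k, 'o, 'm) dgcat \<Rightarrow> ('k, ('o, 'm) twc, nat \<Rightarrow> nat \<Rightarrow> 'm) dgcat"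
  where "pretr C =
    \<lparr>dg_ob = {T. twisted_complex C T},
     dg_hom = tw_hom C,
     dg_diff = (\<lambda>S T n f. tw_diff0 C S T n f
       \<oplus>\<^bsub>tw_hom C S T (n - 1)\<^esub> tw_comp C S T T (-1) n (snd T) f
       \<oplus>\<^bsub>tw_hom C S T (n - 1)\<^esub> ksgn (tw_hom C S T (n - 1)) (n + 1) (tw_comp C S S T n (-1) f (snd S))),
     dg_comp = tw_comp C,
     dg_id = (\<lambda>T. matrix (tw_len T) (tw_len T)
       (\<lambda>i j. if i = j then dg_id C (tw_ob T i) else \<zero>\<^bsub>entry_hom C T T 0 i j\<^esub>))\<rparr>"

definition tw_single :: "('k, 'o, 'm) dgcat \<Rightarrow> 'o \<Rightarrow> int \<Rightarrow> ('o, 'm) twc"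
  where "tw_single C X r = ([(X, r)], matrix 1 1 (\<lambda>i j. \<zero>\<^bsub>dg_hom C X X (-1)\<^esub>))"

definition pretr_emb :: "('k, 'o, 'm) dgcat \<Rightarrow> ('o, 'm, ('o, 'm) twc, nat \<Rightarrow> nat \<Rightarrow> 'm) dgfun"
  where "pretr_emb C = \<lparr>fun_ob = (\<lambda>X. tw_single C X 0), fun_mor = (\<lambda>X Y n f. matrix 1 1 (\<lambda>i j. f))\<rparr>"

definition pretriangulated :: "('k, 'r) ring_scheme \<Rightarrow> ('k, 'o, 'm) dgcat \<Rightarrow> bool"
  where "pretriangulated R C \<longleftrightarrow> dg_category R C \<and> quasi_equivalence R C (pretr C) (pretr_emb C)"

definition tw_cone :: "('k, 'o, 'm) dgcat \<Rightarrow> 'o \<Rightarrow> 'o \<Rightarrow> 'm \<Rightarrow> ('o, 'm) twc"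
  where "tw_cone C A B f = ([(B, 0), (A, 1)], matrix 2 2
    (\<lambda>i j. if i = 0 \<and> j = 1 then f
           else \<zero>\<^bsub>dg_hom C ([B, A] ! j) ([B, A] ! i) (-1 + int j - int i)\<^esub>))"

definition cone_in :: "('k, 'o, 'm) dgcat \<Rightarrow> 'o \<Rightarrow> 'o \<Rightarrow> nat \<Rightarrow> nat \<Rightarrow> 'm"
  where "cone_in C A B = matrix 2 1 (\<lambda>i j. if i = 0 then dg_id C B else \<zero>\<^bsub>dg_hom C B A (-1)\<^esub>)"

definition cone_out :: "('k, 'o, 'm) dgcat \<Rightarrow> 'o \<Rightarrow> 'o \<Rightarrow> nat \<Rightarrow> nat \<Rightarrow> 'm"
  where "cone_out C A B = matrix 1 2 (\<lambda>i j. if j = 0 then \<zero>\<^bsub>dg_hom C B A (-1)\<^esub> else dg_id C A)"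

text \<open>
  The object \<open>S\<close> of \<open>C\<close> is a suspension of \<open>A\<close>, via the isomorphism \<open>\<sigma> : S \<cong> \<Sigma> A\<close> of
  \<open>H\<^sub>0(pretr C)\<close>.
\<close>

definition suspension :: "('k, 'o, 'm) dgcat \<Rightarrow> 'o \<Rightarrow> 'o \<Rightarrow> (nat \<Rightarrow> nat \<Rightarrow> 'm) \<Rightarrow> bool"
  where "suspension C A S \<sigma> \<longleftrightarrow> A \<in> dg_ob C \<and> S \<in> dg_ob C \<and> H0_iso (pretr C) (tw_single C S 0) (tw_single C A 1) \<sigma>"

text \<open>
  \<open>A \<rightarrow> B \<rightarrow> K \<rightarrow> S\<close> given by \<open>x\<close>, \<open>y\<close>, \<open>z\<close>, with \<open>S\<close> identified with \<open>\<Sigma> A\<close> by \<open>\<sigma>\<close>, is isomorphic in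
  \<open>H\<^sub>0(pretr C)\<close> to the standard triangle \<open>A' \<rightarrow> B' \<rightarrow> Cone(f) \<rightarrow> \<Sigma> A'\<close> of some \<open>f\<close>. As \<open>a\<close> has degree
  \<open>0\<close>, the matrix of \<open>a\<close> is also that of \<open>\<Sigma> a\<close>.
\<close>

definition exact_triangle :: "('k, 'o, 'm) dgcat \<Rightarrow> 'o \<Rightarrow> 'o \<Rightarrow> 'o \<Rightarrow> 'o \<Rightarrow> (nat \<Rightarrow> nat \<Rightarrow> 'm) \<Rightarrow>
    'm \<Rightarrow> 'm \<Rightarrow> 'm \<Rightarrow> bool"
  where "exact_triangle C A B K S \<sigma> x y z \<longleftrightarrow>
    A \<in> dg_ob C \<and> B \<in> dg_ob C \<and> K \<in> dg_ob C \<and> suspension C A S \<sigma>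
    \<and> x \<in> cycles C A B 0 \<and> y \<in> cycles C B K 0 \<and> z \<in> cycles C K S 0
    \<and> (\<exists>A'\<in>dg_ob C. \<exists>B'\<in>dg_ob C. \<exists>f\<in>cycles C A' B' 0. \<exists>a b c.
        (let P = pretr C; \<iota> = (\<lambda>X. tw_single C X 0); \<Sigma> = (\<lambda>X. tw_single C X 1);
             e = (\<lambda>u. matrix 1 1 (\<lambda>i j. u)); Q = tw_cone C A' B' f in
          H0_iso P (\<iota> A) (\<iota> A') a \<and> H0_iso P (\<iota> B) (\<iota> B') b \<and> H0_iso P (\<iota> K) Q c
          \<and> homologous P (\<iota> A) (\<iota> B') 0
              (dg_comp P (\<iota> A) (\<iota> B) (\<iota> B') 0 0 b (e x))
              (dg_comp P (\<iota> A) (\<iota> A') (\<iota> B') 0 0 (e f) a)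
          \<and> homologous P (\<iota> B) Q 0
              (dg_comp P (\<iota> B) (\<iota> K) Q 0 0 c (e y))
              (dg_comp P (\<iota> B) (\<iota> B') Q 0 0 (cone_in C A' B') b)
          \<and> homologous P (\<iota> K) (\<Sigma> A') 0
              (dg_comp P (\<iota> K) (\<Sigma> A) (\<Sigma> A') 0 0 a (dg_comp P (\<iota> K) (\<iota> S) (\<Sigma> A) 0 0 \<sigma> (e z)))
              (dg_comp P (\<iota> K) Q (\<Sigma> A') 0 0 (cone_out C A' B') c)))"

end

theory Submission
  imports Defs
begin

text \<open>
  The three categories are connected by quasi-equivalences without intermediate steps, because all of
  them satisfy the same universal property: each is obtained from \<open>C\<close> by freely making \<open>B\<close>
  contractible.

  Call \<open>B\<close> contractible if its identity is a boundary. In \<open>C/B\<close> it is so by construction. In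
  \<open>(C/x)/y\<close> and \<open>(C/y)/x\<close> both maps of the triangle are null homotopic; the identity of \<open>B\<close> dies after
  composition with \<open>y\<close>, so it factors through \<open>x\<close> up to homotopy, and so it is null homotopic
  (\<open>contractible_of_cone\<close>, \<open>exact_triangle_contractible\<close>).

  Conversely let \<open>E\<close> be a dg category under \<open>C\<close>, with the same objects, in which \<open>B\<close> is contractible. Then all complexes of
  morphisms of \<open>E\<close> into or out of \<open>B\<close> are acyclic. A functor from a free extension of \<open>C\<close> to \<open>E\<close>
  amounts to a choice of null homotopies in \<open>E\<close> of the killed morphisms. If these start or
  end at \<open>B\<close>, such null homotopies exist, and any two of them differ by a boundary, so that any two functors under \<open>C\<close>
  are homotopic (\<open>extension_exists\<close>, \<open>homotopic_extension\<close>, \<open>unique_extension\<close>). Hence any two of the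
  three categories are connected by maps in both directions whose composites are homotopic to the
  identities, and such maps are quasi-equivalences (\<open>weq_under_of_unique\<close>,
  \<open>homotopy_equivalence_quasi_equivalence\<close>).

  A homotopy between dg functors is a derivation of degree \<open>1\<close>, and the differential of a free extension
  is a derivation of degree \<open>-1\<close>. Both are obtained from the universal property of the underlying graded
  category, by viewing derivations as functors into a category of triples (\<open>der_cat\<close>).
\<close>

section \<open>Graded categories\<close>

text \<open>
  The differential of a free extension is only known to be well defined once its homs are known to
  form a graded linear category. Linear algebra in the homs is therefore developed without a
  differential.
\<close>

locale graded_category = cring R for R :: "('k, 'r) ring_scheme" (structure) +
  fixes C :: "('k, 'o, 'm) dgcat"
  assumes hom_module: "\<And>X Y n. X \<in> dg_ob C \<Longrightarrow> Y \<in> dg_ob C \<Longrightarrow> module R (dg_hom C X Y n)"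
    and comp_hom_left: "\<And>X Y Z m n f. X \<in> dg_ob C \<Longrightarrow> Y \<in> dg_ob C \<Longrightarrow> Z \<in> dg_ob C \<Longrightarrow>
      f \<in> carrier (dg_hom C X Y n) \<Longrightarrow>
      (\<lambda>g. dg_comp C X Y Z m n g f) \<in> module_hom R (dg_hom C Y Z m) (dg_hom C X Z (m + n))"
    and comp_hom_right: "\<And>X Y Z m n g. X \<in> dg_ob C \<Longrightarrow> Y \<in> dg_ob C \<Longrightarrow> Z \<in> dg_ob C \<Longrightarrow>
      g \<in> carrier (dg_hom C Y Z m) \<Longrightarrow>
      (\<lambda>f. dg_comp C X Y Z m n g f) \<in> module_hom R (dg_hom C X Y n) (dg_hom C X Z (m + n))"
    and comp_assoc: "\<And>W X Y Z l m n h g f. W \<in> dg_ob C \<Longrightarrow> X \<in> dg_ob C \<Longrightarrow> Y \<in> dg_ob C \<Longrightarrow>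
      Z \<in> dg_ob C \<Longrightarrow> h \<in> carrier (dg_hom C Y Z l) \<Longrightarrow> g \<in> carrier (dg_hom C X Y m) \<Longrightarrow>
      f \<in> carrier (dg_hom C W X n) \<Longrightarrow>
      dg_comp C W X Z (l + m) n (dg_comp C X Y Z l m h g) f =
        dg_comp C W Y Z l (m + n) h (dg_comp C W X Y m n g f)"
    and id_closed: "\<And>X. X \<in> dg_ob C \<Longrightarrow> dg_id C X \<in> carrier (dg_hom C X X 0)"
    and comp_id_right: "\<And>X Y n f. X \<in> dg_ob C \<Longrightarrow> Y \<in> dg_ob C \<Longrightarrow>
      f \<in> carrier (dg_hom C X Y n) \<Longrightarrow> dg_comp C X X Y n 0 f (dg_id C X) = f"
    and comp_id_left: "\<And>X Y n f. X \<in> dg_ob C \<Longrightarrow> Y \<in> dg_ob C \<Longrightarrow>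
      f \<in> carrier (dg_hom C X Y n) \<Longrightarrow> dg_comp C X Y Y 0 n (dg_id C Y) f = f"
begin

declare id_closed [simp, intro] comp_id_right [simp] comp_id_left [simp]

lemma hom_abelian_group [intro]:
  "X \<in> dg_ob C \<Longrightarrow> Y \<in> dg_ob C \<Longrightarrow> abelian_group (dg_hom C X Y n)"
  using hom_module module_def by blast

lemma hom_add_closed [simp, intro]:
  "\<lbrakk>X \<in> dg_ob C; Y \<in> dg_ob C; f \<in> carrier (dg_hom C X Y n); g \<in> carrier (dg_hom C X Y n)\<rbrakk>
    \<Longrightarrow> f \<oplus>\<^bsub>dg_hom C X Y n\<^esub> g \<in> carrier (dg_hom C X Y n)"
  by (meson abelian_groupE(1) hom_abelian_group)

lemma hom_zero_closed [simp, intro]: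
  "\<lbrakk>X \<in> dg_ob C; Y \<in> dg_ob C\<rbrakk> \<Longrightarrow> \<zero>\<^bsub>dg_hom C X Y n\<^esub> \<in> carrier (dg_hom C X Y n)"
  by (meson abelian_groupE(2) hom_abelian_group)

lemma hom_minus_closed [simp, intro]:
  "\<lbrakk>X \<in> dg_ob C; Y \<in> dg_ob C; f \<in> carrier (dg_hom C X Y n)\<rbrakk>
    \<Longrightarrow> \<ominus>\<^bsub>dg_hom C X Y n\<^esub> f \<in> carrier (dg_hom C X Y n)"
  by (meson abelian_group.a_inv_closed hom_abelian_group)

lemma hom_smult_closed [simp, intro]:
  "\<lbrakk>X \<in> dg_ob C; Y \<in> dg_ob C; a \<in> carrier R; f \<in> carrier (dg_hom C X Y n)\<rbrakk>
    \<Longrightarrow> a \<odot>\<^bsub>dg_hom C X Y n\<^esub> f \<in> carrier (dg_hom C X Y n)"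
  by (meson module.smult_closed hom_module)

lemma hom_zero_add [simp]:
  assumes "X \<in> dg_ob C" "Y \<in> dg_ob C" "f \<in> carrier (dg_hom C X Y n)"
  shows "\<zero>\<^bsub>dg_hom C X Y n\<^esub> \<oplus>\<^bsub>dg_hom C X Y n\<^esub> f = f" "f \<oplus>\<^bsub>dg_hom C X Y n\<^esub> \<zero>\<^bsub>dg_hom C X Y n\<^esub> = f"
proof -
  interpret M: abelian_group "dg_hom C X Y n" using assms by blast
  show "\<zero>\<^bsub>dg_hom C X Y n\<^esub> \<oplus>\<^bsub>dg_hom C X Y n\<^esub> f = f" "f \<oplus>\<^bsub>dg_hom C X Y n\<^esub> \<zero>\<^bsub>dg_hom C X Y n\<^esub> = f"
    using assms by simp_all
qed

lemma hom_minus [simp]: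
  assumes "X \<in> dg_ob C" "Y \<in> dg_ob C"
  shows "\<ominus>\<^bsub>dg_hom C X Y n\<^esub> \<zero>\<^bsub>dg_hom C X Y n\<^esub> = \<zero>\<^bsub>dg_hom C X Y n\<^esub>"
    and "f \<in> carrier (dg_hom C X Y n) \<Longrightarrow> \<ominus>\<^bsub>dg_hom C X Y n\<^esub> (\<ominus>\<^bsub>dg_hom C X Y n\<^esub> f) = f"
    and "f \<in> carrier (dg_hom C X Y n) \<Longrightarrow> g \<in> carrier (dg_hom C X Y n) \<Longrightarrow>
      \<ominus>\<^bsub>dg_hom C X Y n\<^esub> (f \<oplus>\<^bsub>dg_hom C X Y n\<^esub> g) = \<ominus>\<^bsub>dg_hom C X Y n\<^esub> f \<oplus>\<^bsub>dg_hom C X Y n\<^esub> \<ominus>\<^bsub>dg_hom C X Y n\<^esub> g"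
    and "f \<in> carrier (dg_hom C X Y n) \<Longrightarrow> f \<oplus>\<^bsub>dg_hom C X Y n\<^esub> \<ominus>\<^bsub>dg_hom C X Y n\<^esub> f = \<zero>\<^bsub>dg_hom C X Y n\<^esub>"
    and "f \<in> carrier (dg_hom C X Y n) \<Longrightarrow> \<ominus>\<^bsub>dg_hom C X Y n\<^esub> f \<oplus>\<^bsub>dg_hom C X Y n\<^esub> f = \<zero>\<^bsub>dg_hom C X Y n\<^esub>"
    and "f \<in> carrier (dg_hom C X Y n) \<Longrightarrow> g \<in> carrier (dg_hom C X Y n) \<Longrightarrow>
      f \<oplus>\<^bsub>dg_hom C X Y n\<^esub> (\<ominus>\<^bsub>dg_hom C X Y n\<^esub> f \<oplus>\<^bsub>dg_hom C X Y n\<^esub> g) = g"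
    and "f \<in> carrier (dg_hom C X Y n) \<Longrightarrow> g \<in> carrier (dg_hom C X Y n) \<Longrightarrow>
      \<ominus>\<^bsub>dg_hom C X Y n\<^esub> f \<oplus>\<^bsub>dg_hom C X Y n\<^esub> (f \<oplus>\<^bsub>dg_hom C X Y n\<^esub> g) = g"
proof -
  interpret M: abelian_group "dg_hom C X Y n" using assms by blast
  show "\<ominus>\<^bsub>dg_hom C X Y n\<^esub> \<zero>\<^bsub>dg_hom C X Y n\<^esub> = \<zero>\<^bsub>dg_hom C X Y n\<^esub>"
    and "f \<in> carrier (dg_hom C X Y n) \<Longrightarrow> \<ominus>\<^bsub>dg_hom C X Y n\<^esub> (\<ominus>\<^bsub>dg_hom C X Y n\<^esub> f) = f"
    and "f \<in> carrier (dg_hom C X Y n) \<Longrightarrow> g \<in> carrier (dg_hom C X Y n) \<Longrightarrow>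
      \<ominus>\<^bsub>dg_hom C X Y n\<^esub> (f \<oplus>\<^bsub>dg_hom C X Y n\<^esub> g) = \<ominus>\<^bsub>dg_hom C X Y n\<^esub> f \<oplus>\<^bsub>dg_hom C X Y n\<^esub> \<ominus>\<^bsub>dg_hom C X Y n\<^esub> g"
    and "f \<in> carrier (dg_hom C X Y n) \<Longrightarrow> f \<oplus>\<^bsub>dg_hom C X Y n\<^esub> \<ominus>\<^bsub>dg_hom C X Y n\<^esub> f = \<zero>\<^bsub>dg_hom C X Y n\<^esub>"
    and "f \<in> carrier (dg_hom C X Y n) \<Longrightarrow> \<ominus>\<^bsub>dg_hom C X Y n\<^esub> f \<oplus>\<^bsub>dg_hom C X Y n\<^esub> f = \<zero>\<^bsub>dg_hom C X Y n\<^esub>"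
    and "f \<in> carrier (dg_hom C X Y n) \<Longrightarrow> g \<in> carrier (dg_hom C X Y n) \<Longrightarrow>
      f \<oplus>\<^bsub>dg_hom C X Y n\<^esub> (\<ominus>\<^bsub>dg_hom C X Y n\<^esub> f \<oplus>\<^bsub>dg_hom C X Y n\<^esub> g) = g"
    and "f \<in> carrier (dg_hom C X Y n) \<Longrightarrow> g \<in> carrier (dg_hom C X Y n) \<Longrightarrow>
      \<ominus>\<^bsub>dg_hom C X Y n\<^esub> f \<oplus>\<^bsub>dg_hom C X Y n\<^esub> (f \<oplus>\<^bsub>dg_hom C X Y n\<^esub> g) = g"
    by (simp_all add: M.minus_add M.r_neg M.l_neg M.r_neg1 M.r_neg2)
qed

lemma hom_add_assoc:
  "\<lbrakk>X \<in> dg_ob C; Y \<in> dg_ob C; f \<in> carrier (dg_hom C X Y n); g \<in> carrier (dg_hom C X Y n);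
    h \<in> carrier (dg_hom C X Y n)\<rbrakk> \<Longrightarrow>
    f \<oplus>\<^bsub>dg_hom C X Y n\<^esub> g \<oplus>\<^bsub>dg_hom C X Y n\<^esub> h = f \<oplus>\<^bsub>dg_hom C X Y n\<^esub> (g \<oplus>\<^bsub>dg_hom C X Y n\<^esub> h)"
  by (meson abelian_groupE(3) hom_abelian_group)

lemma hom_add_comm:
  "\<lbrakk>X \<in> dg_ob C; Y \<in> dg_ob C; f \<in> carrier (dg_hom C X Y n); g \<in> carrier (dg_hom C X Y n)\<rbrakk> \<Longrightarrow>
    f \<oplus>\<^bsub>dg_hom C X Y n\<^esub> g = g \<oplus>\<^bsub>dg_hom C X Y n\<^esub> f"
  by (meson abelian_groupE(4) hom_abelian_group)

lemma hom_add_left_comm: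
  assumes "X \<in> dg_ob C" "Y \<in> dg_ob C" "f \<in> carrier (dg_hom C X Y n)" "g \<in> carrier (dg_hom C X Y n)"
    "h \<in> carrier (dg_hom C X Y n)"
  shows "f \<oplus>\<^bsub>dg_hom C X Y n\<^esub> (g \<oplus>\<^bsub>dg_hom C X Y n\<^esub> h) = g \<oplus>\<^bsub>dg_hom C X Y n\<^esub> (f \<oplus>\<^bsub>dg_hom C X Y n\<^esub> h)"
proof -
  interpret M: abelian_group "dg_hom C X Y n" using assms by blast
  show ?thesis using assms by (simp add: M.a_lcomm)
qed

lemmas hom_ac = hom_add_assoc hom_add_comm hom_add_left_comm

lemma hom_eqI:
  assumes "X \<in> dg_ob C" "Y \<in> dg_ob C" "f \<in> carrier (dg_hom C X Y n)" "g \<in> carrier (dg_hom C X Y n)"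
    and "f \<oplus>\<^bsub>dg_hom C X Y n\<^esub> \<ominus>\<^bsub>dg_hom C X Y n\<^esub> g = \<zero>\<^bsub>dg_hom C X Y n\<^esub>"
  shows "f = g"
  using assms by (metis hom_add_assoc hom_minus(5) hom_minus_closed hom_zero_add)

lemma hom_cancel:
  assumes "X \<in> dg_ob C" "Y \<in> dg_ob C" "f \<in> carrier (dg_hom C X Y n)" "g \<in> carrier (dg_hom C X Y n)"
    and "h \<in> carrier (dg_hom C X Y n)"
  shows "f \<oplus>\<^bsub>dg_hom C X Y n\<^esub> (g \<oplus>\<^bsub>dg_hom C X Y n\<^esub> (\<ominus>\<^bsub>dg_hom C X Y n\<^esub> f \<oplus>\<^bsub>dg_hom C X Y n\<^esub> h)) =
    g \<oplus>\<^bsub>dg_hom C X Y n\<^esub> h"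
  using assms hom_add_left_comm[of X Y f n g] by simp

lemma hom_smult:
  assumes "X \<in> dg_ob C" "Y \<in> dg_ob C" "f \<in> carrier (dg_hom C X Y n)"
  shows "a \<in> carrier R \<Longrightarrow> g \<in> carrier (dg_hom C X Y n) \<Longrightarrow> a \<odot>\<^bsub>dg_hom C X Y n\<^esub> (f \<oplus>\<^bsub>dg_hom C X Y n\<^esub> g) =
      a \<odot>\<^bsub>dg_hom C X Y n\<^esub> f \<oplus>\<^bsub>dg_hom C X Y n\<^esub> a \<odot>\<^bsub>dg_hom C X Y n\<^esub> g"
    and "a \<in> carrier R \<Longrightarrow> a \<odot>\<^bsub>dg_hom C X Y n\<^esub> (\<ominus>\<^bsub>dg_hom C X Y n\<^esub> f) = \<ominus>\<^bsub>dg_hom C X Y n\<^esub> (a \<odot>\<^bsub>dg_hom C X Y n\<^esub> f)"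
    and "(\<ominus> \<one>) \<odot>\<^bsub>dg_hom C X Y n\<^esub> f = \<ominus>\<^bsub>dg_hom C X Y n\<^esub> f"
    and "\<one> \<odot>\<^bsub>dg_hom C X Y n\<^esub> f = f"
    and "a \<in> carrier R \<Longrightarrow> b \<in> carrier R \<Longrightarrow> (a \<oplus> b) \<odot>\<^bsub>dg_hom C X Y n\<^esub> f =
      a \<odot>\<^bsub>dg_hom C X Y n\<^esub> f \<oplus>\<^bsub>dg_hom C X Y n\<^esub> b \<odot>\<^bsub>dg_hom C X Y n\<^esub> f"
    and "a \<in> carrier R \<Longrightarrow> b \<in> carrier R \<Longrightarrow> (a \<otimes> b) \<odot>\<^bsub>dg_hom C X Y n\<^esub> f = a \<odot>\<^bsub>dg_hom C X Y n\<^esub> (b \<odot>\<^bsub>dg_hom C X Y n\<^esub> f)"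
    and "\<zero> \<odot>\<^bsub>dg_hom C X Y n\<^esub> f = \<zero>\<^bsub>dg_hom C X Y n\<^esub>"
proof -
  interpret M: module R "dg_hom C X Y n" using assms hom_module by blast
  note simps = M.smult_r_distr M.smult_l_distr M.smult_l_minus M.smult_r_minus M.smult_assoc1
  show "a \<in> carrier R \<Longrightarrow> g \<in> carrier (dg_hom C X Y n) \<Longrightarrow> a \<odot>\<^bsub>dg_hom C X Y n\<^esub> (f \<oplus>\<^bsub>dg_hom C X Y n\<^esub> g) =
      a \<odot>\<^bsub>dg_hom C X Y n\<^esub> f \<oplus>\<^bsub>dg_hom C X Y n\<^esub> a \<odot>\<^bsub>dg_hom C X Y n\<^esub> g"
    and "a \<in> carrier R \<Longrightarrow> a \<odot>\<^bsub>dg_hom C X Y n\<^esub> (\<ominus>\<^bsub>dg_hom C X Y n\<^esub> f) = \<ominus>\<^bsub>dg_hom C X Y n\<^esub> (a \<odot>\<^bsub>dg_hom C X Y n\<^esub> f)"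
    and "(\<ominus> \<one>) \<odot>\<^bsub>dg_hom C X Y n\<^esub> f = \<ominus>\<^bsub>dg_hom C X Y n\<^esub> f"
    and "\<one> \<odot>\<^bsub>dg_hom C X Y n\<^esub> f = f"
    and "a \<in> carrier R \<Longrightarrow> b \<in> carrier R \<Longrightarrow> (a \<oplus> b) \<odot>\<^bsub>dg_hom C X Y n\<^esub> f =
      a \<odot>\<^bsub>dg_hom C X Y n\<^esub> f \<oplus>\<^bsub>dg_hom C X Y n\<^esub> b \<odot>\<^bsub>dg_hom C X Y n\<^esub> f"
    and "a \<in> carrier R \<Longrightarrow> b \<in> carrier R \<Longrightarrow> (a \<otimes> b) \<odot>\<^bsub>dg_hom C X Y n\<^esub> f = a \<odot>\<^bsub>dg_hom C X Y n\<^esub> (b \<odot>\<^bsub>dg_hom C X Y n\<^esub> f)"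
    and "\<zero> \<odot>\<^bsub>dg_hom C X Y n\<^esub> f = \<zero>\<^bsub>dg_hom C X Y n\<^esub>"
    using assms by (simp_all add: simps)
qed

lemma hom_smult_zero [simp]:
  "\<lbrakk>X \<in> dg_ob C; Y \<in> dg_ob C; a \<in> carrier R\<rbrakk> \<Longrightarrow>
    a \<odot>\<^bsub>dg_hom C X Y n\<^esub> \<zero>\<^bsub>dg_hom C X Y n\<^esub> = \<zero>\<^bsub>dg_hom C X Y n\<^esub>"
  by (meson hom_module module.smult_r_null)

end

lemma module_homD:
  assumes "\<phi> \<in> module_hom R M N"
  shows "x \<in> carrier M \<Longrightarrow> \<phi> x \<in> carrier N"
    and "x \<in> carrier M \<Longrightarrow> y \<in> carrier M \<Longrightarrow> \<phi> (x \<oplus>\<^bsub>M\<^esub> y) = \<phi> x \<oplus>\<^bsub>N\<^esub> \<phi> y"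
    and "a \<in> carrier R \<Longrightarrow> x \<in> carrier M \<Longrightarrow> \<phi> (a \<odot>\<^bsub>M\<^esub> x) = a \<odot>\<^bsub>N\<^esub> \<phi> x"
  using assms by (auto simp: module_hom_def)

lemma module_hom_zero:
  assumes "\<phi> \<in> module_hom R M N" "abelian_group M" "abelian_group N"
  shows "\<phi> \<zero>\<^bsub>M\<^esub> = \<zero>\<^bsub>N\<^esub>"
proof -
  interpret M: abelian_group M by fact
  interpret N: abelian_group N by fact
  have "\<phi> \<zero>\<^bsub>M\<^esub> \<oplus>\<^bsub>N\<^esub> \<phi> \<zero>\<^bsub>M\<^esub> = \<phi> \<zero>\<^bsub>M\<^esub>" "\<phi> \<zero>\<^bsub>M\<^esub> \<in> carrier N"
    using module_homD[OF assms(1)] by (metis M.zero_closed M.l_zero, blast)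
  then show ?thesis by (metis N.add.r_cancel_one')
qed

lemma module_hom_minus:
  assumes "\<phi> \<in> module_hom R M N" "abelian_group M" "abelian_group N" "x \<in> carrier M"
  shows "\<phi> (\<ominus>\<^bsub>M\<^esub> x) = \<ominus>\<^bsub>N\<^esub> \<phi> x"
proof -
  interpret M: abelian_group M by fact
  interpret N: abelian_group N by fact
  have "\<phi> (\<ominus>\<^bsub>M\<^esub> x) \<oplus>\<^bsub>N\<^esub> \<phi> x = \<zero>\<^bsub>N\<^esub>"
    using module_homD(2)[OF assms(1)] assms(4) module_hom_zero[OF assms(1-3)]
    by (metis M.a_inv_closed M.l_neg)
  then show ?thesis using module_homD(1)[OF assms(1)] assms(4) M.a_inv_closed N.minus_equality by metis
qed

context graded_category
begin

text \<open>
  Degrees occur in the types of homs only through integer terms, so \<open>m - 1 + n\<close> and \<open>m + n - 1\<close> name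
  syntactically different homs. Membership rules leave the degree of the result free and ask for an
  arithmetical identity, which lets the simplifier move between such names.
\<close>

lemma comp_closed [simp, intro]:
  "\<lbrakk>X \<in> dg_ob C; Y \<in> dg_ob C; Z \<in> dg_ob C; g \<in> carrier (dg_hom C Y Z m);
    f \<in> carrier (dg_hom C X Y n); k = m + n\<rbrakk> \<Longrightarrow> dg_comp C X Y Z m n g f \<in> carrier (dg_hom C X Z k)"
  using module_homD(1)[OF comp_hom_left] by blast

lemma comp_left [simp]:
  assumes "X \<in> dg_ob C" "Y \<in> dg_ob C" "Z \<in> dg_ob C" "f \<in> carrier (dg_hom C X Y n)"
  shows "g \<in> carrier (dg_hom C Y Z m) \<Longrightarrow> g' \<in> carrier (dg_hom C Y Z m) \<Longrightarrow>
      dg_comp C X Y Z m n (g \<oplus>\<^bsub>dg_hom C Y Z m\<^esub> g') f =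
      dg_comp C X Y Z m n g f \<oplus>\<^bsub>dg_hom C X Z (m + n)\<^esub> dg_comp C X Y Z m n g' f"
    and "a \<in> carrier R \<Longrightarrow> g \<in> carrier (dg_hom C Y Z m) \<Longrightarrow>
      dg_comp C X Y Z m n (a \<odot>\<^bsub>dg_hom C Y Z m\<^esub> g) f = a \<odot>\<^bsub>dg_hom C X Z (m + n)\<^esub> dg_comp C X Y Z m n g f"
    and "dg_comp C X Y Z m n \<zero>\<^bsub>dg_hom C Y Z m\<^esub> f = \<zero>\<^bsub>dg_hom C X Z (m + n)\<^esub>"
    and "g \<in> carrier (dg_hom C Y Z m) \<Longrightarrow>
      dg_comp C X Y Z m n (\<ominus>\<^bsub>dg_hom C Y Z m\<^esub> g) f = \<ominus>\<^bsub>dg_hom C X Z (m + n)\<^esub> dg_comp C X Y Z m n g f"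
  using module_homD(2,3)[OF comp_hom_left[OF assms]]
    module_hom_zero[OF comp_hom_left[OF assms]] module_hom_minus[OF comp_hom_left[OF assms]] assms
  by (simp_all add: hom_abelian_group)

lemma comp_right [simp]:
  assumes "X \<in> dg_ob C" "Y \<in> dg_ob C" "Z \<in> dg_ob C" "g \<in> carrier (dg_hom C Y Z m)"
  shows "f \<in> carrier (dg_hom C X Y n) \<Longrightarrow> f' \<in> carrier (dg_hom C X Y n) \<Longrightarrow>
      dg_comp C X Y Z m n g (f \<oplus>\<^bsub>dg_hom C X Y n\<^esub> f') =
      dg_comp C X Y Z m n g f \<oplus>\<^bsub>dg_hom C X Z (m + n)\<^esub> dg_comp C X Y Z m n g f'"
    and "a \<in> carrier R \<Longrightarrow> f \<in> carrier (dg_hom C X Y n) \<Longrightarrow>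
      dg_comp C X Y Z m n g (a \<odot>\<^bsub>dg_hom C X Y n\<^esub> f) = a \<odot>\<^bsub>dg_hom C X Z (m + n)\<^esub> dg_comp C X Y Z m n g f"
    and "dg_comp C X Y Z m n g \<zero>\<^bsub>dg_hom C X Y n\<^esub> = \<zero>\<^bsub>dg_hom C X Z (m + n)\<^esub>"
    and "f \<in> carrier (dg_hom C X Y n) \<Longrightarrow>
      dg_comp C X Y Z m n g (\<ominus>\<^bsub>dg_hom C X Y n\<^esub> f) = \<ominus>\<^bsub>dg_hom C X Z (m + n)\<^esub> dg_comp C X Y Z m n g f"
  using module_homD(2,3)[OF comp_hom_right[OF assms]]
    module_hom_zero[OF comp_hom_right[OF assms]] module_hom_minus[OF comp_hom_right[OF assms]] assms
  by (simp_all add: hom_abelian_group)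

lemma ksgn_closed [simp, intro]:
  "\<lbrakk>X \<in> dg_ob C; Y \<in> dg_ob C; f \<in> carrier (dg_hom C X Y n)\<rbrakk> \<Longrightarrow> ksgn (dg_hom C X Y n) p f \<in> carrier (dg_hom C X Y n)"
  by (simp add: ksgn_def)

end

sublocale dg_category \<subseteq> graded_category
  by (rule graded_category.intro, rule is_cring, rule graded_category_axioms.intro)
    (fact hom_module, fact comp_hom_left, fact comp_hom_right, fact comp_assoc, fact id_closed,
      fact comp_id_right, fact comp_id_left)

lemma dg_categoryI:
  assumes "graded_category R C"
    and "\<And>X Y n. X \<in> dg_ob C \<Longrightarrow> Y \<in> dg_ob C \<Longrightarrow>
      dg_diff C X Y n \<in> module_hom R (dg_hom C X Y n) (dg_hom C X Y (n - 1))"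
    and "\<And>X Y n f. X \<in> dg_ob C \<Longrightarrow> Y \<in> dg_ob C \<Longrightarrow> f \<in> carrier (dg_hom C X Y n) \<Longrightarrow>
      dg_diff C X Y (n - 1) (dg_diff C X Y n f) = \<zero>\<^bsub>dg_hom C X Y (n - 2)\<^esub>"
    and "\<And>X Y Z m n g f. X \<in> dg_ob C \<Longrightarrow> Y \<in> dg_ob C \<Longrightarrow> Z \<in> dg_ob C \<Longrightarrow>
      g \<in> carrier (dg_hom C Y Z m) \<Longrightarrow> f \<in> carrier (dg_hom C X Y n) \<Longrightarrow>
      dg_diff C X Z (m + n) (dg_comp C X Y Z m n g f) =
        dg_comp C X Y Z (m - 1) n (dg_diff C Y Z m g) f
        \<oplus>\<^bsub>dg_hom C X Z (m + n - 1)\<^esub>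
        ksgn (dg_hom C X Z (m + n - 1)) m (dg_comp C X Y Z m (n - 1) g (dg_diff C X Y n f))"
    and "\<And>X. X \<in> dg_ob C \<Longrightarrow> dg_diff C X X 0 (dg_id C X) = \<zero>\<^bsub>dg_hom C X X (-1)\<^esub>"
  shows "dg_category R C"
proof -
  interpret graded_category R C by fact
  show ?thesis
    by (rule dg_category.intro, rule is_cring, rule dg_category_axioms.intro)
      (fact hom_module, fact assms(2), fact assms(3), fact comp_hom_left, fact comp_hom_right, fact assms(4),
        fact comp_assoc, fact id_closed, fact assms(5), fact comp_id_right, fact comp_id_left)
qed

context dg_category
begin

lemma diff_closed [simp, intro]:
  "\<lbrakk>X \<in> dg_ob C; Y \<in> dg_ob C; f \<in> carrier (dg_hom C X Y n); k = n - 1\<rbrakk> \<Longrightarrow>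
    dg_diff C X Y n f \<in> carrier (dg_hom C X Y k)"
  using module_homD(1)[OF diff_hom] by blast

lemma diff_linear [simp]:
  assumes "X \<in> dg_ob C" "Y \<in> dg_ob C"
  shows "f \<in> carrier (dg_hom C X Y n) \<Longrightarrow> g \<in> carrier (dg_hom C X Y n) \<Longrightarrow>
      dg_diff C X Y n (f \<oplus>\<^bsub>dg_hom C X Y n\<^esub> g) =
      dg_diff C X Y n f \<oplus>\<^bsub>dg_hom C X Y (n - 1)\<^esub> dg_diff C X Y n g"
    and "a \<in> carrier R \<Longrightarrow> f \<in> carrier (dg_hom C X Y n) \<Longrightarrow>
      dg_diff C X Y n (a \<odot>\<^bsub>dg_hom C X Y n\<^esub> f) = a \<odot>\<^bsub>dg_hom C X Y (n - 1)\<^esub> dg_diff C X Y n f"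
    and "dg_diff C X Y n \<zero>\<^bsub>dg_hom C X Y n\<^esub> = \<zero>\<^bsub>dg_hom C X Y (n - 1)\<^esub>"
    and "f \<in> carrier (dg_hom C X Y n) \<Longrightarrow>
      dg_diff C X Y n (\<ominus>\<^bsub>dg_hom C X Y n\<^esub> f) = \<ominus>\<^bsub>dg_hom C X Y (n - 1)\<^esub> dg_diff C X Y n f"
  using module_homD(2,3)[OF diff_hom[OF assms]]
    module_hom_zero[OF diff_hom[OF assms]] module_hom_minus[OF diff_hom[OF assms]] assms
  by (simp_all add: hom_abelian_group)

declare diff_id [simp]

lemma diff_diff' [simp]:
  assumes "X \<in> dg_ob C" "Y \<in> dg_ob C" "f \<in> carrier (dg_hom C X Y n)" "k = n - 1"
  shows "dg_diff C X Y k (dg_diff C X Y n f) = \<zero>\<^bsub>dg_hom C X Y (n - 2)\<^esub>"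
  using diff_diff assms by blast

end

section \<open>Free extensions as graded categories\<close>

text \<open>
  Source, target and degree of an expression are determined by its shape, which allows
  expressions to be evaluated by primitive recursion although the operations of a dg category are
  indexed by objects and degrees.
\<close>

primrec expr_src :: "('k, 'o, 'm) expr \<Rightarrow> 'o"
  where
    "expr_src (Old X Y n f) = X"
  | "expr_src (New X Y n v) = X"
  | "expr_src (Add s t) = expr_src s"
  | "expr_src (Scal a s) = expr_src s"
  | "expr_src (Comp t s) = expr_src s"

primrec expr_tgt :: "('k, 'o, 'm) expr \<Rightarrow> 'o"
  where
    "expr_tgt (Old X Y n f) = Y"
  | "expr_tgt (New X Y n v) = Y"
  | "expr_tgt (Add s t) = expr_tgt s"
  | "expr_tgt (Scal a s) = expr_tgt s"
  | "expr_tgt (Comp t s) = expr_tgt t"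

lemma is_expr_Comp:
  "is_expr R C V Y Z m t \<Longrightarrow> is_expr R C V X Y n s \<Longrightarrow> k = m + n \<Longrightarrow> is_expr R C V X Z k (Comp t s)"
  by (simp add: is_expr.Comp)

lemma dg_ob_adjoin [simp]: "dg_ob (adjoin R C V) = dg_ob C"
  by (simp add: adjoin_def)

locale free_extension = dg_category R C for R :: "('k, 'r) ring_scheme" (structure) and C :: "('k, 'o, 'm) dgcat" +
  fixes V :: "('o \<times> 'o \<times> int \<times> 'm) set"
  assumes generators: "\<And>X Y n v. (X, Y, n, v) \<in> V \<Longrightarrow> X \<in> dg_ob C \<and> Y \<in> dg_ob C \<and> v \<in> cycles C X Y n"
begin

abbreviation "isx \<equiv> is_expr R C V"
abbreviation "cls \<equiv> expr_class R C V"
abbreviation "G \<equiv> adjoin R C V"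

lemma is_expr_ob: "isx X Y n s \<Longrightarrow> X \<in> dg_ob C \<and> Y \<in> dg_ob C"
  by (induction rule: is_expr.induct) (auto dest: generators)

lemma is_expr_type: "isx X Y n s \<Longrightarrow> expr_src s = X \<and> expr_tgt s = Y \<and> expr_deg s = n"
  by (induction rule: is_expr.induct) auto

lemma is_expr_zero [simp, intro]:
  "\<lbrakk>X \<in> dg_ob C; Y \<in> dg_ob C\<rbrakk> \<Longrightarrow> isx X Y n (Old X Y n \<zero>\<^bsub>dg_hom C X Y n\<^esub>)"
  by (simp add: is_expr.Old)

lemma is_expr_id [simp, intro]: "X \<in> dg_ob C \<Longrightarrow> isx X X 0 (Old X X 0 (dg_id C X))"
  by (simp add: is_expr.Old)

lemma expr_eq_is_expr: "expr_eq R C V X Y n s t \<Longrightarrow> isx X Y n s \<and> isx X Y n t"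
proof (induction rule: expr_eq.induct)
  case (comp_assoc Y Z l u X m t W n s)
  then show ?case by (auto intro!: is_expr_Comp)
next
  case (comp_id_right X Y n s)
  then show ?case using is_expr_Comp[OF _ is_expr_id, of X Y n s n] is_expr_ob by auto
next
  case (comp_id_left X Y n s)
  then show ?case using is_expr_Comp[OF is_expr_id, of Y X n s n] is_expr_ob by auto
qed (auto intro: is_expr.intros is_expr_Comp dest: is_expr_ob)

lemma cls_eq_iff: "isx X Y n s \<Longrightarrow> cls X Y n s = cls X Y n t \<longleftrightarrow> expr_eq R C V X Y n s t"
  unfolding expr_class_def set_eq_iff mem_Collect_eq
  by (meson expr_eq.refl expr_eq.sym expr_eq.trans)

lemma cls_eqI: "expr_eq R C V X Y n s t \<Longrightarrow> cls X Y n s = cls X Y n t"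
  using cls_eq_iff expr_eq_is_expr by blast

lemma hom_cls [simp, intro]: "isx X Y n s \<Longrightarrow> cls X Y n s \<in> carrier (dg_hom G X Y n)"
  by (auto simp: adjoin_def)

lemma hom_clsE:
  assumes "S \<in> carrier (dg_hom G X Y n)"
  obtains s where "isx X Y n s" "S = cls X Y n s"
  using assms by (auto simp: adjoin_def)

lemma zero_cls: "\<zero>\<^bsub>dg_hom G X Y n\<^esub> = cls X Y n (Old X Y n \<zero>\<^bsub>dg_hom C X Y n\<^esub>)"
  by (simp add: adjoin_def)

lemma id_cls: "dg_id G X = cls X X 0 (Old X X 0 (dg_id C X))"
  by (simp add: adjoin_def)

text \<open>
  The operations of \<^const>\<open>adjoin\<close> are unions over representatives. A union of equal sets over a nonempty
  index set collapses to any one of them, so compatibility with \<^const>\<open>expr_eq\<close> is all that is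
  needed to compute on representatives.
\<close>

lemma UN_cls:
  assumes "isx X Y n s" "\<And>s'. expr_eq R C V X Y n s s' \<Longrightarrow> f s' = f s"
  shows "(\<Union>s\<in>cls X Y n s. f s) = f s"
  using assms by (auto simp: expr_class_def intro: expr_eq.refl)

lemma add_cls:
  assumes "isx X Y n s" "isx X Y n t"
  shows "cls X Y n s \<oplus>\<^bsub>dg_hom G X Y n\<^esub> cls X Y n t = cls X Y n (Add s t)"
proof -
  have "cls X Y n s \<oplus>\<^bsub>dg_hom G X Y n\<^esub> cls X Y n t =
      (\<Union>s\<in>cls X Y n s. \<Union>t\<in>cls X Y n t. cls X Y n (Add s t))"
    by (simp add: adjoin_def)
  also have "\<dots> = (\<Union>s\<in>cls X Y n s. cls X Y n (Add s t))"
    by (intro SUP_cong refl UN_cls assms cls_eqI expr_eq.Add_cong)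
      (auto simp: expr_class_def dest: expr_eq_is_expr intro: expr_eq.refl expr_eq.sym)
  also have "\<dots> = cls X Y n (Add s t)"
    by (intro UN_cls assms cls_eqI expr_eq.Add_cong expr_eq.refl) (rule expr_eq.sym)
  finally show ?thesis .
qed

lemma smult_cls:
  assumes "a \<in> carrier R" "isx X Y n s"
  shows "a \<odot>\<^bsub>dg_hom G X Y n\<^esub> cls X Y n s = cls X Y n (Scal a s)"
proof -
  have "a \<odot>\<^bsub>dg_hom G X Y n\<^esub> cls X Y n s = (\<Union>s\<in>cls X Y n s. cls X Y n (Scal a s))"
    by (simp add: adjoin_def)
  also have "\<dots> = cls X Y n (Scal a s)"
    by (intro UN_cls assms cls_eqI expr_eq.Scal_cong) (rule expr_eq.sym)
  finally show ?thesis .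
qed

lemma comp_cls:
  assumes "isx Y Z m t" "isx X Y n s"
  shows "dg_comp G X Y Z m n (cls Y Z m t) (cls X Y n s) = cls X Z (m + n) (Comp t s)"
proof -
  have "dg_comp G X Y Z m n (cls Y Z m t) (cls X Y n s) =
      (\<Union>t\<in>cls Y Z m t. \<Union>s\<in>cls X Y n s. cls X Z (m + n) (Comp t s))"
    by (simp add: adjoin_def)
  also have "\<dots> = (\<Union>t\<in>cls Y Z m t. cls X Z (m + n) (Comp t s))"
    by (intro SUP_cong refl UN_cls assms cls_eqI expr_eq.Comp_cong)
      (auto simp: expr_class_def dest: expr_eq_is_expr intro: expr_eq.refl expr_eq.sym)
  also have "\<dots> = cls X Z (m + n) (Comp t s)"
    using assms by (intro UN_cls cls_eqI expr_eq.Comp_cong[OF _ expr_eq.refl]) (auto intro: expr_eq.sym)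
  finally show ?thesis .
qed

lemma expr_eq_minus:
  assumes s: "isx X Y n s"
  shows "expr_eq R C V X Y n (Add (Scal (\<ominus> \<one>) s) s) (Old X Y n \<zero>\<^bsub>dg_hom C X Y n\<^esub>)"
proof -
  have "expr_eq R C V X Y n (Add (Scal (\<ominus> \<one>) s) s) (Add (Scal (\<ominus> \<one>) s) (Scal \<one> s))"
    using s by (auto intro!: expr_eq.Add_cong intro: expr_eq.intros is_expr.intros)
  also have "expr_eq R C V X Y n (Add (Scal (\<ominus> \<one>) s) (Scal \<one> s)) (Scal (\<ominus> \<one> \<oplus> \<one>) s)"
    using s by (auto intro!: expr_eq.sym[OF expr_eq.scal_add_left])
  also (expr_eq.trans) have "expr_eq R C V X Y n (Scal (\<ominus> \<one> \<oplus> \<one>) s) (Old X Y n \<zero>\<^bsub>dg_hom C X Y n\<^esub>)"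
    using s by (simp add: l_neg expr_eq.scal_zero)
  finally (expr_eq.trans) show ?thesis .
qed

lemma adjoin_hom_module:
  assumes ob: "X \<in> dg_ob C" "Y \<in> dg_ob C"
  shows "module R (dg_hom G X Y n)"
proof (rule moduleI)
  show "abelian_group (dg_hom G X Y n)"
  proof (rule abelian_groupI)
    fix S T assume "S \<in> carrier (dg_hom G X Y n)" "T \<in> carrier (dg_hom G X Y n)"
    then obtain s t where "isx X Y n s" "S = cls X Y n s" "isx X Y n t" "T = cls X Y n t"
      by (metis hom_clsE)
    then show "S \<oplus>\<^bsub>dg_hom G X Y n\<^esub> T = T \<oplus>\<^bsub>dg_hom G X Y n\<^esub> S"
      using cls_eqI[OF expr_eq.add_comm[of R C V X Y n s t]] by (simp add: add_cls)
  next
    fix S assume "S \<in> carrier (dg_hom G X Y n)"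
    then obtain s where s: "isx X Y n s" "S = cls X Y n s" by (rule hom_clsE)
    have "cls X Y n (Scal (\<ominus> \<one>) s) \<oplus>\<^bsub>dg_hom G X Y n\<^esub> S = \<zero>\<^bsub>dg_hom G X Y n\<^esub>"
      using s cls_eqI[OF expr_eq_minus] by (simp add: add_cls zero_cls is_expr.Scal)
    then show "\<exists>T\<in>carrier (dg_hom G X Y n). T \<oplus>\<^bsub>dg_hom G X Y n\<^esub> S = \<zero>\<^bsub>dg_hom G X Y n\<^esub>"
      using s hom_cls[OF is_expr.Scal[OF _ s(1), of "\<ominus> \<one>"]] by auto
  qed (auto elim!: hom_clsE simp: zero_cls add_cls is_expr.Add ob
        cls_eqI[OF expr_eq.add_assoc] cls_eqI[OF expr_eq.add_zero])
qed (auto elim!: hom_clsE simp: smult_cls add_cls is_expr.intros is_cring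
    cls_eqI[OF expr_eq.scal_add_left] cls_eqI[OF expr_eq.scal_add_right] cls_eqI[OF expr_eq.scal_mult]
    cls_eqI[OF expr_eq.scal_one])

lemma comp_cls_assoc:
  assumes "isx Y Z l u" "isx X Y m t" "isx W X n s"
  shows "cls W Z (l + m + n) (Comp (Comp u t) s) = cls W Z (l + (m + n)) (Comp u (Comp t s))"
  using cls_eqI[OF expr_eq.comp_assoc[OF assms]] by (simp add: add.assoc)

text \<open>
  Each axiom is one of the defining relations of \<^const>\<open>expr_eq\<close>.
\<close>

lemma adjoin_graded_category: "graded_category R G"
proof (rule graded_category.intro[OF is_cring graded_category_axioms.intro])
  show "module R (dg_hom G X Y n)" if "X \<in> dg_ob G" "Y \<in> dg_ob G" for X Y n
    using that by (simp add: adjoin_hom_module)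
next
  fix X Y Z m n f assume "X \<in> dg_ob G" "Y \<in> dg_ob G" "Z \<in> dg_ob G" "f \<in> carrier (dg_hom G X Y n)"
  then show "(\<lambda>g. dg_comp G X Y Z m n g f) \<in> module_hom R (dg_hom G Y Z m) (dg_hom G X Z (m + n))"
    by (auto simp: module_hom_def comp_cls add_cls smult_cls is_expr.intros
        cls_eqI[OF expr_eq.comp_add_left] cls_eqI[OF expr_eq.comp_scal_left] elim!: hom_clsE)
next
  fix X Y Z m n g assume "X \<in> dg_ob G" "Y \<in> dg_ob G" "Z \<in> dg_ob G" "g \<in> carrier (dg_hom G Y Z m)"
  then show "(\<lambda>f. dg_comp G X Y Z m n g f) \<in> module_hom R (dg_hom G X Y n) (dg_hom G X Z (m + n))"
    by (auto simp: module_hom_def comp_cls add_cls smult_cls is_expr.intros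
        cls_eqI[OF expr_eq.comp_add_right] cls_eqI[OF expr_eq.comp_scal_right] elim!: hom_clsE)
next
  fix W X Y Z l m n h g f
  assume "h \<in> carrier (dg_hom G Y Z l)" "g \<in> carrier (dg_hom G X Y m)" "f \<in> carrier (dg_hom G W X n)"
  then show "dg_comp G W X Z (l + m) n (dg_comp G X Y Z l m h g) f =
        dg_comp G W Y Z l (m + n) h (dg_comp G W X Y m n g f)"
    by (auto simp: comp_cls is_expr.Comp comp_cls_assoc elim!: hom_clsE)
next
  show "dg_id G X \<in> carrier (dg_hom G X X 0)" if "X \<in> dg_ob G" for X
    using that by (simp add: id_cls)
next
  fix X Y n f assume a: "X \<in> dg_ob G" "Y \<in> dg_ob G" "f \<in> carrier (dg_hom G X Y n)"
  obtain s where s: "isx X Y n s" "f = cls X Y n s" using a(3) by (rule hom_clsE)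
  show "dg_comp G X X Y n 0 f (dg_id G X) = f"
    using a s cls_eqI[OF expr_eq.comp_id_right[OF s(1)]] by (simp add: id_cls comp_cls)
  show "dg_comp G X Y Y 0 n (dg_id G Y) f = f"
    using a s cls_eqI[OF expr_eq.comp_id_left[OF s(1)]] by (simp add: id_cls comp_cls)
qed

end

section \<open>The universal property of a free extension\<close>

text \<open>
  The conditions on a dg functor that do not mention the differential.
\<close>

definition graded_functor ::
  "('k, 'r) ring_scheme \<Rightarrow> ('k, 'o, 'm) dgcat \<Rightarrow> ('k, 'p, 'n) dgcat \<Rightarrow> ('o, 'm, 'p, 'n) dgfun \<Rightarrow> bool"
  where "graded_functor R C D F \<longleftrightarrow>
    fun_ob F \<in> dg_ob C \<rightarrow> dg_ob D
    \<and> (\<forall>X\<in>dg_ob C. \<forall>Y\<in>dg_ob C. \<forall>n.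
        fun_mor F X Y n \<in> module_hom R (dg_hom C X Y n) (dg_hom D (fun_ob F X) (fun_ob F Y) n))
    \<and> (\<forall>X\<in>dg_ob C. \<forall>Y\<in>dg_ob C. \<forall>Z\<in>dg_ob C. \<forall>m n.
        \<forall>g\<in>carrier (dg_hom C Y Z m). \<forall>f\<in>carrier (dg_hom C X Y n).
        fun_mor F X Z (m + n) (dg_comp C X Y Z m n g f)
          = dg_comp D (fun_ob F X) (fun_ob F Y) (fun_ob F Z) m n (fun_mor F Y Z m g) (fun_mor F X Y n f))
    \<and> (\<forall>X\<in>dg_ob C. fun_mor F X X 0 (dg_id C X) = dg_id D (fun_ob F X))"

lemma dg_functor_iff:
  "dg_functor R C D F \<longleftrightarrow> graded_functor R C D F \<and>
    (\<forall>X\<in>dg_ob C. \<forall>Y\<in>dg_ob C. \<forall>n. \<forall>f\<in>carrier (dg_hom C X Y n).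
        fun_mor F X Y (n - 1) (dg_diff C X Y n f)
          = dg_diff D (fun_ob F X) (fun_ob F Y) n (fun_mor F X Y n f))"
  unfolding dg_functor_def graded_functor_def by blast

lemma graded_functorD:
  assumes "graded_functor R C D F" "X \<in> dg_ob C"
  shows "fun_ob F X \<in> dg_ob D"
    and "Y \<in> dg_ob C \<Longrightarrow> fun_mor F X Y n \<in> module_hom R (dg_hom C X Y n) (dg_hom D (fun_ob F X) (fun_ob F Y) n)"
    and "fun_mor F X X 0 (dg_id C X) = dg_id D (fun_ob F X)"
    and "\<lbrakk>Y \<in> dg_ob C; Z \<in> dg_ob C; g \<in> carrier (dg_hom C Y Z m); f \<in> carrier (dg_hom C X Y n)\<rbrakk> \<Longrightarrow>
      fun_mor F X Z (m + n) (dg_comp C X Y Z m n g f)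
          = dg_comp D (fun_ob F X) (fun_ob F Y) (fun_ob F Z) m n (fun_mor F Y Z m g) (fun_mor F X Y n f)"
    and "\<lbrakk>Y \<in> dg_ob C; f \<in> carrier (dg_hom C X Y n)\<rbrakk> \<Longrightarrow>
      fun_mor F X Y n f \<in> carrier (dg_hom D (fun_ob F X) (fun_ob F Y) n)"
    and "\<lbrakk>Y \<in> dg_ob C; f \<in> carrier (dg_hom C X Y n); g \<in> carrier (dg_hom C X Y n)\<rbrakk> \<Longrightarrow>
      fun_mor F X Y n (f \<oplus>\<^bsub>dg_hom C X Y n\<^esub> g) =
      fun_mor F X Y n f \<oplus>\<^bsub>dg_hom D (fun_ob F X) (fun_ob F Y) n\<^esub> fun_mor F X Y n g"
    and "\<lbrakk>Y \<in> dg_ob C; a \<in> carrier R; f \<in> carrier (dg_hom C X Y n)\<rbrakk> \<Longrightarrow>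
      fun_mor F X Y n (a \<odot>\<^bsub>dg_hom C X Y n\<^esub> f) = a \<odot>\<^bsub>dg_hom D (fun_ob F X) (fun_ob F Y) n\<^esub> fun_mor F X Y n f"
  using assms unfolding graded_functor_def module_hom_def by (blast, blast, blast, blast, blast, blast, blast)

lemma graded_functor_zero:
  assumes "graded_functor R C D F" "graded_category R C" "graded_category R D" "X \<in> dg_ob C" "Y \<in> dg_ob C"
  shows "fun_mor F X Y n \<zero>\<^bsub>dg_hom C X Y n\<^esub> = \<zero>\<^bsub>dg_hom D (fun_ob F X) (fun_ob F Y) n\<^esub>"
  using assms module_hom_zero[OF graded_functorD(2)] graded_category.hom_abelian_group graded_functorD(1) by metis

lemma graded_functor_minus:
  assumes "graded_functor R C D F" "graded_category R C" "graded_category R D" "X \<in> dg_ob C" "Y \<in> dg_ob C"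
    "f \<in> carrier (dg_hom C X Y n)"
  shows "fun_mor F X Y n (\<ominus>\<^bsub>dg_hom C X Y n\<^esub> f) = \<ominus>\<^bsub>dg_hom D (fun_ob F X) (fun_ob F Y) n\<^esub> fun_mor F X Y n f"
  using assms module_hom_minus[OF graded_functorD(2)] graded_category.hom_abelian_group graded_functorD(1) by metis

primrec expr_eval :: "('k, 'p, 'n) dgcat \<Rightarrow> ('o, 'm, 'p, 'n) dgfun \<Rightarrow> ('o \<Rightarrow> 'o \<Rightarrow> int \<Rightarrow> 'm \<Rightarrow> 'n) \<Rightarrow>
    ('k, 'o, 'm) expr \<Rightarrow> 'n"
  where
    "expr_eval D F W (Old X Y n f) = fun_mor F X Y n f"
  | "expr_eval D F W (New X Y n v) = W X Y n v"
  | "expr_eval D F W (Add s t) = expr_eval D F W s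
      \<oplus>\<^bsub>dg_hom D (fun_ob F (expr_src s)) (fun_ob F (expr_tgt s)) (expr_deg s)\<^esub> expr_eval D F W t"
  | "expr_eval D F W (Scal a s) =
      a \<odot>\<^bsub>dg_hom D (fun_ob F (expr_src s)) (fun_ob F (expr_tgt s)) (expr_deg s)\<^esub> expr_eval D F W s"
  | "expr_eval D F W (Comp t s) =
      dg_comp D (fun_ob F (expr_src s)) (fun_ob F (expr_tgt s)) (fun_ob F (expr_tgt t)) (expr_deg t) (expr_deg s)
        (expr_eval D F W t) (expr_eval D F W s)"

text \<open>
  A graded functor on \<open>C\<close> together with arbitrary images of the right degree for the new morphisms
  determines a graded functor on the free extension, since the relations of \<^const>\<open>expr_eq\<close> hold in
  every graded category.
\<close>

locale evaluation = free_extension R C V + D: graded_category R D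
  for R :: "('k, 'r) ring_scheme" (structure) and C :: "('k, 'o, 'm) dgcat" and V and D :: "('k, 'p, 'n) dgcat" +
  fixes F :: "('o, 'm, 'p, 'n) dgfun" and W :: "'o \<Rightarrow> 'o \<Rightarrow> int \<Rightarrow> 'm \<Rightarrow> 'n"
  assumes base: "graded_functor R C D F"
    and images: "\<And>X Y n v. (X, Y, n, v) \<in> V \<Longrightarrow> W X Y n v \<in> carrier (dg_hom D (fun_ob F X) (fun_ob F Y) (n + 1))"
begin

abbreviation "ev \<equiv> expr_eval D F W"

lemma ev_closed:
  "isx X Y n s \<Longrightarrow> ev s \<in> carrier (dg_hom D (fun_ob F X) (fun_ob F Y) n)"
proof (induction rule: is_expr.induct)
  case (Comp Y Z m t X n s)
  then show ?case
    using is_expr_ob is_expr_type graded_functorD(1)[OF base] by (metis D.comp_closed expr_eval.simps(5))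
next
  case (Add X Y n s t)
  then show ?case
    using is_expr_ob is_expr_type graded_functorD(1)[OF base] by (metis D.hom_add_closed expr_eval.simps(3))
next
  case (Scal a X Y n s)
  then show ?case
    using is_expr_ob is_expr_type graded_functorD(1)[OF base] by (metis D.hom_smult_closed expr_eval.simps(4))
qed (use images graded_functorD(5)[OF base] in auto)

lemma is_expr_data:
  "isx X Y n s \<Longrightarrow> expr_src s = X \<and> expr_tgt s = Y \<and> expr_deg s = n \<and> X \<in> dg_ob C \<and> Y \<in> dg_ob C
    \<and> fun_ob F X \<in> dg_ob D \<and> fun_ob F Y \<in> dg_ob D \<and> ev s \<in> carrier (dg_hom D (fun_ob F X) (fun_ob F Y) n)"
  using is_expr_ob is_expr_type ev_closed graded_functorD(1)[OF base] by blast

lemma ev_cong: "expr_eq R C V X Y n s t \<Longrightarrow> ev s = ev t"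
proof (induction rule: expr_eq.induct)
  case (Add_cong X Y n s s' t t')
  then show ?case by (auto dest!: expr_eq_is_expr is_expr_data)
next
  case (Scal_cong a X Y n s s')
  then show ?case by (auto dest!: expr_eq_is_expr is_expr_data)
next
  case (Comp_cong Y Z m t t' X n s s')
  then show ?case by (auto dest!: expr_eq_is_expr is_expr_data)
next
  case (comp_assoc Y Z l u X m t W n s)
  then show ?case by (auto dest!: is_expr_data intro: D.comp_assoc)
qed (auto dest!: is_expr_data simp: D.hom_ac D.hom_smult graded_functorD[OF base]
      graded_functor_zero[OF base graded_category_axioms D.graded_category_axioms])

text \<open>
  The evaluation is constant on equivalence classes, so its image of a class is a singleton.
\<close>

definition free_functor :: "('o, ('k, 'o, 'm) expr set, 'p, 'n) dgfun" where
  "free_functor = \<lparr>fun_ob = fun_ob F, fun_mor = (\<lambda>X Y n S. the_elem (ev ` S))\<rparr>"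

lemma fun_ob_free_functor [simp]: "fun_ob free_functor = fun_ob F"
  by (simp add: free_functor_def)

lemma free_functor_cls [simp]:
  assumes "isx X Y n s"
  shows "fun_mor free_functor X' Y' n' (cls X Y n s) = ev s"
proof -
  have "ev ` cls X Y n s = {ev s}"
  proof (intro equalityI subsetI)
    fix u assume "u \<in> ev ` cls X Y n s"
    then obtain t where "expr_eq R C V X Y n s t" "u = ev t" unfolding expr_class_def by blast
    then show "u \<in> {ev s}" using ev_cong[of X Y n s t] by simp
  next
    show "u \<in> ev ` cls X Y n s" if "u \<in> {ev s}" for u
      using that expr_eq.refl[OF assms] by (simp add: expr_class_def)
  qed
  then show ?thesis by (simp add: free_functor_def)
qed

lemma free_functor_graded: "graded_functor R G D free_functor"
  unfolding graded_functor_def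
proof (intro conjI ballI allI)
  show "fun_ob free_functor \<in> dg_ob G \<rightarrow> dg_ob D" using graded_functorD(1)[OF base] by auto
  show "fun_mor free_functor X Y n \<in> module_hom R (dg_hom G X Y n) (dg_hom D (fun_ob free_functor X) (fun_ob free_functor Y) n)"
    for X Y n
    unfolding module_hom_def mem_Collect_eq
  proof (intro conjI ballI)
    show "fun_mor free_functor X Y n \<in> carrier (dg_hom G X Y n) \<rightarrow>
        carrier (dg_hom D (fun_ob free_functor X) (fun_ob free_functor Y) n)"
      by (auto simp: ev_closed elim!: hom_clsE)
    fix S T assume "S \<in> carrier (dg_hom G X Y n)" "T \<in> carrier (dg_hom G X Y n)"
    then obtain s t where "isx X Y n s" "S = cls X Y n s" "isx X Y n t" "T = cls X Y n t"
      by (metis hom_clsE)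
    then show "fun_mor free_functor X Y n (S \<oplus>\<^bsub>dg_hom G X Y n\<^esub> T) =
        fun_mor free_functor X Y n S \<oplus>\<^bsub>dg_hom D (fun_ob free_functor X) (fun_ob free_functor Y) n\<^esub>
        fun_mor free_functor X Y n T"
      using is_expr_type[of X Y n s] by (simp add: add_cls is_expr.Add)
  next
    fix a S assume "a \<in> carrier R" "S \<in> carrier (dg_hom G X Y n)"
    then obtain s where "a \<in> carrier R" "isx X Y n s" "S = cls X Y n s"
      by (metis hom_clsE)
    then show "fun_mor free_functor X Y n (a \<odot>\<^bsub>dg_hom G X Y n\<^esub> S) =
        a \<odot>\<^bsub>dg_hom D (fun_ob free_functor X) (fun_ob free_functor Y) n\<^esub> fun_mor free_functor X Y n S"
      using is_expr_type[of X Y n s] by (simp add: smult_cls is_expr.Scal)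
  qed
  show "fun_mor free_functor X Z (m + n) (dg_comp G X Y Z m n g f) =
      dg_comp D (fun_ob free_functor X) (fun_ob free_functor Y) (fun_ob free_functor Z) m n
        (fun_mor free_functor Y Z m g) (fun_mor free_functor X Y n f)"
    if g: "g \<in> carrier (dg_hom G Y Z m)" and f: "f \<in> carrier (dg_hom G X Y n)" for X Y Z m n g f
  proof -
    obtain t s where t: "isx Y Z m t" "g = cls Y Z m t" and s: "isx X Y n s" "f = cls X Y n s"
      using f g by (blast elim!: hom_clsE)
    show ?thesis using s t is_expr_type[OF t(1)] is_expr_type[OF s(1)] free_functor_cls[OF is_expr.Comp[OF t(1) s(1)]]
      by (simp add: comp_cls)
  qed
  show "fun_mor free_functor X X 0 (dg_id G X) = dg_id D (fun_ob free_functor X)" if "X \<in> dg_ob G" for X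
    using that by (simp add: id_cls graded_functorD[OF base])
qed

end

section \<open>Derivations as functors\<close>

text \<open>
  Morphisms are triples whose third component lives in a degree shifted by \<open>k\<close>. For odd \<open>k\<close> a graded
  functor into \<open>der_cat C k\<close> is a pair of graded functors \<open>F\<close>, \<open>F'\<close> to \<open>C\<close> together with a derivation of
  degree \<open>k\<close> between them: \<open>h (g f) = h g \<cdot> F f + (-1)\<^sup>m F' g \<cdot> h f\<close> for \<open>g\<close> of degree \<open>m\<close>. Thus the universal
  property of free extensions also produces derivations from prescribed values on generators.
  It is used twice. For \<open>k = -1\<close> and \<open>F = F'\<close> the derivation is the differential of a free extension.
  For \<open>k = 1\<close> it is a homotopy, and \<open>der_cat C 1\<close> is the path object of \<open>C\<close>: a dg functor into it, for the
  differential \<open>(f, g, h) \<mapsto> (d f, d g, f - g - d h)\<close>, is a homotopy \<open>F - F' = d h + h d\<close>. This differential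
  has degree \<open>-1\<close> only when \<open>k = 1\<close>.
\<close>

definition der_cat :: "('k, 'o, 'm) dgcat \<Rightarrow> int \<Rightarrow> ('k, 'o, 'm \<times> 'm \<times> 'm) dgcat" where
  "der_cat C k =
    \<lparr>dg_ob = dg_ob C,
     dg_hom = (\<lambda>X Y n.
       \<lparr>carrier = carrier (dg_hom C X Y n) \<times> carrier (dg_hom C X Y n) \<times> carrier (dg_hom C X Y (n + k)),
        mult = undefined, one = undefined,
        zero = (\<zero>\<^bsub>dg_hom C X Y n\<^esub>, \<zero>\<^bsub>dg_hom C X Y n\<^esub>, \<zero>\<^bsub>dg_hom C X Y (n + k)\<^esub>),
        add = (\<lambda>(f, g, h) (f', g', h').
          (f \<oplus>\<^bsub>dg_hom C X Y n\<^esub> f', g \<oplus>\<^bsub>dg_hom C X Y n\<^esub> g', h \<oplus>\<^bsub>dg_hom C X Y (n + k)\<^esub> h')),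
        smult = (\<lambda>a (f, g, h).
          (a \<odot>\<^bsub>dg_hom C X Y n\<^esub> f, a \<odot>\<^bsub>dg_hom C X Y n\<^esub> g, a \<odot>\<^bsub>dg_hom C X Y (n + k)\<^esub> h))\<rparr>),
     dg_diff = (\<lambda>X Y n (f, g, h).
       (dg_diff C X Y n f, dg_diff C X Y n g,
        f \<oplus>\<^bsub>dg_hom C X Y n\<^esub> \<ominus>\<^bsub>dg_hom C X Y n\<^esub> (g \<oplus>\<^bsub>dg_hom C X Y n\<^esub> dg_diff C X Y (n + k) h))),
     dg_comp = (\<lambda>X Y Z m n (f', g', h') (f, g, h).
       (dg_comp C X Y Z m n f' f, dg_comp C X Y Z m n g' g,
        dg_comp C X Y Z (m + k) n h' f \<oplus>\<^bsub>dg_hom C X Z (m + n + k)\<^esub>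
          ksgn (dg_hom C X Z (m + n + k)) m (dg_comp C X Y Z m (n + k) g' h))),
     dg_id = (\<lambda>X. (dg_id C X, dg_id C X, \<zero>\<^bsub>dg_hom C X X k\<^esub>))\<rparr>"

lemma der_cat_simps [simp]:
  "dg_ob (der_cat C k) = dg_ob C"
  "carrier (dg_hom (der_cat C k) X Y n) =
    carrier (dg_hom C X Y n) \<times> carrier (dg_hom C X Y n) \<times> carrier (dg_hom C X Y (n + k))"
  "\<zero>\<^bsub>dg_hom (der_cat C k) X Y n\<^esub> =
    (\<zero>\<^bsub>dg_hom C X Y n\<^esub>, \<zero>\<^bsub>dg_hom C X Y n\<^esub>, \<zero>\<^bsub>dg_hom C X Y (n + k)\<^esub>)"
  "(f, g, h) \<oplus>\<^bsub>dg_hom (der_cat C k) X Y n\<^esub> (f', g', h') =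
    (f \<oplus>\<^bsub>dg_hom C X Y n\<^esub> f', g \<oplus>\<^bsub>dg_hom C X Y n\<^esub> g', h \<oplus>\<^bsub>dg_hom C X Y (n + k)\<^esub> h')"
  "a \<odot>\<^bsub>dg_hom (der_cat C k) X Y n\<^esub> (f, g, h) =
    (a \<odot>\<^bsub>dg_hom C X Y n\<^esub> f, a \<odot>\<^bsub>dg_hom C X Y n\<^esub> g, a \<odot>\<^bsub>dg_hom C X Y (n + k)\<^esub> h)"
  "dg_diff (der_cat C k) X Y n (f, g, h) =
    (dg_diff C X Y n f, dg_diff C X Y n g,
     f \<oplus>\<^bsub>dg_hom C X Y n\<^esub> \<ominus>\<^bsub>dg_hom C X Y n\<^esub> (g \<oplus>\<^bsub>dg_hom C X Y n\<^esub> dg_diff C X Y (n + k) h))"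
  "dg_comp (der_cat C k) X Y Z m n (f', g', h') (f, g, h) =
    (dg_comp C X Y Z m n f' f, dg_comp C X Y Z m n g' g,
     dg_comp C X Y Z (m + k) n h' f \<oplus>\<^bsub>dg_hom C X Z (m + n + k)\<^esub>
       ksgn (dg_hom C X Z (m + n + k)) m (dg_comp C X Y Z m (n + k) g' h))"
  "dg_id (der_cat C k) X = (dg_id C X, dg_id C X, \<zero>\<^bsub>dg_hom C X X k\<^esub>)"
  by (simp_all add: der_cat_def)

context graded_category
begin

lemma comp_assoc':
  "\<lbrakk>W \<in> dg_ob C; X \<in> dg_ob C; Y \<in> dg_ob C; Z \<in> dg_ob C; h \<in> carrier (dg_hom C Y Z l);
    g \<in> carrier (dg_hom C X Y m); f \<in> carrier (dg_hom C W X n); p = l + m\<rbrakk> \<Longrightarrow>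
    dg_comp C W X Z p n (dg_comp C X Y Z l m h g) f = dg_comp C W Y Z l (m + n) h (dg_comp C W X Y m n g f)"
  by (simp add: comp_assoc)

lemma der_cat_module:
  assumes ob: "X \<in> dg_ob C" "Y \<in> dg_ob C"
  shows "module R (dg_hom (der_cat C k) X Y n)"
proof (rule moduleI)
  show "abelian_group (dg_hom (der_cat C k) X Y n)"
  proof (rule abelian_groupI)
    fix u assume "u \<in> carrier (dg_hom (der_cat C k) X Y n)"
    then obtain f g h where u: "u = (f, g, h)" "f \<in> carrier (dg_hom C X Y n)"
        "g \<in> carrier (dg_hom C X Y n)" "h \<in> carrier (dg_hom C X Y (n + k))"
      by auto
    show "\<exists>v\<in>carrier (dg_hom (der_cat C k) X Y n).
        v \<oplus>\<^bsub>dg_hom (der_cat C k) X Y n\<^esub> u = \<zero>\<^bsub>dg_hom (der_cat C k) X Y n\<^esub>"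
      using u ob by (intro bexI[where x = "(\<ominus>\<^bsub>dg_hom C X Y n\<^esub> f, \<ominus>\<^bsub>dg_hom C X Y n\<^esub> g, \<ominus>\<^bsub>dg_hom C X Y (n + k)\<^esub> h)"])
        auto
  qed (use ob in \<open>auto simp: hom_ac\<close>)
qed (use ob in \<open>auto simp: hom_smult is_cring\<close>)

lemma der_cat_minus [simp]:
  assumes "X \<in> dg_ob C" "Y \<in> dg_ob C" "f \<in> carrier (dg_hom C X Y n)" "g \<in> carrier (dg_hom C X Y n)"
    "h \<in> carrier (dg_hom C X Y (n + k))"
  shows "\<ominus>\<^bsub>dg_hom (der_cat C k) X Y n\<^esub> (f, g, h) =
    (\<ominus>\<^bsub>dg_hom C X Y n\<^esub> f, \<ominus>\<^bsub>dg_hom C X Y n\<^esub> g, \<ominus>\<^bsub>dg_hom C X Y (n + k)\<^esub> h)"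
proof -
  interpret M: module R "dg_hom (der_cat C k) X Y n" by (rule der_cat_module[OF assms(1,2)])
  show ?thesis using assms by (intro M.minus_equality) auto
qed

text \<open>
  Both bracketings of a triple composite have the third component
  \<open>h'' f' f + (-1)\<^sup>l g'' h' f + (-1)\<^bsup>l + m\<^esup> g'' g' h\<close>.
\<close>

lemma der_cat_graded_category:
  assumes k: "odd k"
  shows "graded_category R (der_cat C k)"
proof (rule graded_category.intro[OF is_cring graded_category_axioms.intro])
  show "module R (dg_hom (der_cat C k) X Y n)" if "X \<in> dg_ob (der_cat C k)" "Y \<in> dg_ob (der_cat C k)" for X Y n
    using that by (intro der_cat_module) auto
next
  fix X Y Z m n u assume "X \<in> dg_ob (der_cat C k)" "Y \<in> dg_ob (der_cat C k)" "Z \<in> dg_ob (der_cat C k)"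
    "u \<in> carrier (dg_hom (der_cat C k) X Y n)"
  then show "(\<lambda>v. dg_comp (der_cat C k) X Y Z m n v u)
      \<in> module_hom R (dg_hom (der_cat C k) Y Z m) (dg_hom (der_cat C k) X Z (m + n))"
    by (cases "even m") (auto simp: module_hom_def ksgn_def algebra_simps hom_smult hom_ac)
next
  fix X Y Z m n v assume "X \<in> dg_ob (der_cat C k)" "Y \<in> dg_ob (der_cat C k)" "Z \<in> dg_ob (der_cat C k)"
    "v \<in> carrier (dg_hom (der_cat C k) Y Z m)"
  then show "(\<lambda>u. dg_comp (der_cat C k) X Y Z m n v u)
      \<in> module_hom R (dg_hom (der_cat C k) X Y n) (dg_hom (der_cat C k) X Z (m + n))"
    by (cases "even m") (auto simp: module_hom_def ksgn_def algebra_simps hom_smult hom_ac)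
next
  fix W X Y Z l m n w v u
  assume "W \<in> dg_ob (der_cat C k)" "X \<in> dg_ob (der_cat C k)" "Y \<in> dg_ob (der_cat C k)" "Z \<in> dg_ob (der_cat C k)"
    "w \<in> carrier (dg_hom (der_cat C k) Y Z l)" "v \<in> carrier (dg_hom (der_cat C k) X Y m)"
    "u \<in> carrier (dg_hom (der_cat C k) W X n)"
  then show "dg_comp (der_cat C k) W X Z (l + m) n (dg_comp (der_cat C k) X Y Z l m w v) u =
        dg_comp (der_cat C k) W Y Z l (m + n) w (dg_comp (der_cat C k) W X Y m n v u)"
    by (cases "even m"; cases "even l") (auto simp: ksgn_def algebra_simps comp_assoc' hom_ac)
next
  show "dg_id (der_cat C k) X \<in> carrier (dg_hom (der_cat C k) X X 0)" if "X \<in> dg_ob (der_cat C k)" for X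
    using that by auto
next
  fix X Y n u assume "X \<in> dg_ob (der_cat C k)" "Y \<in> dg_ob (der_cat C k)" "u \<in> carrier (dg_hom (der_cat C k) X Y n)"
  then show "dg_comp (der_cat C k) X X Y n 0 u (dg_id (der_cat C k) X) = u"
    "dg_comp (der_cat C k) X Y Y 0 n (dg_id (der_cat C k) Y) u = u"
    using k by (auto simp: ksgn_def add.commute)
qed

end

context dg_category
begin

lemma leibniz':
  "\<lbrakk>X \<in> dg_ob C; Y \<in> dg_ob C; Z \<in> dg_ob C; g \<in> carrier (dg_hom C Y Z m); f \<in> carrier (dg_hom C X Y n);
    k = m + n\<rbrakk> \<Longrightarrow>
    dg_diff C X Z k (dg_comp C X Y Z m n g f) =
      dg_comp C X Y Z (m - 1) n (dg_diff C Y Z m g) f \<oplus>\<^bsub>dg_hom C X Z (m + n - 1)\<^esub>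
      ksgn (dg_hom C X Z (m + n - 1)) m (dg_comp C X Y Z m (n - 1) g (dg_diff C X Y n f))"
  by (simp add: leibniz)

abbreviation "path \<equiv> der_cat C 1"

text \<open>
  In the third component of the Leibniz rule the mixed terms \<open>g' f\<close> with \<open>g'\<close> from the second and \<open>f\<close>
  from the first component cancel, and the remaining ones are those of \<open>f' f - g' g - d (h' f \<plusminus> g' h)\<close>.
\<close>

lemma path_dg_category: "dg_category R path"
proof (rule dg_categoryI)
  show "graded_category R path" by (rule der_cat_graded_category) simp
next
  fix X Y n assume "X \<in> dg_ob path" "Y \<in> dg_ob path"
  then show "dg_diff path X Y n \<in> module_hom R (dg_hom path X Y n) (dg_hom path X Y (n - 1))"
    by (auto simp: module_hom_def algebra_simps hom_smult hom_ac)
next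
  fix X Y n u assume "X \<in> dg_ob path" "Y \<in> dg_ob path" "u \<in> carrier (dg_hom path X Y n)"
  then show "dg_diff path X Y (n - 1) (dg_diff path X Y n u) = \<zero>\<^bsub>dg_hom path X Y (n - 2)\<^esub>"
    by (auto simp: algebra_simps hom_ac)
next
  fix X Y Z m n v u
  assume "X \<in> dg_ob path" "Y \<in> dg_ob path" "Z \<in> dg_ob path"
    "v \<in> carrier (dg_hom path Y Z m)" "u \<in> carrier (dg_hom path X Y n)"
  then show "dg_diff path X Z (m + n) (dg_comp path X Y Z m n v u) =
      dg_comp path X Y Z (m - 1) n (dg_diff path Y Z m v) u
      \<oplus>\<^bsub>dg_hom path X Z (m + n - 1)\<^esub>
      ksgn (dg_hom path X Z (m + n - 1)) m (dg_comp path X Y Z m (n - 1) v (dg_diff path X Y n u))"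
    by (cases "even m") (auto simp: ksgn_def algebra_simps leibniz' hom_ac)
next
  show "dg_diff path X X 0 (dg_id path X) = \<zero>\<^bsub>dg_hom path X X (-1)\<^esub>" if "X \<in> dg_ob path" for X
    using that by auto
qed

end

section \<open>The differential of a free extension\<close>

context free_extension
begin

lemma is_expr_diff: "isx X Y n s \<Longrightarrow> isx X Y (n - 1) (expr_diff R C s)"
proof (induction rule: is_expr.induct)
  case (New X Y n v)
  then show ?case using generators[OF New] by (auto simp: cycles_def intro: is_expr.Old)
next
  case (Comp Y Z m t X n s)
  have "isx X Z (m + n - 1) (Comp (expr_diff R C t) s)" "isx X Z (m + n - 1) (Comp t (expr_diff R C s))"
    using Comp by (auto intro!: is_expr_Comp)
  then show ?case by (auto intro: is_expr.Add is_expr.Scal)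
qed (auto intro: is_expr.intros)

sublocale G: graded_category R G
  by (rule adjoin_graded_category)

lemma incl_graded_functor: "graded_functor R C G (adjoin_incl R C V)"
  unfolding graded_functor_def
proof (intro conjI ballI allI)
  fix X Y n assume ob: "X \<in> dg_ob C" "Y \<in> dg_ob C"
  show "fun_mor (adjoin_incl R C V) X Y n
      \<in> module_hom R (dg_hom C X Y n) (dg_hom G (fun_ob (adjoin_incl R C V) X) (fun_ob (adjoin_incl R C V) Y) n)"
    using ob by (auto simp: module_hom_def adjoin_incl_def is_expr.Old add_cls smult_cls
        cls_eqI[OF expr_eq.Old_add] cls_eqI[OF expr_eq.Old_scal])
qed (auto simp: adjoin_incl_def id_cls comp_cls is_expr.Old cls_eqI[OF expr_eq.Old_comp])

abbreviation "old X Y n f \<equiv> cls X Y n (Old X Y n f)"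

lemma fun_mor_adjoin_incl [simp]: "fun_mor (adjoin_incl R C V) X Y n f = old X Y n f"
  and fun_ob_adjoin_incl [simp]: "fun_ob (adjoin_incl R C V) = (\<lambda>X. X)"
  by (simp_all add: adjoin_incl_def)

lemma old_closed [simp, intro]:
  "\<lbrakk>X \<in> dg_ob C; Y \<in> dg_ob C; f \<in> carrier (dg_hom C X Y n)\<rbrakk> \<Longrightarrow> old X Y n f \<in> carrier (dg_hom G X Y n)"
  by (simp add: is_expr.Old)

lemma old_hom:
  assumes "X \<in> dg_ob C" "Y \<in> dg_ob C" "f \<in> carrier (dg_hom C X Y n)"
  shows "g \<in> carrier (dg_hom C X Y n) \<Longrightarrow>
      old X Y n (f \<oplus>\<^bsub>dg_hom C X Y n\<^esub> g) = old X Y n f \<oplus>\<^bsub>dg_hom G X Y n\<^esub> old X Y n g"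
    and "a \<in> carrier R \<Longrightarrow> old X Y n (a \<odot>\<^bsub>dg_hom C X Y n\<^esub> f) = a \<odot>\<^bsub>dg_hom G X Y n\<^esub> old X Y n f"
    and "old X Y n (\<ominus>\<^bsub>dg_hom C X Y n\<^esub> f) = \<ominus>\<^bsub>dg_hom G X Y n\<^esub> old X Y n f"
    and "old X Y n (ksgn (dg_hom C X Y n) p f) = ksgn (dg_hom G X Y n) p (old X Y n f)"
    and "Z \<in> dg_ob C \<Longrightarrow> h \<in> carrier (dg_hom C Y Z m) \<Longrightarrow> k = m + n \<Longrightarrow>
      old X Z k (dg_comp C X Y Z m n h f) = dg_comp G X Y Z m n (old Y Z m h) (old X Y n f)"
  using graded_functorD(4-7)[OF incl_graded_functor] assms
    graded_functor_minus[OF incl_graded_functor graded_category_axioms G.graded_category_axioms]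
  by (simp_all add: ksgn_def)

text \<open>
  The differential as a derivation of degree \<open>-1\<close>: an old morphism goes to the class of its
  differential, and the generator \<open>w\<close> with \<open>d w = v\<close> goes to the class of \<open>v\<close>.
\<close>

definition diff_base :: "('o, 'm, 'o, ('k, 'o, 'm) expr set \<times> ('k, 'o, 'm) expr set \<times> ('k, 'o, 'm) expr set) dgfun" where
  "diff_base = \<lparr>fun_ob = (\<lambda>X. X),
     fun_mor = (\<lambda>X Y n f. (old X Y n f, old X Y n f, old X Y (n - 1) (dg_diff C X Y n f)))\<rparr>"

definition diff_gen :: "'o \<Rightarrow> 'o \<Rightarrow> int \<Rightarrow> 'm \<Rightarrow>
    ('k, 'o, 'm) expr set \<times> ('k, 'o, 'm) expr set \<times> ('k, 'o, 'm) expr set" where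
  "diff_gen X Y n v = (cls X Y (n + 1) (New X Y n v), cls X Y (n + 1) (New X Y n v), old X Y n v)"

lemma diff_base_graded_functor: "graded_functor R C (der_cat G (-1)) diff_base"
  unfolding graded_functor_def
proof (intro conjI ballI allI)
  fix X Y n assume ob: "X \<in> dg_ob C" "Y \<in> dg_ob C"
  show "fun_mor diff_base X Y n
      \<in> module_hom R (dg_hom C X Y n) (dg_hom (der_cat G (-1)) (fun_ob diff_base X) (fun_ob diff_base Y) n)"
    using ob by (auto simp: module_hom_def diff_base_def old_hom)
next
  fix X Y Z m n g f assume ob: "X \<in> dg_ob C" "Y \<in> dg_ob C" "Z \<in> dg_ob C" 
    "g \<in> carrier (dg_hom C Y Z m)" "f \<in> carrier (dg_hom C X Y n)"
  then show "fun_mor diff_base X Z (m + n) (dg_comp C X Y Z m n g f) =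
      dg_comp (der_cat G (- 1)) (fun_ob diff_base X) (fun_ob diff_base Y) (fun_ob diff_base Z) m n
        (fun_mor diff_base Y Z m g) (fun_mor diff_base X Y n f)"
    by (simp add: diff_base_def old_hom leibniz algebra_simps)
qed (auto simp: diff_base_def id_cls zero_cls)

sublocale DG: evaluation R C V "der_cat G (-1)" diff_base diff_gen
proof (rule evaluation.intro[OF free_extension_axioms G.der_cat_graded_category evaluation_axioms.intro])
  show "graded_functor R C (der_cat G (- 1)) diff_base" by (rule diff_base_graded_functor)
  fix X Y n v assume "(X, Y, n, v) \<in> V"
  then show "diff_gen X Y n v \<in> carrier (dg_hom (der_cat G (- 1)) (fun_ob diff_base X) (fun_ob diff_base Y) (n + 1))"
    using generators[of X Y n v] by (auto simp: diff_base_def diff_gen_def cycles_def is_expr.New)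
qed simp

lemma sign_cls:
  assumes "isx X Y n s"
  shows "cls X Y n (Scal (if even m then \<one> else \<ominus> \<one>) s) = ksgn (dg_hom G X Y n) m (cls X Y n s)"
  using assms G.hom_smult(3,4)[of X Y "cls X Y n s" n] is_expr_ob[OF assms]
  by (simp add: ksgn_def smult_cls[symmetric])

lemma cls_diff_Comp:
  assumes t: "isx Y Z m t" and s: "isx X Y n s"
  shows "cls X Z (m + n - 1) (expr_diff R C (Comp t s)) =
    dg_comp G X Y Z (m - 1) n (cls Y Z (m - 1) (expr_diff R C t)) (cls X Y n s)
    \<oplus>\<^bsub>dg_hom G X Z (m + n - 1)\<^esub>
    ksgn (dg_hom G X Z (m + n - 1)) m (dg_comp G X Y Z m (n - 1) (cls Y Z m t) (cls X Y (n - 1) (expr_diff R C s)))"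
proof -
  have i: "isx X Z (m + n - 1) (Comp (expr_diff R C t) s)" "isx X Z (m + n - 1) (Comp t (expr_diff R C s))"
    using is_expr_diff t s by (auto intro!: is_expr_Comp)
  have "cls X Z (m + n - 1) (Comp (expr_diff R C t) s) =
      dg_comp G X Y Z (m - 1) n (cls Y Z (m - 1) (expr_diff R C t)) (cls X Y n s)"
    "cls X Z (m + n - 1) (Comp t (expr_diff R C s)) =
      dg_comp G X Y Z m (n - 1) (cls Y Z m t) (cls X Y (n - 1) (expr_diff R C s))"
    using comp_cls[OF is_expr_diff[OF t] s] comp_cls[OF t is_expr_diff[OF s]] by (simp_all add: algebra_simps)
  then show ?thesis
    using i is_expr_type[OF t] by (simp add: add_cls[symmetric] sign_cls is_expr.Scal)
qed

text \<open>
  Evaluation in \<open>der_cat G (-1)\<close> computes \<^const>\<open>expr_diff\<close> in the third component. As evaluation respects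
  \<^const>\<open>expr_eq\<close>, so does \<^const>\<open>expr_diff\<close>.
\<close>

lemma diff_ev: "isx X Y n s \<Longrightarrow> DG.ev s = (cls X Y n s, cls X Y n s, cls X Y (n - 1) (expr_diff R C s))"
proof (induction rule: is_expr.induct)
  case (Comp Y Z m t X n s)
  then show ?case
    using is_expr_type[OF Comp.hyps(1)] is_expr_type[OF Comp.hyps(2)] cls_diff_Comp[OF Comp.hyps]
    by (simp add: comp_cls diff_base_def)
next
  case (Add X Y n s t)
  then show ?case
    using is_expr_type[OF Add.hyps(1)] by (simp add: add_cls diff_base_def is_expr_diff)
next
  case (Scal a X Y n s)
  then show ?case
    using is_expr_type[OF Scal.hyps(2)] by (simp add: smult_cls diff_base_def is_expr_diff)
qed (auto simp: diff_base_def diff_gen_def)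

lemma diff_cls [simp]:
  assumes s: "isx X Y n s"
  shows "dg_diff G X Y n (cls X Y n s) = cls X Y (n - 1) (expr_diff R C s)"
proof -
  have "cls X Y (n - 1) (expr_diff R C s') = cls X Y (n - 1) (expr_diff R C s)" if "expr_eq R C V X Y n s s'" for s'
    using DG.ev_cong[OF that] diff_ev[OF s] diff_ev[of X Y n s'] expr_eq_is_expr[OF that] by simp
  then have "(\<Union>s\<in>cls X Y n s. cls X Y (n - 1) (expr_diff R C s)) = cls X Y (n - 1) (expr_diff R C s)"
    by (rule UN_cls[OF s])
  then show ?thesis by (simp add: adjoin_def)
qed

lemma diff_closed_adjoin: "f \<in> carrier (dg_hom G X Y n) \<Longrightarrow> dg_diff G X Y n f \<in> carrier (dg_hom G X Y (n - 1))"
  by (auto elim!: hom_clsE simp: is_expr_diff)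

lemma diff_linear_adjoin:
  "f \<in> carrier (dg_hom G X Y n) \<Longrightarrow> g \<in> carrier (dg_hom G X Y n) \<Longrightarrow>
    dg_diff G X Y n (f \<oplus>\<^bsub>dg_hom G X Y n\<^esub> g) = dg_diff G X Y n f \<oplus>\<^bsub>dg_hom G X Y (n - 1)\<^esub> dg_diff G X Y n g"
  "a \<in> carrier R \<Longrightarrow> f \<in> carrier (dg_hom G X Y n) \<Longrightarrow>
    dg_diff G X Y n (a \<odot>\<^bsub>dg_hom G X Y n\<^esub> f) = a \<odot>\<^bsub>dg_hom G X Y (n - 1)\<^esub> dg_diff G X Y n f"
  by (auto elim!: hom_clsE simp: add_cls smult_cls is_expr.Add is_expr.Scal is_expr_diff)

lemma leibniz_adjoin:
  assumes g: "g \<in> carrier (dg_hom G Y Z m)" and f: "f \<in> carrier (dg_hom G X Y n)"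
  shows "dg_diff G X Z (m + n) (dg_comp G X Y Z m n g f) =
    dg_comp G X Y Z (m - 1) n (dg_diff G Y Z m g) f \<oplus>\<^bsub>dg_hom G X Z (m + n - 1)\<^esub>
    ksgn (dg_hom G X Z (m + n - 1)) m (dg_comp G X Y Z m (n - 1) g (dg_diff G X Y n f))"
proof -
  obtain t s where t: "isx Y Z m t" "g = cls Y Z m t" and s: "isx X Y n s" "f = cls X Y n s"
    using f g by (blast elim!: hom_clsE)
  have "dg_diff G X Z (m + n) (dg_comp G X Y Z m n g f) = cls X Z (m + n - 1) (expr_diff R C (Comp t s))"
    using t s diff_cls[OF is_expr.Comp[OF t(1) s(1)]] by (simp add: comp_cls)
  then show ?thesis using cls_diff_Comp[OF t(1) s(1)] t s by simp
qed

text \<open>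
  On generators this is the cycle condition on \<open>v\<close>. On composites the two mixed terms of the iterated
  Leibniz rule carry opposite signs.
\<close>

lemma diff_diff_adjoin:
  "isx X Y n s \<Longrightarrow> dg_diff G X Y (n - 1) (dg_diff G X Y n (cls X Y n s)) = \<zero>\<^bsub>dg_hom G X Y (n - 2)\<^esub>"
proof (induction rule: is_expr.induct)
  case (Old X Y f n)
  then have "isx X Y (n - 1) (Old X Y (n - 1) (dg_diff C X Y n f))" by (simp add: is_expr.Old)
  with Old show ?case by (simp add: is_expr.Old zero_cls)
next
  case (New X Y n v)
  then have "isx X Y n (Old X Y n v)" "dg_diff C X Y n v = \<zero>\<^bsub>dg_hom C X Y (n - 1)\<^esub>"
    using generators[OF New] by (auto simp: cycles_def is_expr.Old)
  then show ?case using New by (simp add: is_expr.New zero_cls)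
next
  case (Add X Y n s t)
  have "cls X Y n s \<in> carrier (dg_hom G X Y n)" "cls X Y n t \<in> carrier (dg_hom G X Y n)"
    using Add.hyps by auto
  then show ?case using Add is_expr_ob[OF Add.hyps(1)]
    by (simp add: add_cls[symmetric] diff_linear_adjoin diff_closed_adjoin del: diff_cls)
next
  case (Scal a X Y n s)
  have "cls X Y n s \<in> carrier (dg_hom G X Y n)" using Scal.hyps by auto
  then show ?case using Scal is_expr_ob[OF Scal.hyps(2)]
    by (simp add: smult_cls[symmetric] diff_linear_adjoin diff_closed_adjoin del: diff_cls)
next
  case (Comp Y Z m t X n s)
  define f g where "f = cls X Y n s" and "g = cls Y Z m t"
  have fg: "f \<in> carrier (dg_hom G X Y n)" "g \<in> carrier (dg_hom G Y Z m)"
    using Comp.hyps by (auto simp: f_def g_def)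
  note cl = fg diff_closed_adjoin[OF fg(1)] diff_closed_adjoin[OF fg(2)]
  have ob: "X \<in> dg_ob C" "Y \<in> dg_ob C" "Z \<in> dg_ob C"
    using Comp.hyps is_expr_ob by auto
  have *: "dg_diff G X Z (m + n - 1) (dg_comp G X Y Z (m - 1) n (dg_diff G Y Z m g) f) =
      ksgn (dg_hom G X Z (m + n - 2)) (m - 1) (dg_comp G X Y Z (m - 1) (n - 1) (dg_diff G Y Z m g) (dg_diff G X Y n f))"
    using leibniz_adjoin[OF cl(4) cl(1)] Comp.IH ob cl
    by (simp add: f_def[symmetric] g_def[symmetric] algebra_simps del: diff_cls)
  have **: "dg_diff G X Z (m + n - 1) (dg_comp G X Y Z m (n - 1) g (dg_diff G X Y n f)) =
      dg_comp G X Y Z (m - 1) (n - 1) (dg_diff G Y Z m g) (dg_diff G X Y n f)"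
    using leibniz_adjoin[OF cl(2) cl(3)] Comp.IH ob cl
    by (simp add: f_def[symmetric] g_def[symmetric] algebra_simps ksgn_def del: diff_cls)
  have "cls X Z (m + n) (Comp t s) = dg_comp G X Y Z m n g f"
    using Comp.hyps by (simp add: f_def g_def comp_cls)
  moreover have "dg_comp G X Y Z m (n - 1) g (dg_diff G X Y n f) \<in> carrier (dg_hom G X Z (m + n - 1))"
    "dg_comp G X Y Z (m - 1) n (dg_diff G Y Z m g) f \<in> carrier (dg_hom G X Z (m + n - 1))"
    "dg_comp G X Y Z (m - 1) (n - 1) (dg_diff G Y Z m g) (dg_diff G X Y n f) \<in> carrier (dg_hom G X Z (m + n - 2))"
    using ob cl by auto
  moreover have "dg_diff G X Z (m + n - 1) (\<ominus>\<^bsub>dg_hom G X Z (m + n - 1)\<^esub> h) =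
      \<ominus>\<^bsub>dg_hom G X Z (m + n - 2)\<^esub> dg_diff G X Z (m + n - 1) h" if "h \<in> carrier (dg_hom G X Z (m + n - 1))" for h
    using diff_linear_adjoin(2)[OF _ that, of "\<ominus> \<one>"] diff_closed_adjoin[OF that] G.hom_smult(3) that ob by simp
  ultimately show ?case
    using leibniz_adjoin[OF fg(2,1)] * ** ob
    by (cases "even m") (simp_all add: ksgn_def diff_linear_adjoin algebra_simps del: diff_cls)
qed

lemma adjoin_dg_category: "dg_category R G"
proof (rule dg_categoryI[OF adjoin_graded_category])
  show "dg_diff G X Y n \<in> module_hom R (dg_hom G X Y n) (dg_hom G X Y (n - 1))" for X Y n
    by (auto simp: module_hom_def diff_linear_adjoin diff_closed_adjoin)
  show "dg_diff G X Y (n - 1) (dg_diff G X Y n f) = \<zero>\<^bsub>dg_hom G X Y (n - 2)\<^esub>"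
    if "f \<in> carrier (dg_hom G X Y n)" for X Y n f
    using that diff_diff_adjoin by (metis hom_clsE)
  show "dg_diff G X X 0 (dg_id G X) = \<zero>\<^bsub>dg_hom G X X (- 1)\<^esub>" if "X \<in> dg_ob G" for X
    using that by (simp add: id_cls zero_cls)
qed (rule leibniz_adjoin)

sublocale G: dg_category R G
  by (rule adjoin_dg_category)

lemma incl_dg_functor: "dg_functor R C G (adjoin_incl R C V)"
  using incl_graded_functor by (simp add: dg_functor_iff is_expr.Old)

lemma new_closed: "(X, Y, n, v) \<in> V \<Longrightarrow> cls X Y (n + 1) (New X Y n v) \<in> carrier (dg_hom G X Y (n + 1))"
  by (simp add: is_expr.New)

lemma diff_new:
  "(X, Y, n, v) \<in> V \<Longrightarrow> dg_diff G X Y (n + 1) (cls X Y (n + 1) (New X Y n v)) = old X Y n v"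
  by (simp add: is_expr.New)

text \<open>
  The dg version of the universal property: the image \<open>W\<close> of a generator over \<open>v\<close> has to be a
  null homotopy of the image of \<open>v\<close>, and then evaluation commutes with differentials on all expressions.
\<close>

lemma extension_exists:
  assumes D: "dg_category R D" and F: "dg_functor R C D F"
    and W: "\<And>X Y n v. (X, Y, n, v) \<in> V \<Longrightarrow> W X Y n v \<in> carrier (dg_hom D (fun_ob F X) (fun_ob F Y) (n + 1))
      \<and> dg_diff D (fun_ob F X) (fun_ob F Y) (n + 1) (W X Y n v) = fun_mor F X Y n v"
  obtains F' where "dg_functor R G D F'" "fun_ob F' = fun_ob F"
    "\<And>X Y n f. \<lbrakk>X \<in> dg_ob C; Y \<in> dg_ob C; f \<in> carrier (dg_hom C X Y n)\<rbrakk> \<Longrightarrow>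
      fun_mor F' X Y n (old X Y n f) = fun_mor F X Y n f"
    "\<And>X Y n v. (X, Y, n, v) \<in> V \<Longrightarrow> fun_mor F' X Y (n + 1) (cls X Y (n + 1) (New X Y n v)) = W X Y n v"
proof -
  interpret D: dg_category R D by (rule D)
  have base: "graded_functor R C D F" using F by (simp add: dg_functor_iff)
  interpret E: evaluation R C V D F W
    by (intro evaluation.intro evaluation_axioms.intro free_extension_axioms D.graded_category_axioms base)
      (use W in blast)
  have "E.ev (expr_diff R C s) = dg_diff D (fun_ob F X) (fun_ob F Y) n (E.ev s)" if "isx X Y n s" for X Y n s
    using that
  proof (induction rule: is_expr.induct)
    case (Old X Y f n)
    then show ?case using F by (simp add: dg_functor_iff)
  next
    case (New X Y n v)
    then show ?case using W by simp
  next
    case (Add X Y n s t)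
    then show ?case
      using is_expr_type[OF Add.hyps(1)] is_expr_type[OF is_expr_diff[OF Add.hyps(1)]]
        E.is_expr_data[OF Add.hyps(1)] E.is_expr_data[OF Add.hyps(2)] by simp
  next
    case (Scal a X Y n s)
    then show ?case
      using is_expr_type[OF Scal.hyps(2)] is_expr_type[OF is_expr_diff[OF Scal.hyps(2)]]
        E.is_expr_data[OF Scal.hyps(2)] by simp
  next
    case (Comp Y Z m t X n s)
    have "isx X Z (m + n - 1) (Comp t (expr_diff R C s))" "isx X Z (m + n - 1) (Comp (expr_diff R C t) s)"
      using Comp.hyps is_expr_diff by (auto intro!: is_expr_Comp)
    note i = E.is_expr_data[OF Comp.hyps(1)] E.is_expr_data[OF Comp.hyps(2)] E.is_expr_data[OF this(1)]
      E.is_expr_data[OF this(2)] E.is_expr_data[OF is_expr_diff[OF Comp.hyps(1)]] E.is_expr_data[OF is_expr_diff[OF Comp.hyps(2)]]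
    then show ?case using Comp.IH
      by (cases "even m") (simp_all add: D.leibniz ksgn_def D.hom_smult diff_add_eq add_diff_eq)
  qed
  then have "dg_functor R G D E.free_functor"
    using E.free_functor_graded by (auto simp: dg_functor_iff is_expr_diff elim!: hom_clsE)
  then show thesis
    by (rule that) (simp_all add: is_expr.Old is_expr.New)
qed

text \<open>
  Every morphism of a free extension is an expression in old and new morphisms.
\<close>

lemma extension_unique:
  assumes F: "graded_functor R G D F" and F': "graded_functor R G D F'"
    and ob: "\<And>X. X \<in> dg_ob C \<Longrightarrow> fun_ob F X = fun_ob F' X"
    and old: "\<And>X Y n f. \<lbrakk>X \<in> dg_ob C; Y \<in> dg_ob C; f \<in> carrier (dg_hom C X Y n)\<rbrakk> \<Longrightarrow>
      fun_mor F X Y n (old X Y n f) = fun_mor F' X Y n (old X Y n f)"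
    and new: "\<And>X Y n v. (X, Y, n, v) \<in> V \<Longrightarrow> fun_mor F X Y (n + 1) (cls X Y (n + 1) (New X Y n v)) =
      fun_mor F' X Y (n + 1) (cls X Y (n + 1) (New X Y n v))"
    and S: "S \<in> carrier (dg_hom G X Y n)"
  shows "fun_mor F X Y n S = fun_mor F' X Y n S"
proof -
  obtain s where s: "isx X Y n s" "S = cls X Y n s" using S by (rule hom_clsE)
  from s(1) have "fun_mor F X Y n (cls X Y n s) = fun_mor F' X Y n (cls X Y n s)"
  proof (induction rule: is_expr.induct)
    case (Comp Y Z m t X n s)
    then show ?case
      using graded_functorD(4)[OF F, of X Y Z "cls Y Z m t" m "cls X Y n s" n] ob is_expr_ob
        graded_functorD(4)[OF F', of X Y Z "cls Y Z m t" m "cls X Y n s" n] by (simp add: comp_cls)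
  next
    case (Add X Y n s t)
    then show ?case
      using graded_functorD(6)[OF F, of X Y "cls X Y n s" n "cls X Y n t"] ob is_expr_ob
        graded_functorD(6)[OF F', of X Y "cls X Y n s" n "cls X Y n t"] by (simp add: add_cls)
  next
    case (Scal a X Y n s)
    then show ?case
      using graded_functorD(7)[OF F, of X Y a "cls X Y n s" n] ob is_expr_ob
        graded_functorD(7)[OF F', of X Y a "cls X Y n s" n] by (simp add: smult_cls)
  qed (use old new in auto)
  then show ?thesis using s by simp
qed

end

section \<open>Homotopic dg functors\<close>

definition dgfun_id :: "('o, 'm, 'o, 'm) dgfun" where
  "dgfun_id = \<lparr>fun_ob = (\<lambda>X. X), fun_mor = (\<lambda>X Y n f. f)\<rparr>"

lemma dgfun_id_simps [simp]: "fun_ob dgfun_id = (\<lambda>X. X)" "fun_mor dgfun_id X Y n f = f"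
  by (simp_all add: dgfun_id_def)

lemma dgfun_comp_simps [simp]:
  "fun_ob (dgfun_comp G F) = (\<lambda>X. fun_ob G (fun_ob F X))"
  "fun_mor (dgfun_comp G F) X Y n f = fun_mor G (fun_ob F X) (fun_ob F Y) n (fun_mor F X Y n f)"
  by (auto simp: dgfun_comp_def)

lemma graded_functor_id: "graded_functor R C C dgfun_id"
  by (auto simp: graded_functor_def module_hom_def)

lemma dg_functor_id: "dg_functor R C C dgfun_id"
  by (simp add: dg_functor_iff graded_functor_id)

lemma graded_functor_comp:
  assumes F: "graded_functor R C D F" and G: "graded_functor R D E G"
  shows "graded_functor R C E (dgfun_comp G F)"
  unfolding graded_functor_def
proof (intro conjI ballI allI)
  show "fun_ob (dgfun_comp G F) \<in> dg_ob C \<rightarrow> dg_ob E"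
    using graded_functorD(1)[OF F] graded_functorD(1)[OF G] by auto
  fix X Y n assume "X \<in> dg_ob C" "Y \<in> dg_ob C"
  then show "fun_mor (dgfun_comp G F) X Y n
      \<in> module_hom R (dg_hom C X Y n) (dg_hom E (fun_ob (dgfun_comp G F) X) (fun_ob (dgfun_comp G F) Y) n)"
    using graded_functorD(1,5-7)[OF F] graded_functorD(5-7)[OF G] by (simp add: module_hom_def)
qed (use graded_functorD(1,3-5)[OF F] graded_functorD(3,4)[OF G] in simp_all)

lemma dg_functor_comp:
  assumes F: "dg_functor R C D F" and G: "dg_functor R D E G"
  shows "dg_functor R C E (dgfun_comp G F)"
proof -
  have "graded_functor R C D F" "graded_functor R D E G" using F G by (simp_all add: dg_functor_iff)
  then show ?thesis
    using F G graded_functor_comp[of R C D F E G] graded_functorD(1,5)[of R C D F] by (simp add: dg_functor_iff)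
qed

lemma dg_functorD:
  assumes "dg_functor R C D F" "X \<in> dg_ob C"
  shows "fun_ob F X \<in> dg_ob D"
    and "Y \<in> dg_ob C \<Longrightarrow> f \<in> carrier (dg_hom C X Y n) \<Longrightarrow>
      fun_mor F X Y n f \<in> carrier (dg_hom D (fun_ob F X) (fun_ob F Y) n)"
    and "Y \<in> dg_ob C \<Longrightarrow> f \<in> carrier (dg_hom C X Y n) \<Longrightarrow> g \<in> carrier (dg_hom C X Y n) \<Longrightarrow>
      fun_mor F X Y n (f \<oplus>\<^bsub>dg_hom C X Y n\<^esub> g) =
      fun_mor F X Y n f \<oplus>\<^bsub>dg_hom D (fun_ob F X) (fun_ob F Y) n\<^esub> fun_mor F X Y n g"
    and "Y \<in> dg_ob C \<Longrightarrow> f \<in> carrier (dg_hom C X Y n) \<Longrightarrow>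
      dg_diff D (fun_ob F X) (fun_ob F Y) n (fun_mor F X Y n f) = fun_mor F X Y (n - 1) (dg_diff C X Y n f)"
  using assms graded_functorD[of R C D F] by (simp_all add: dg_functor_iff)

lemma dg_functor_cong:
  assumes C: "dg_category R C" and F: "dg_functor R C D F" and ob: "fun_ob F' = fun_ob F"
    and eq: "\<And>X Y n f. X \<in> dg_ob C \<Longrightarrow> Y \<in> dg_ob C \<Longrightarrow> f \<in> carrier (dg_hom C X Y n) \<Longrightarrow>
      fun_mor F' X Y n f = fun_mor F X Y n f"
  shows "dg_functor R C D F'"
proof -
  interpret C: dg_category R C by (rule C)
  have "fun_mor F' X Y n \<in> module_hom R (dg_hom C X Y n) (dg_hom D (fun_ob F X) (fun_ob F Y) n)"
    if "X \<in> dg_ob C" "Y \<in> dg_ob C" for X Y n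
    using F that by (simp add: dg_functor_def module_hom_def eq Pi_iff)
  then show ?thesis using F unfolding dg_functor_def ob by (simp add: eq)
qed

context dg_category
begin

lemma hclass_eq_iff:
  assumes ob: "X \<in> dg_ob C" "Y \<in> dg_ob C" and f: "f \<in> carrier (dg_hom C X Y n)" and g: "g \<in> carrier (dg_hom C X Y n)"
  shows "hclass C X Y n f = hclass C X Y n g \<longleftrightarrow>
    (\<exists>k\<in>carrier (dg_hom C X Y (n + 1)). f = g \<oplus>\<^bsub>dg_hom C X Y n\<^esub> dg_diff C X Y (n + 1) k)"
proof -
  define d where "d = dg_diff C X Y (n + 1)"
  have dk: "d k \<in> carrier (dg_hom C X Y n)" if "k \<in> carrier (dg_hom C X Y (n + 1))" for k
    using that ob by (simp add: d_def)
  have mem: "u \<in> hclass C X Y n f \<longleftrightarrow> (\<exists>k\<in>carrier (dg_hom C X Y (n + 1)). u = f \<oplus>\<^bsub>dg_hom C X Y n\<^esub> d k)"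
    if "f \<in> carrier (dg_hom C X Y n)" for u f
    using that ob dk
    by (auto simp: hclass_def a_r_coset_def' boundaries_def d_def[symmetric] hom_add_comm)
  show ?thesis
  proof
    assume "hclass C X Y n f = hclass C X Y n g"
    moreover have "f \<in> hclass C X Y n f"
      unfolding mem[OF f] using ob f
      by (intro bexI[where x = "\<zero>\<^bsub>dg_hom C X Y (n + 1)\<^esub>"]) (auto simp: d_def)
    ultimately show "\<exists>k\<in>carrier (dg_hom C X Y (n + 1)). f = g \<oplus>\<^bsub>dg_hom C X Y n\<^esub> dg_diff C X Y (n + 1) k"
      using mem[OF g] by (simp add: d_def)
  next
    assume "\<exists>k\<in>carrier (dg_hom C X Y (n + 1)). f = g \<oplus>\<^bsub>dg_hom C X Y n\<^esub> dg_diff C X Y (n + 1) k"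
    then obtain k where k: "k \<in> carrier (dg_hom C X Y (n + 1))" "f = g \<oplus>\<^bsub>dg_hom C X Y n\<^esub> d k"
      by (auto simp: d_def)
    have "(\<exists>l\<in>carrier (dg_hom C X Y (n + 1)). u = f \<oplus>\<^bsub>dg_hom C X Y n\<^esub> d l) \<longleftrightarrow>
        (\<exists>l\<in>carrier (dg_hom C X Y (n + 1)). u = g \<oplus>\<^bsub>dg_hom C X Y n\<^esub> d l)" for u
    proof
      assume "\<exists>l\<in>carrier (dg_hom C X Y (n + 1)). u = f \<oplus>\<^bsub>dg_hom C X Y n\<^esub> d l"
      then obtain l where "l \<in> carrier (dg_hom C X Y (n + 1))" "u = f \<oplus>\<^bsub>dg_hom C X Y n\<^esub> d l" by blast
      then show "\<exists>l\<in>carrier (dg_hom C X Y (n + 1)). u = g \<oplus>\<^bsub>dg_hom C X Y n\<^esub> d l"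
        using k g ob dk
        by (intro bexI[where x = "k \<oplus>\<^bsub>dg_hom C X Y (n + 1)\<^esub> l"]) (auto simp: d_def hom_ac)
    next
      assume "\<exists>l\<in>carrier (dg_hom C X Y (n + 1)). u = g \<oplus>\<^bsub>dg_hom C X Y n\<^esub> d l"
      then obtain l where "l \<in> carrier (dg_hom C X Y (n + 1))" "u = g \<oplus>\<^bsub>dg_hom C X Y n\<^esub> d l" by blast
      then show "\<exists>l\<in>carrier (dg_hom C X Y (n + 1)). u = f \<oplus>\<^bsub>dg_hom C X Y n\<^esub> d l"
        using k g ob dk
        by (intro bexI[where x = "\<ominus>\<^bsub>dg_hom C X Y (n + 1)\<^esub> k \<oplus>\<^bsub>dg_hom C X Y (n + 1)\<^esub> l"])
          (auto simp: d_def hom_ac)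
    qed
    then show "hclass C X Y n f = hclass C X Y n g" by (auto simp only: set_eq_iff mem[OF f] mem[OF g])
  qed
qed

end

lemma dg_functor_cycles:
  assumes "dg_category R C" "dg_category R D" "dg_functor R C D F" "X \<in> dg_ob C" "Y \<in> dg_ob C"
    and "f \<in> cycles C X Y n"
  shows "fun_mor F X Y n f \<in> cycles D (fun_ob F X) (fun_ob F Y) n"
proof -
  interpret C: dg_category R C by fact
  interpret D: dg_category R D by fact
  have "fun_mor F X Y (n - 1) \<zero>\<^bsub>dg_hom C X Y (n - 1)\<^esub> = \<zero>\<^bsub>dg_hom D (fun_ob F X) (fun_ob F Y) (n - 1)\<^esub>"
    using assms by (intro graded_functor_zero[OF _ C.graded_category_axioms D.graded_category_axioms])
      (simp_all add: dg_functor_iff)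
  then show ?thesis using assms dg_functorD(2,4)[OF assms(3,4,5)] by (simp add: cycles_def)
qed

lemma dg_functor_hclass:
  assumes "dg_category R C" "dg_category R D" and F: "dg_functor R C D F" and ob: "X \<in> dg_ob C" "Y \<in> dg_ob C"
    and f: "f \<in> carrier (dg_hom C X Y n)" and g: "g \<in> carrier (dg_hom C X Y n)"
    and eq: "hclass C X Y n f = hclass C X Y n g"
  shows "hclass D (fun_ob F X) (fun_ob F Y) n (fun_mor F X Y n f) =
    hclass D (fun_ob F X) (fun_ob F Y) n (fun_mor F X Y n g)"
proof -
  interpret C: dg_category R C by fact
  interpret D: dg_category R D by fact
  obtain k where k: "k \<in> carrier (dg_hom C X Y (n + 1))" "f = g \<oplus>\<^bsub>dg_hom C X Y n\<^esub> dg_diff C X Y (n + 1) k"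
    using eq C.hclass_eq_iff[OF ob f g] by blast
  have "fun_mor F X Y n f = fun_mor F X Y n g \<oplus>\<^bsub>dg_hom D (fun_ob F X) (fun_ob F Y) n\<^esub>
      dg_diff D (fun_ob F X) (fun_ob F Y) (n + 1) (fun_mor F X Y (n + 1) k)"
    using k g ob dg_functorD(3,4)[OF F ob] by simp
  then show ?thesis
    using k f g ob dg_functorD(1)[OF F] dg_functorD(2)[OF F ob] by (subst D.hclass_eq_iff) blast+
qed

text \<open>
  A homotopy is a lift to the path object \<open>der_cat D 1\<close>, that is a derivation \<open>h\<close> of degree \<open>1\<close> with
  \<open>d h + h d = F - F'\<close>.
\<close>

definition dg_homotopic :: "('k, 'r) ring_scheme \<Rightarrow> ('k, 'o, 'm) dgcat \<Rightarrow> ('k, 'p, 'n) dgcat \<Rightarrow>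
    ('o, 'm, 'p, 'n) dgfun \<Rightarrow> ('o, 'm, 'p, 'n) dgfun \<Rightarrow> bool"
  where "dg_homotopic R C D F F' \<longleftrightarrow> fun_ob F' = fun_ob F \<and>
    (\<exists>h. dg_functor R C (der_cat D 1) \<lparr>fun_ob = fun_ob F,
      fun_mor = (\<lambda>X Y n f. (fun_mor F X Y n f, fun_mor F' X Y n f, h X Y n f))\<rparr>)"

text \<open>
  On a cycle \<open>f\<close> the term \<open>h (d f)\<close> of the homotopy formula vanishes, so \<open>F f\<close> and \<open>F' f\<close> differ by \<open>d (h f)\<close>.
\<close>

lemma homotopy_on_cycles:
  assumes "dg_category R C" "dg_category R D"
    and H: "dg_functor R C (der_cat D 1) H"
    and hom: "\<And>f n. f \<in> carrier (dg_hom C X Y n) \<Longrightarrow>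
      fun_mor H X Y n f = (fun_mor F X Y n f, fun_mor F' X Y n f, h X Y n f)"
    and ob: "fun_ob H = fun_ob F"
    and X: "X \<in> dg_ob C" "Y \<in> dg_ob C" and f: "f \<in> cycles C X Y n"
  shows "h X Y n f \<in> carrier (dg_hom D (fun_ob F X) (fun_ob F Y) (n + 1))"
    and "fun_mor F X Y n f = fun_mor F' X Y n f \<oplus>\<^bsub>dg_hom D (fun_ob F X) (fun_ob F Y) n\<^esub>
      dg_diff D (fun_ob F X) (fun_ob F Y) (n + 1) (h X Y n f)"
proof -
  interpret C: dg_category R C by fact
  interpret D: dg_category R D by fact
  interpret P: dg_category R "der_cat D 1" by (rule D.path_dg_category)
  have f': "f \<in> carrier (dg_hom C X Y n)" using f by (simp add: cycles_def)
  have FX: "fun_ob F X \<in> dg_ob D" "fun_ob F Y \<in> dg_ob D" using dg_functorD(1)[OF H] X ob by auto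
  have cl: "(fun_mor F X Y n f, fun_mor F' X Y n f, h X Y n f) \<in> carrier (dg_hom (der_cat D 1) (fun_ob F X) (fun_ob F Y) n)"
    using dg_functorD(2)[OF H X f'] hom[OF f'] ob by simp
  then show "h X Y n f \<in> carrier (dg_hom D (fun_ob F X) (fun_ob F Y) (n + 1))" by simp
  have "(fun_mor F X Y n f, fun_mor F' X Y n f, h X Y n f) \<in> cycles (der_cat D 1) (fun_ob F X) (fun_ob F Y) n"
    using dg_functor_cycles[OF assms(1) P.dg_category_axioms H X f] hom[OF f'] ob by simp
  then have "fun_mor F X Y n f \<oplus>\<^bsub>dg_hom D (fun_ob F X) (fun_ob F Y) n\<^esub> \<ominus>\<^bsub>dg_hom D (fun_ob F X) (fun_ob F Y) n\<^esub>
      (fun_mor F' X Y n f \<oplus>\<^bsub>dg_hom D (fun_ob F X) (fun_ob F Y) n\<^esub>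
      dg_diff D (fun_ob F X) (fun_ob F Y) (n + 1) (h X Y n f)) = \<zero>\<^bsub>dg_hom D (fun_ob F X) (fun_ob F Y) n\<^esub>"
    by (simp add: cycles_def)
  from D.hom_eqI[OF FX _ _ this]
  show "fun_mor F X Y n f = fun_mor F' X Y n f \<oplus>\<^bsub>dg_hom D (fun_ob F X) (fun_ob F Y) n\<^esub>
      dg_diff D (fun_ob F X) (fun_ob F Y) (n + 1) (h X Y n f)"
    using cl FX by simp
qed

lemma homotopic_hclass:
  assumes "dg_category R C" "dg_category R D" "dg_homotopic R C D F F'"
    and X: "X \<in> dg_ob C" "Y \<in> dg_ob C" and f: "f \<in> cycles C X Y n"
  shows "hclass D (fun_ob F X) (fun_ob F Y) n (fun_mor F X Y n f) =
    hclass D (fun_ob F X) (fun_ob F Y) n (fun_mor F' X Y n f)"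
proof -
  interpret D: dg_category R D by fact
  obtain h where H: "dg_functor R C (der_cat D 1) \<lparr>fun_ob = fun_ob F,
      fun_mor = (\<lambda>X Y n f. (fun_mor F X Y n f, fun_mor F' X Y n f, h X Y n f))\<rparr>"
    using assms(3) by (auto simp: dg_homotopic_def)
  note * = homotopy_on_cycles[OF assms(1,2) H _ _ X f, of F F' h, simplified]
  have "fun_ob F X \<in> dg_ob D" "fun_ob F Y \<in> dg_ob D" "fun_mor F X Y n f \<in> carrier (dg_hom D (fun_ob F X) (fun_ob F Y) n)"
    "fun_mor F' X Y n f \<in> carrier (dg_hom D (fun_ob F X) (fun_ob F Y) n)"
    using dg_functorD(1)[OF H] dg_functorD(2)[OF H X, of f n] X f by (simp_all add: cycles_def)
  then show ?thesis using * by (subst D.hclass_eq_iff) auto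
qed

text \<open>
  Homotopic functors induce the same map on homology, so \<open>F\<close> and \<open>G\<close> are inverse to each other on
  homology. They are inverse on objects because homotopies fix objects.
\<close>

theorem homotopy_equivalence_quasi_equivalence:
  assumes C: "dg_category R C" and D: "dg_category R D"
    and F: "dg_functor R C D F" and G: "dg_functor R D C G"
    and GF: "dg_homotopic R C C (dgfun_comp G F) dgfun_id"
    and FG: "dg_homotopic R D D (dgfun_comp F G) dgfun_id"
  shows "quasi_equivalence R C D F"
proof -
  interpret C: dg_category R C by (rule C)
  interpret D: dg_category R D by (rule D)
  have GF_ob: "fun_ob G (fun_ob F X) = X" for X using GF unfolding dg_homotopic_def by (simp add: fun_eq_iff)
  have FG_ob: "fun_ob F (fun_ob G X) = X" for X using FG unfolding dg_homotopic_def by (simp add: fun_eq_iff)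
  have hGF: "hclass C X Y n (fun_mor G (fun_ob F X) (fun_ob F Y) n (fun_mor F X Y n f)) = hclass C X Y n f"
    if "X \<in> dg_ob C" "Y \<in> dg_ob C" "f \<in> cycles C X Y n" for X Y n f
    using homotopic_hclass[OF C C GF that] by (simp add: GF_ob)
  have "\<exists>\<phi>. (\<forall>f\<in>cycles C X Y n. \<phi> (hclass C X Y n f) = hclass D (fun_ob F X) (fun_ob F Y) n (fun_mor F X Y n f))
      \<and> bij_betw \<phi> (homology C X Y n) (homology D (fun_ob F X) (fun_ob F Y) n)"
    if ob: "X \<in> dg_ob C" "Y \<in> dg_ob C" for X Y n
  proof -
    define \<phi> where "\<phi> S = hclass D (fun_ob F X) (fun_ob F Y) n
      (fun_mor F X Y n (SOME f. f \<in> cycles C X Y n \<and> S = hclass C X Y n f))" for S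
    have \<phi>: "\<phi> (hclass C X Y n f) = hclass D (fun_ob F X) (fun_ob F Y) n (fun_mor F X Y n f)"
      if f: "f \<in> cycles C X Y n" for f
    proof -
      define g where "g = (SOME g. g \<in> cycles C X Y n \<and> hclass C X Y n f = hclass C X Y n g)"
      have "g \<in> cycles C X Y n \<and> hclass C X Y n f = hclass C X Y n g"
        unfolding g_def by (rule someI[of _ f]) (simp add: f)
      then show ?thesis
        unfolding \<phi>_def g_def[symmetric] using dg_functor_hclass[OF C D F ob, of g n f] f by (simp add: cycles_def)
    qed
    have "inj_on \<phi> (homology C X Y n)"
    proof (rule inj_onI)
      fix S T assume "S \<in> homology C X Y n" "T \<in> homology C X Y n" and eq: "\<phi> S = \<phi> T"
      then obtain f g where f: "f \<in> cycles C X Y n" "S = hclass C X Y n f" and g: "g \<in> cycles C X Y n" "T = hclass C X Y n g"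
        by (auto simp: homology_def)
      have "fun_mor F X Y n f \<in> carrier (dg_hom D (fun_ob F X) (fun_ob F Y) n)"
        "fun_mor F X Y n g \<in> carrier (dg_hom D (fun_ob F X) (fun_ob F Y) n)"
        using f g dg_functorD(2)[OF F ob] by (auto simp: cycles_def)
      then show "S = T"
        using dg_functor_hclass[OF D C G, of "fun_ob F X" "fun_ob F Y" "fun_mor F X Y n f" n "fun_mor F X Y n g"]
          eq hGF[OF ob] f g ob dg_functorD(1)[OF F] by (simp add: \<phi> GF_ob)
    qed
    moreover have "\<phi> ` homology C X Y n = homology D (fun_ob F X) (fun_ob F Y) n"
    proof (intro equalityI subsetI)
      fix T assume "T \<in> \<phi> ` homology C X Y n"
      then show "T \<in> homology D (fun_ob F X) (fun_ob F Y) n"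
        using dg_functor_cycles[OF C D F ob] by (auto simp: homology_def \<phi>)
    next
      fix T assume "T \<in> homology D (fun_ob F X) (fun_ob F Y) n"
      then obtain g where g: "g \<in> cycles D (fun_ob F X) (fun_ob F Y) n" "T = hclass D (fun_ob F X) (fun_ob F Y) n g"
        by (auto simp: homology_def)
      define f where "f = fun_mor G (fun_ob F X) (fun_ob F Y) n g"
      have "f \<in> cycles C X Y n"
        using dg_functor_cycles[OF D C G _ _ g(1)] ob dg_functorD(1)[OF F] by (simp add: f_def GF_ob)
      moreover from this have "\<phi> (hclass C X Y n f) = T"
        using homotopic_hclass[OF D D FG _ _ g(1)] ob dg_functorD(1)[OF F] g by (simp add: \<phi> f_def GF_ob)
      ultimately show "T \<in> \<phi> ` homology C X Y n" by (auto simp: homology_def)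
    qed
    ultimately show ?thesis using \<phi> unfolding bij_betw_def by (intro exI[of _ \<phi>]) simp
  qed
  moreover have "\<exists>X\<in>dg_ob C. \<exists>u. H0_iso D (fun_ob F X) Z u" if Z: "Z \<in> dg_ob D" for Z
  proof (intro bexI exI)
    have "dg_id D Z \<in> cycles D Z Z 0" using Z by (simp add: cycles_def)
    then show "H0_iso D (fun_ob F (fun_ob G Z)) Z (dg_id D Z)"
      using Z by (auto simp: H0_iso_def FG_ob homologous_def intro!: bexI[of _ "dg_id D Z"])
    show "fun_ob G Z \<in> dg_ob C" using dg_functorD(1)[OF G Z] .
  qed
  ultimately show ?thesis using F by (simp add: quasi_equivalence_def)
qed

lemma dg_homotopic_of_eq:
  assumes C: "dg_category R C" and D: "dg_category R D"
    and F: "dg_functor R C D F" and ob: "fun_ob F' = fun_ob F"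
    and eq: "\<And>X Y n f. \<lbrakk>X \<in> dg_ob C; Y \<in> dg_ob C; f \<in> carrier (dg_hom C X Y n)\<rbrakk> \<Longrightarrow>
      fun_mor F' X Y n f = fun_mor F X Y n f"
  shows "dg_homotopic R C D F F'"
proof -
  interpret C: dg_category R C by (rule C)
  interpret D: dg_category R D by (rule D)
  let ?H = "\<lparr>fun_ob = fun_ob F, fun_mor = (\<lambda>X Y n f.
    (fun_mor F X Y n f, fun_mor F' X Y n f, \<zero>\<^bsub>dg_hom D (fun_ob F X) (fun_ob F Y) (n + 1)\<^esub>))\<rparr>"
  have FG: "graded_functor R C D F" using F by (simp add: dg_functor_iff)
  have "graded_functor R C (der_cat D 1) ?H"
    unfolding graded_functor_def
  proof (intro conjI ballI allI)
    show "fun_ob ?H \<in> dg_ob C \<rightarrow> dg_ob (der_cat D 1)" using dg_functorD(1)[OF F] by auto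
    show "fun_mor ?H X Y n \<in> module_hom R (dg_hom C X Y n) (dg_hom (der_cat D 1) (fun_ob ?H X) (fun_ob ?H Y) n)"
      if "X \<in> dg_ob C" "Y \<in> dg_ob C" for X Y n
      using that graded_functorD[OF FG] by (auto simp: module_hom_def eq)
    show "fun_mor ?H X Z (m + n) (dg_comp C X Y Z m n g f) =
        dg_comp (der_cat D 1) (fun_ob ?H X) (fun_ob ?H Y) (fun_ob ?H Z) m n (fun_mor ?H Y Z m g) (fun_mor ?H X Y n f)"
      if "X \<in> dg_ob C" "Y \<in> dg_ob C" "Z \<in> dg_ob C" "g \<in> carrier (dg_hom C Y Z m)" "f \<in> carrier (dg_hom C X Y n)"
      for X Y Z m n g f
      using that graded_functorD[OF FG] by (auto simp: eq ksgn_def algebra_simps)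
  qed (use graded_functorD[OF FG] in \<open>simp add: eq\<close>)
  then have "dg_functor R C (der_cat D 1) ?H"
    using dg_functorD[OF F] by (auto simp: dg_functor_iff eq)
  then show ?thesis using ob by (auto simp: dg_homotopic_def)
qed

section \<open>Contractible objects\<close>

definition contractible :: "('k, 'o, 'm) dgcat \<Rightarrow> 'o \<Rightarrow> bool"
  where "contractible C B \<longleftrightarrow> B \<in> dg_ob C \<and> dg_id C B \<in> boundaries C B B 0"

text \<open>
  If \<open>d e = 1\<close>, composition with \<open>e\<close> contracts every complex of morphisms into or out of \<open>B\<close>:
  \<open>f = d (e f)\<close> for cycles into \<open>B\<close>, and \<open>f = \<plusminus> d (f e)\<close> for cycles out of \<open>B\<close>.
\<close>

lemma (in dg_category) contractible_acyclic:
  assumes B: "contractible C B" and ob: "X \<in> dg_ob C" "Y \<in> dg_ob C" and XY: "B = X \<or> B = Y"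
    and f: "f \<in> cycles C X Y n"
  shows "\<exists>k\<in>carrier (dg_hom C X Y (n + 1)). dg_diff C X Y (n + 1) k = f"
proof -
  obtain e where e: "e \<in> carrier (dg_hom C B B 1)" "dg_diff C B B 1 e = dg_id C B"
    using B by (auto simp: contractible_def boundaries_def)
  have f': "f \<in> carrier (dg_hom C X Y n)" "dg_diff C X Y n f = \<zero>\<^bsub>dg_hom C X Y (n - 1)\<^esub>"
    using f by (auto simp: cycles_def)
  show ?thesis
  proof (cases "B = Y")
    case True
    then show ?thesis using e f' ob
      by (intro bexI[where x = "dg_comp C X Y Y 1 n e f"]) (auto simp: leibniz' ksgn_def)
  next
    case False
    then show ?thesis using e f' ob XY
      by (intro bexI[where x = "ksgn (dg_hom C X Y (n + 1)) n (dg_comp C X X Y n 1 f e)"])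
        (auto simp: leibniz' ksgn_def)
  qed
qed

context free_extension
begin

text \<open>
  A homotopy on \<open>C\<close> extends to the free extension as soon as each generator \<open>w\<close> over \<open>v\<close> receives a value
  \<open>k\<close> with \<open>d k = F w - F' w - h v\<close>. The right hand side is a cycle by the homotopy formula for \<open>v\<close>, so
  acyclicity of the hom in question provides \<open>k\<close>. The extension is the universal property applied to the
  path object, and its two projections are \<open>F\<close> and \<open>F'\<close> by uniqueness.
\<close>

lemma homotopic_extension:
  assumes D: "dg_category R D" and F: "dg_functor R G D F" and F': "dg_functor R G D F'"
    and homotopic: "dg_homotopic R C D (dgfun_comp F (adjoin_incl R C V)) (dgfun_comp F' (adjoin_incl R C V))"
    and acyclic: "\<And>X Y n v f. (X, Y, n, v) \<in> V \<Longrightarrow> f \<in> cycles D (fun_ob F X) (fun_ob F Y) (n + 1) \<Longrightarrow>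
      \<exists>k\<in>carrier (dg_hom D (fun_ob F X) (fun_ob F Y) (n + 2)). dg_diff D (fun_ob F X) (fun_ob F Y) (n + 2) k = f"
  shows "dg_homotopic R G D F F'"
proof -
  interpret D: dg_category R D by (rule D)
  note P = D.path_dg_category
  obtain h where ob: "fun_ob F' = fun_ob F"
    and H: "dg_functor R C (der_cat D 1) \<lparr>fun_ob = fun_ob F,
      fun_mor = (\<lambda>X Y n f. (fun_mor F X Y n (old X Y n f), fun_mor F' X Y n (old X Y n f), h X Y n f))\<rparr>" (is "dg_functor _ _ _ ?H")
    using homotopic by (auto simp: dg_homotopic_def)
  define w where "w X Y n v = cls X Y (n + 1) (New X Y n v)" for X Y n v
  have step: "\<exists>k. k \<in> carrier (dg_hom D (fun_ob F X) (fun_ob F Y) (n + 2)) \<and>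
      fun_mor F X Y (n + 1) (w X Y n v) \<oplus>\<^bsub>dg_hom D (fun_ob F X) (fun_ob F Y) (n + 1)\<^esub>
      \<ominus>\<^bsub>dg_hom D (fun_ob F X) (fun_ob F Y) (n + 1)\<^esub> (fun_mor F' X Y (n + 1) (w X Y n v)
        \<oplus>\<^bsub>dg_hom D (fun_ob F X) (fun_ob F Y) (n + 1)\<^esub> dg_diff D (fun_ob F X) (fun_ob F Y) (n + 2) k) = h X Y n v"
    if V: "(X, Y, n, v) \<in> V" for X Y n v
  proof -
    have XY: "X \<in> dg_ob C" "Y \<in> dg_ob C" and v: "v \<in> cycles C X Y n" using generators[OF V] by auto
    have FXY: "fun_ob F X \<in> dg_ob D" "fun_ob F Y \<in> dg_ob D" using dg_functorD(1)[OF F] XY by auto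
    let ?M = "dg_hom D (fun_ob F X) (fun_ob F Y) (n + 1)" and ?d = "dg_diff D (fun_ob F X) (fun_ob F Y)"
    have w: "w X Y n v \<in> carrier (dg_hom G X Y (n + 1))" "dg_diff G X Y (n + 1) (w X Y n v) = old X Y n v"
      using new_closed[OF V] diff_new[OF V] by (auto simp: w_def)
    have Fw: "fun_mor F X Y (n + 1) (w X Y n v) \<in> carrier ?M"
      "?d (n + 1) (fun_mor F X Y (n + 1) (w X Y n v)) = fun_mor F X Y n (old X Y n v)"
      using dg_functorD(2,4)[OF F _ _ w(1)] XY w(2) by auto
    have Fw': "fun_mor F' X Y (n + 1) (w X Y n v) \<in> carrier ?M"
      "?d (n + 1) (fun_mor F' X Y (n + 1) (w X Y n v)) = fun_mor F' X Y n (old X Y n v)"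
      using dg_functorD(2,4)[OF F' _ _ w(1)] XY w(2) ob by auto
    have h: "h X Y n v \<in> carrier ?M"
      "fun_mor F X Y n (old X Y n v) = fun_mor F' X Y n (old X Y n v) \<oplus>\<^bsub>dg_hom D (fun_ob F X) (fun_ob F Y) n\<^esub> ?d (n + 1) (h X Y n v)"
      using homotopy_on_cycles[OF dg_category_axioms D H _ _ XY v, of "dgfun_comp F (adjoin_incl R C V)" "dgfun_comp F' (adjoin_incl R C V)" h]
      by (simp_all add: ob)
    have old': "fun_mor F' X Y n (old X Y n v) \<in> carrier (dg_hom D (fun_ob F X) (fun_ob F Y) n)"
      using dg_functorD(2)[OF F', of X Y "old X Y n v" n] v XY ob by (simp add: cycles_def)
    have c: "fun_mor F X Y (n + 1) (w X Y n v) \<oplus>\<^bsub>?M\<^esub> \<ominus>\<^bsub>?M\<^esub> (fun_mor F' X Y (n + 1) (w X Y n v) \<oplus>\<^bsub>?M\<^esub> h X Y n v)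
        \<in> cycles D (fun_ob F X) (fun_ob F Y) (n + 1)" (is "?c \<in> _")
      using Fw Fw' h FXY old' by (simp add: cycles_def D.hom_ac)
    obtain k where k: "k \<in> carrier (dg_hom D (fun_ob F X) (fun_ob F Y) (n + 2))" "?d (n + 2) k = ?c"
      using acyclic[OF V c] by blast
    have "fun_mor F X Y (n + 1) (w X Y n v) \<oplus>\<^bsub>?M\<^esub>
        \<ominus>\<^bsub>?M\<^esub> (fun_mor F' X Y (n + 1) (w X Y n v) \<oplus>\<^bsub>?M\<^esub> ?d (n + 2) k) = h X Y n v"
      unfolding k(2) using Fw(1) Fw'(1) h(1) FXY by (simp add: D.hom_ac)
    with k show ?thesis by blast
  qed
  define k where "k X Y n v = (SOME k. k \<in> carrier (dg_hom D (fun_ob F X) (fun_ob F Y) (n + 2)) \<and>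
      fun_mor F X Y (n + 1) (w X Y n v) \<oplus>\<^bsub>dg_hom D (fun_ob F X) (fun_ob F Y) (n + 1)\<^esub>
      \<ominus>\<^bsub>dg_hom D (fun_ob F X) (fun_ob F Y) (n + 1)\<^esub> (fun_mor F' X Y (n + 1) (w X Y n v)
        \<oplus>\<^bsub>dg_hom D (fun_ob F X) (fun_ob F Y) (n + 1)\<^esub> dg_diff D (fun_ob F X) (fun_ob F Y) (n + 2) k) = h X Y n v)"
    for X Y n v
  note kV = someI_ex[OF step, folded k_def]
  define W where "W X Y n v = (fun_mor F X Y (n + 1) (w X Y n v), fun_mor F' X Y (n + 1) (w X Y n v), k X Y n v)" for X Y n v
  have W: "W X Y n v \<in> carrier (dg_hom (der_cat D 1) (fun_ob ?H X) (fun_ob ?H Y) (n + 1)) \<and>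
      dg_diff (der_cat D 1) (fun_ob ?H X) (fun_ob ?H Y) (n + 1) (W X Y n v) = fun_mor ?H X Y n v"
    if V: "(X, Y, n, v) \<in> V" for X Y n v
  proof -
    have XY: "X \<in> dg_ob C" "Y \<in> dg_ob C" using generators[OF V] by auto
    have w: "w X Y n v \<in> carrier (dg_hom G X Y (n + 1))" "dg_diff G X Y (n + 1) (w X Y n v) = old X Y n v"
      using new_closed[OF V] diff_new[OF V] by (auto simp: w_def)
    show ?thesis
      using dg_functorD(2,4)[OF F _ _ w(1)] dg_functorD(2,4)[OF F' _ _ w(1)] w(2) kV[OF V] XY
      by (simp add: W_def ob algebra_simps)
  qed
  obtain K where K: "dg_functor R G (der_cat D 1) K" "fun_ob K = fun_ob ?H"
    "\<And>X Y n f. \<lbrakk>X \<in> dg_ob C; Y \<in> dg_ob C; f \<in> carrier (dg_hom C X Y n)\<rbrakk> \<Longrightarrow>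
      fun_mor K X Y n (old X Y n f) = fun_mor ?H X Y n f"
    "\<And>X Y n v. (X, Y, n, v) \<in> V \<Longrightarrow> fun_mor K X Y (n + 1) (cls X Y (n + 1) (New X Y n v)) = W X Y n v"
    using extension_exists[OF P H W] by blast
  have KG: "graded_functor R G (der_cat D 1) K" using K(1) by (simp add: dg_functor_iff)
  let ?p0 = "\<lparr>fun_ob = (\<lambda>X. X), fun_mor = (\<lambda>X Y n u. fst u)\<rparr>"
  let ?p1 = "\<lparr>fun_ob = (\<lambda>X. X), fun_mor = (\<lambda>X Y n u. fst (snd u))\<rparr>"
  have p: "graded_functor R (der_cat D 1) D ?p0" "graded_functor R (der_cat D 1) D ?p1"
    by (auto simp: graded_functor_def module_hom_def)
  have "fst (fun_mor K X Y n S) = fun_mor F X Y n S" if "S \<in> carrier (dg_hom G X Y n)" for X Y n S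
    using extension_unique[OF graded_functor_comp[OF KG p(1)] _ _ _ _ that, of F] F K(2-4)
    by (simp add: dg_functor_iff W_def w_def)
  moreover have "fst (snd (fun_mor K X Y n S)) = fun_mor F' X Y n S" if "S \<in> carrier (dg_hom G X Y n)" for X Y n S
    using extension_unique[OF graded_functor_comp[OF KG p(2)] _ _ _ _ that, of F'] F' K(2-4) ob
    by (simp add: dg_functor_iff W_def w_def)
  ultimately have "fun_mor K X Y n S = (fun_mor F X Y n S, fun_mor F' X Y n S, snd (snd (fun_mor K X Y n S)))"
    if "S \<in> carrier (dg_hom G X Y n)" for X Y n S
    using that by (metis prod.collapse)
  then have "dg_functor R G (der_cat D 1) \<lparr>fun_ob = fun_ob F,
      fun_mor = (\<lambda>X Y n S. (fun_mor F X Y n S, fun_mor F' X Y n S, snd (snd (fun_mor K X Y n S))))\<rparr>"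
    using K(2) by (intro dg_functor_cong[OF adjoin_dg_category K(1)]) simp_all
  then show ?thesis unfolding dg_homotopic_def using ob by (intro conjI exI[of _ "\<lambda>X Y n S. snd (snd (fun_mor K X Y n S))"]) simp_all
qed

end

section \<open>Triangles become contractible\<close>

lemma matrix_simps [simp]:
  "matrix a b (matrix a b f) = matrix a b f"
  "i < a \<Longrightarrow> j < b \<Longrightarrow> matrix a b f i j = f i j"
  by (auto simp: matrix_def fun_eq_iff)

context graded_category
begin

lemma tw_hom_abelian_group:
  assumes S: "\<And>i. i < tw_len S \<Longrightarrow> tw_ob S i \<in> dg_ob C" and T: "\<And>i. i < tw_len T \<Longrightarrow> tw_ob T i \<in> dg_ob C"
  shows "abelian_group (tw_hom C S T n)"
proof (rule abelian_groupI)
  fix f assume f: "f \<in> carrier (tw_hom C S T n)"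
  show "\<exists>g\<in>carrier (tw_hom C S T n). g \<oplus>\<^bsub>tw_hom C S T n\<^esub> f = \<zero>\<^bsub>tw_hom C S T n\<^esub>"
    using f S T
    by (intro bexI[where x = "matrix (tw_len T) (tw_len S) (\<lambda>i j. \<ominus>\<^bsub>entry_hom C S T n i j\<^esub> f i j)"])
      (auto simp: tw_hom_def matrix_def entry_hom_def fun_eq_iff)
next
  fix f assume f: "f \<in> carrier (tw_hom C S T n)"
  then have "matrix (tw_len T) (tw_len S) f = f"
    and e: "\<And>i j. i < tw_len T \<Longrightarrow> j < tw_len S \<Longrightarrow> f i j \<in> carrier (entry_hom C S T n i j)"
    by (simp_all add: tw_hom_def)
  moreover have "\<zero>\<^bsub>tw_hom C S T n\<^esub> \<oplus>\<^bsub>tw_hom C S T n\<^esub> f = matrix (tw_len T) (tw_len S) f"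
    using e S T by (auto simp: tw_hom_def matrix_def entry_hom_def fun_eq_iff)
  ultimately show "\<zero>\<^bsub>tw_hom C S T n\<^esub> \<oplus>\<^bsub>tw_hom C S T n\<^esub> f = f" by simp
qed (use S T in \<open>auto simp: tw_hom_def matrix_def entry_hom_def fun_eq_iff hom_ac\<close>)

lemma hom_finsum:
  assumes "X \<in> dg_ob C" "Y \<in> dg_ob C"
  shows "f 0 \<in> carrier (dg_hom C X Y n) \<Longrightarrow> finsum (dg_hom C X Y n) f {..<Suc 0} = f 0"
    and "f 0 \<in> carrier (dg_hom C X Y n) \<Longrightarrow> f (Suc 0) \<in> carrier (dg_hom C X Y n) \<Longrightarrow>
      finsum (dg_hom C X Y n) f {..<Suc (Suc 0)} = f 0 \<oplus>\<^bsub>dg_hom C X Y n\<^esub> f (Suc 0)"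
proof -
  interpret M: abelian_group "dg_hom C X Y n" using assms by blast
  show "f 0 \<in> carrier (dg_hom C X Y n) \<Longrightarrow> finsum (dg_hom C X Y n) f {..<Suc 0} = f 0"
    "f 0 \<in> carrier (dg_hom C X Y n) \<Longrightarrow> f (Suc 0) \<in> carrier (dg_hom C X Y n) \<Longrightarrow>
      finsum (dg_hom C X Y n) f {..<Suc (Suc 0)} = f 0 \<oplus>\<^bsub>dg_hom C X Y n\<^esub> f (Suc 0)"
    by (simp_all add: lessThan_Suc Pi_iff M.a_comm)
qed

end

context dg_category
begin

text \<open>
  The next lemmas spell out, in terms of matrix entries, morphisms of twisted complexes from a single
  object to a single object or to a cone. The twist of a single object is zero, so only the twist
  \<open>f\<close> of the cone contributes to the differential.
\<close>

abbreviation "\<iota> X \<equiv> tw_single C X 0"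

lemma hom_single_single:
  "u \<in> carrier (tw_hom C (\<iota> X) (\<iota> Y) n) \<longleftrightarrow> u = matrix 1 1 u \<and> u 0 0 \<in> carrier (dg_hom C X Y n)"
  by (auto simp: tw_hom_def entry_hom_def tw_single_def)

lemma hom_single_cone:
  "u \<in> carrier (tw_hom C (\<iota> X) (tw_cone C A B f) n) \<longleftrightarrow>
    u = matrix 2 1 u \<and> u 0 0 \<in> carrier (dg_hom C X B n) \<and> u 1 0 \<in> carrier (dg_hom C X A (n - 1))"
  by (auto simp: tw_hom_def entry_hom_def tw_single_def tw_cone_def less_Suc_eq numeral_2_eq_2)

lemma pretr_diff_single:
  assumes X: "X \<in> dg_ob C" and Y: "Y \<in> dg_ob C" and u: "u \<in> carrier (tw_hom C (\<iota> X) (\<iota> Y) n)"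
  shows "dg_diff (pretr C) (\<iota> X) (\<iota> Y) n u = matrix 1 1 (\<lambda>i j. dg_diff C X Y n (u 0 0))"
proof -
  interpret M: abelian_group "tw_hom C (\<iota> X) (\<iota> Y) (n - 1)"
    by (rule tw_hom_abelian_group) (use X Y in \<open>simp_all add: tw_single_def\<close>)
  have u': "u 0 0 \<in> carrier (dg_hom C X Y n)" using u by (simp add: hom_single_single)
  have "tw_comp C (\<iota> X) (\<iota> X) (\<iota> Y) n (-1) u (snd (\<iota> X)) = \<zero>\<^bsub>tw_hom C (\<iota> X) (\<iota> Y) (n - 1)\<^esub>"
    using X Y u' by (auto simp: tw_comp_def tw_hom_def tw_single_def matrix_def entry_hom_def hom_finsum fun_eq_iff)
  moreover have "tw_comp C (\<iota> X) (\<iota> Y) (\<iota> Y) (-1) n (snd (\<iota> Y)) u = \<zero>\<^bsub>tw_hom C (\<iota> X) (\<iota> Y) (n - 1)\<^esub>"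
    using X Y u' by (auto simp: tw_comp_def tw_hom_def tw_single_def matrix_def entry_hom_def hom_finsum fun_eq_iff)
  moreover have "tw_diff0 C (\<iota> X) (\<iota> Y) n u = matrix 1 1 (\<lambda>i j. dg_diff C X Y n (u 0 0))"
    by (auto simp: tw_diff0_def tw_single_def matrix_def entry_hom_def ksgn_def fun_eq_iff)
  moreover have "matrix 1 1 (\<lambda>i j. dg_diff C X Y n (u 0 0)) \<in> carrier (tw_hom C (\<iota> X) (\<iota> Y) (n - 1))"
    using X Y u' by (simp add: hom_single_single)
  ultimately show ?thesis by (simp add: pretr_def ksgn_def)
qed

lemma pretr_diff_cone:
  assumes ob: "X \<in> dg_ob C" "A \<in> dg_ob C" "B \<in> dg_ob C" and f: "f \<in> carrier (dg_hom C A B 0)"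
    and u: "u \<in> carrier (tw_hom C (\<iota> X) (tw_cone C A B f) n)"
  shows "dg_diff (pretr C) (\<iota> X) (tw_cone C A B f) n u = matrix 2 1 (\<lambda>i j.
    if i = 0 then dg_diff C X B n (u 0 0) \<oplus>\<^bsub>dg_hom C X B (n - 1)\<^esub> dg_comp C X A B 0 (n - 1) f (u 1 0)
    else \<ominus>\<^bsub>dg_hom C X A (n - 2)\<^esub> dg_diff C X A (n - 1) (u 1 0))"
proof -
  let ?Q = "tw_cone C A B f"
  interpret M: abelian_group "tw_hom C (\<iota> X) ?Q (n - 1)"
    by (rule tw_hom_abelian_group) (use ob in \<open>auto simp: tw_single_def tw_cone_def less_Suc_eq\<close>)
  have u': "u 0 0 \<in> carrier (dg_hom C X B n)" "u (Suc 0) 0 \<in> carrier (dg_hom C X A (n - 1))"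
    using u by (simp_all add: hom_single_cone)
  have 1: "tw_comp C (\<iota> X) (\<iota> X) ?Q n (-1) u (snd (\<iota> X)) = \<zero>\<^bsub>tw_hom C (\<iota> X) ?Q (n - 1)\<^esub>"
    using ob u' by (auto simp: tw_comp_def tw_hom_def tw_single_def tw_cone_def matrix_def entry_hom_def hom_finsum
        fun_eq_iff less_Suc_eq numeral_2_eq_2)
  have 2: "tw_comp C (\<iota> X) ?Q ?Q (-1) n (snd ?Q) u = matrix 2 1 (\<lambda>i j.
      if i = 0 then dg_comp C X A B 0 (n - 1) f (u 1 0) else \<zero>\<^bsub>dg_hom C X A (n - 2)\<^esub>)"
    using ob u' f by (auto simp: tw_comp_def tw_hom_def tw_single_def tw_cone_def matrix_def entry_hom_def hom_finsum
        fun_eq_iff less_Suc_eq numeral_2_eq_2)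
  have 3: "tw_diff0 C (\<iota> X) ?Q n u = matrix 2 1 (\<lambda>i j. if i = 0 then dg_diff C X B n (u 0 0)
      else \<ominus>\<^bsub>dg_hom C X A (n - 2)\<^esub> dg_diff C X A (n - 1) (u 1 0))"
    by (auto simp: tw_diff0_def tw_single_def tw_cone_def matrix_def entry_hom_def ksgn_def fun_eq_iff less_Suc_eq numeral_2_eq_2)
  have 4: "tw_diff0 C (\<iota> X) ?Q n u \<oplus>\<^bsub>tw_hom C (\<iota> X) ?Q (n - 1)\<^esub> tw_comp C (\<iota> X) ?Q ?Q (-1) n (snd ?Q) u =
      matrix 2 1 (\<lambda>i j.
    if i = 0 then dg_diff C X B n (u 0 0) \<oplus>\<^bsub>dg_hom C X B (n - 1)\<^esub> dg_comp C X A B 0 (n - 1) f (u 1 0)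
    else \<ominus>\<^bsub>dg_hom C X A (n - 2)\<^esub> dg_diff C X A (n - 1) (u 1 0))" (is "_ = ?R")
    unfolding 2 3 using ob u' f
    by (auto simp: tw_hom_def tw_single_def tw_cone_def matrix_def entry_hom_def fun_eq_iff less_Suc_eq numeral_2_eq_2)
  have "?R \<in> carrier (tw_hom C (\<iota> X) ?Q (n - 1))"
    using ob u' f by (simp add: hom_single_cone)
  then show ?thesis by (simp add: pretr_def ksgn_def 1 4)
qed

lemma pretr_comp_single:
  assumes "X \<in> dg_ob C" "Y \<in> dg_ob C" "Z \<in> dg_ob C"
    and "v \<in> carrier (tw_hom C (\<iota> Y) (\<iota> Z) 0)" "u \<in> carrier (tw_hom C (\<iota> X) (\<iota> Y) 0)"
  shows "dg_comp (pretr C) (\<iota> X) (\<iota> Y) (\<iota> Z) 0 0 v u = matrix 1 1 (\<lambda>i j. dg_comp C X Y Z 0 0 (v 0 0) (u 0 0))"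
proof -
  have "v 0 0 \<in> carrier (dg_hom C Y Z 0)" "u 0 0 \<in> carrier (dg_hom C X Y 0)"
    using assms(4,5) by (simp_all add: hom_single_single)
  then show ?thesis using assms(1-3)
    by (auto simp: pretr_def tw_comp_def tw_single_def entry_hom_def hom_finsum matrix_def fun_eq_iff)
qed

lemma pretr_comp_cone:
  assumes "X \<in> dg_ob C" "Y \<in> dg_ob C" "A \<in> dg_ob C" "B \<in> dg_ob C"
    and "v \<in> carrier (tw_hom C (\<iota> Y) (tw_cone C A B f) 0)" "u \<in> carrier (tw_hom C (\<iota> X) (\<iota> Y) 0)"
  shows "dg_comp (pretr C) (\<iota> X) (\<iota> Y) (tw_cone C A B f) 0 0 v u = matrix 2 1 (\<lambda>i j.
    if i = 0 then dg_comp C X Y B 0 0 (v 0 0) (u 0 0) else dg_comp C X Y A (-1) 0 (v 1 0) (u 0 0))"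
proof -
  have "v 0 0 \<in> carrier (dg_hom C Y B 0)" "v (Suc 0) 0 \<in> carrier (dg_hom C Y A (-1))"
    "u 0 0 \<in> carrier (dg_hom C X Y 0)"
    using assms(5,6) by (simp_all add: hom_single_cone hom_single_single)
  then show ?thesis using assms(1-4)
    by (auto simp: pretr_def tw_comp_def tw_single_def tw_cone_def entry_hom_def hom_finsum matrix_def
        fun_eq_iff less_Suc_eq numeral_2_eq_2)
qed

lemma dg_hom_pretr [simp]: "dg_hom (pretr C) = tw_hom C"
  by (simp add: pretr_def)

text \<open>
  Each coset contains its representative because zero is a boundary, as witnessed by \<open>z\<close>. So membership
  of \<open>f\<close> in the coset of \<open>g\<close> exhibits the homotopy.
\<close>

lemma homologous_homotopy:
  assumes hom: "homologous P X Y n f g" and M: "abelian_group (dg_hom P X Y n)"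
    and z: "z \<in> carrier (dg_hom P X Y (n + 1))" "dg_diff P X Y (n + 1) z = \<zero>\<^bsub>dg_hom P X Y n\<^esub>"
  shows "\<exists>k\<in>carrier (dg_hom P X Y (n + 1)). f = dg_diff P X Y (n + 1) k \<oplus>\<^bsub>dg_hom P X Y n\<^esub> g"
proof -
  interpret M: abelian_group "dg_hom P X Y n" by (rule M)
  have f: "f \<in> carrier (dg_hom P X Y n)" using hom by (simp add: homologous_def cycles_def)
  have "\<zero>\<^bsub>dg_hom P X Y n\<^esub> \<in> boundaries P X Y n"
    using z by (force simp: boundaries_def)
  then have "\<zero>\<^bsub>dg_hom P X Y n\<^esub> \<oplus>\<^bsub>dg_hom P X Y n\<^esub> f \<in> hclass P X Y n f"
    unfolding hclass_def a_r_coset_def' by blast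
  then have "f \<in> hclass P X Y n g" using hom f by (simp add: homologous_def)
  then show ?thesis unfolding hclass_def a_r_coset_def' boundaries_def by blast
qed

lemma homologous_single:
  assumes ob: "X \<in> dg_ob C" "Y \<in> dg_ob C" and hom: "homologous (pretr C) (\<iota> X) (\<iota> Y) 0 u v"
  shows "\<exists>k\<in>carrier (dg_hom C X Y 1). u 0 0 = v 0 0 \<oplus>\<^bsub>dg_hom C X Y 0\<^esub> dg_diff C X Y 1 k"
proof -
  let ?z = "matrix 1 1 (\<lambda>i j. \<zero>\<^bsub>dg_hom C X Y 1\<^esub>)"
  have uv: "u \<in> carrier (tw_hom C (\<iota> X) (\<iota> Y) 0)" "v \<in> carrier (tw_hom C (\<iota> X) (\<iota> Y) 0)"
    using hom by (auto simp: homologous_def cycles_def)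
  have M: "abelian_group (dg_hom (pretr C) (\<iota> X) (\<iota> Y) 0)"
    by (simp, rule tw_hom_abelian_group) (use ob in \<open>simp_all add: tw_single_def\<close>)
  have z: "?z \<in> carrier (tw_hom C (\<iota> X) (\<iota> Y) 1)" using ob by (simp add: hom_single_single)
  have "dg_diff (pretr C) (\<iota> X) (\<iota> Y) 1 ?z = \<zero>\<^bsub>tw_hom C (\<iota> X) (\<iota> Y) 0\<^esub>"
    unfolding pretr_diff_single[OF ob z] using ob
    by (auto simp: tw_hom_def matrix_def tw_single_def entry_hom_def fun_eq_iff)
  then obtain k where k: "k \<in> carrier (tw_hom C (\<iota> X) (\<iota> Y) 1)"
      "u = dg_diff (pretr C) (\<iota> X) (\<iota> Y) 1 k \<oplus>\<^bsub>tw_hom C (\<iota> X) (\<iota> Y) 0\<^esub> v"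
    using homologous_homotopy[OF hom M, of ?z] z by auto
  have "u 0 0 = dg_diff C X Y 1 (k 0 0) \<oplus>\<^bsub>dg_hom C X Y 0\<^esub> v 0 0"
    using k(2) unfolding pretr_diff_single[OF ob k(1)]
    by (simp add: tw_hom_def matrix_def tw_single_def entry_hom_def)
  moreover have "k 0 0 \<in> carrier (dg_hom C X Y 1)" "v 0 0 \<in> carrier (dg_hom C X Y 0)"
    using k(1) uv(2) by (simp_all add: hom_single_single)
  ultimately show ?thesis using ob hom_add_comm by auto
qed

lemma homologous_cone:
  assumes ob: "X \<in> dg_ob C" "A \<in> dg_ob C" "B \<in> dg_ob C" and f: "f \<in> carrier (dg_hom C A B 0)"
    and hom: "homologous (pretr C) (\<iota> X) (tw_cone C A B f) 0 u v"
  shows "\<exists>k\<in>carrier (dg_hom C X B 1). \<exists>l\<in>carrier (dg_hom C X A 0).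
    u 0 0 = v 0 0 \<oplus>\<^bsub>dg_hom C X B 0\<^esub> (dg_diff C X B 1 k \<oplus>\<^bsub>dg_hom C X B 0\<^esub> dg_comp C X A B 0 0 f l) \<and>
    u 1 0 = v 1 0 \<oplus>\<^bsub>dg_hom C X A (-1)\<^esub> \<ominus>\<^bsub>dg_hom C X A (-1)\<^esub> dg_diff C X A 0 l"
proof -
  let ?Q = "tw_cone C A B f"
  let ?z = "matrix 2 1 (\<lambda>i j. if i = 0 then \<zero>\<^bsub>dg_hom C X B 1\<^esub> else \<zero>\<^bsub>dg_hom C X A 0\<^esub>)"
  have uv: "u \<in> carrier (tw_hom C (\<iota> X) ?Q 0)" "v \<in> carrier (tw_hom C (\<iota> X) ?Q 0)"
    using hom by (auto simp: homologous_def cycles_def)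
  have M: "abelian_group (dg_hom (pretr C) (\<iota> X) ?Q 0)"
    by (simp, rule tw_hom_abelian_group) (use ob in \<open>auto simp: tw_single_def tw_cone_def less_Suc_eq\<close>)
  have z: "?z \<in> carrier (tw_hom C (\<iota> X) ?Q 1)" using ob by (simp add: hom_single_cone)
  have "dg_diff (pretr C) (\<iota> X) ?Q 1 ?z = \<zero>\<^bsub>tw_hom C (\<iota> X) ?Q 0\<^esub>"
    unfolding pretr_diff_cone[OF ob f z] using ob f diff_linear(3)[of X A 0]
    by (auto simp: tw_hom_def matrix_def tw_single_def tw_cone_def entry_hom_def fun_eq_iff less_Suc_eq numeral_2_eq_2)
  then obtain k where k: "k \<in> carrier (tw_hom C (\<iota> X) ?Q 1)"
      "u = dg_diff (pretr C) (\<iota> X) ?Q 1 k \<oplus>\<^bsub>tw_hom C (\<iota> X) ?Q 0\<^esub> v"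
    using homologous_homotopy[OF hom M, of ?z] z by auto
  have "u 0 0 = (dg_diff C X B 1 (k 0 0) \<oplus>\<^bsub>dg_hom C X B 0\<^esub> dg_comp C X A B 0 0 f (k 1 0)) \<oplus>\<^bsub>dg_hom C X B 0\<^esub> v 0 0"
    "u 1 0 = \<ominus>\<^bsub>dg_hom C X A (-1)\<^esub> dg_diff C X A 0 (k 1 0) \<oplus>\<^bsub>dg_hom C X A (-1)\<^esub> v 1 0"
    using k(2) unfolding pretr_diff_cone[OF ob f k(1)]
    by (simp_all add: tw_hom_def matrix_def tw_single_def tw_cone_def entry_hom_def)
  moreover have kv: "k 0 0 \<in> carrier (dg_hom C X B 1)" "k 1 0 \<in> carrier (dg_hom C X A 0)"
    "v 0 0 \<in> carrier (dg_hom C X B 0)" "v 1 0 \<in> carrier (dg_hom C X A (-1))"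
    using k(1) uv(2) by (simp_all add: hom_single_cone)
  moreover have "dg_diff C X A 0 (k 1 0) \<in> carrier (dg_hom C X A (-1))" using kv ob by simp
  ultimately show ?thesis using ob f
    by (intro bexI[of _ "k 0 0"] bexI[of _ "k 1 0"]) (auto simp: hom_ac)
qed

lemma cycles_single:
  assumes ob: "X \<in> dg_ob C" "Y \<in> dg_ob C" and u: "u \<in> cycles (pretr C) (\<iota> X) (\<iota> Y) 0"
  shows "u 0 0 \<in> cycles C X Y 0"
proof -
  have u': "u \<in> carrier (tw_hom C (\<iota> X) (\<iota> Y) 0)" "dg_diff (pretr C) (\<iota> X) (\<iota> Y) 0 u = \<zero>\<^bsub>tw_hom C (\<iota> X) (\<iota> Y) (-1)\<^esub>"
    using u by (auto simp: cycles_def)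
  have "dg_diff C X Y 0 (u 0 0) = \<zero>\<^bsub>dg_hom C X Y (-1)\<^esub>"
    using fun_cong[OF fun_cong[OF u'(2)], of 0 0] unfolding pretr_diff_single[OF ob u'(1)]
    by (simp add: tw_hom_def matrix_def tw_single_def entry_hom_def)
  then show ?thesis using u'(1) by (simp add: cycles_def hom_single_single)
qed

lemma cycles_cone:
  assumes ob: "X \<in> dg_ob C" "A \<in> dg_ob C" "B \<in> dg_ob C" and f: "f \<in> carrier (dg_hom C A B 0)"
    and u: "u \<in> cycles (pretr C) (\<iota> X) (tw_cone C A B f) 0"
  shows "dg_diff C X B 0 (u 0 0) \<oplus>\<^bsub>dg_hom C X B (-1)\<^esub> dg_comp C X A B 0 (-1) f (u 1 0) = \<zero>\<^bsub>dg_hom C X B (-1)\<^esub>"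
    and "u 1 0 \<in> cycles C X A (-1)"
proof -
  let ?Q = "tw_cone C A B f"
  have u': "u \<in> carrier (tw_hom C (\<iota> X) ?Q 0)" "dg_diff (pretr C) (\<iota> X) ?Q 0 u = \<zero>\<^bsub>tw_hom C (\<iota> X) ?Q (-1)\<^esub>"
    using u by (auto simp: cycles_def)
  note eq = u'(2)[unfolded pretr_diff_cone[OF ob f u'(1)]]
  have 10: "u 1 0 \<in> carrier (dg_hom C X A (-1))" using u'(1) by (simp add: hom_single_cone)
  show "dg_diff C X B 0 (u 0 0) \<oplus>\<^bsub>dg_hom C X B (-1)\<^esub> dg_comp C X A B 0 (-1) f (u 1 0) = \<zero>\<^bsub>dg_hom C X B (-1)\<^esub>"
    using fun_cong[OF fun_cong[OF eq], of 0 0]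
    by (simp add: tw_hom_def matrix_def tw_single_def tw_cone_def entry_hom_def)
  have "\<ominus>\<^bsub>dg_hom C X A (-2)\<^esub> dg_diff C X A (-1) (u 1 0) = \<zero>\<^bsub>dg_hom C X A (-2)\<^esub>"
    using fun_cong[OF fun_cong[OF eq], of 1 0]
    by (simp add: tw_hom_def matrix_def tw_single_def tw_cone_def entry_hom_def)
  then have "\<ominus>\<^bsub>dg_hom C X A (-2)\<^esub> (\<ominus>\<^bsub>dg_hom C X A (-2)\<^esub> dg_diff C X A (-1) (u 1 0)) = \<zero>\<^bsub>dg_hom C X A (-2)\<^esub>"
    using ob by simp
  then have "dg_diff C X A (-1) (u 1 0) = \<zero>\<^bsub>dg_hom C X A (-2)\<^esub>"
    using ob 10 by (subst (asm) hom_minus(2)) auto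
  then show "u 1 0 \<in> cycles C X A (-1)" using 10 by (simp add: cycles_def)
qed

text \<open>
  The long exact sequence argument in explicit form. In a category where \<open>x = d s\<close> and \<open>y = d t\<close>, the
  identity of \<open>B\<close> composes to zero with \<open>y\<close> in homology, hence factors through \<open>x\<close>, which is zero too. With
  the isomorphism \<open>b\<close> in place of the identity and the cone of \<open>f\<close> in place of \<open>K\<close>, the homotopy
  \<open>c y \<sim> (inclusion) b\<close> with components \<open>u0\<close>, \<open>u1\<close> gives \<open>b = d v + f g\<close> for \<open>v = c0 t - u0\<close> and the cycle
  \<open>g = c1 t - u1\<close>, while \<open>f a \<sim> b x = d (b s)\<close> and the right inverse of \<open>a\<close> show \<open>f = d l\<close>. So \<open>b\<close> is a
  boundary, and a left inverse of \<open>b\<close> turns this into a contraction \<open>e\<close> of \<open>B\<close>.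
\<close>

lemma contractible_of_cone:
  assumes ob: "A \<in> dg_ob C" "B \<in> dg_ob C" "K \<in> dg_ob C" "A' \<in> dg_ob C" "B' \<in> dg_ob C"
    and x: "s \<in> carrier (dg_hom C A B 1)" "dg_diff C A B 1 s = x"
    and y: "t \<in> carrier (dg_hom C B K 1)" "dg_diff C B K 1 t = y"
    and f: "f \<in> cycles C A' B' 0"
    and a: "a \<in> cycles C A A' 0" "a' \<in> cycles C A' A 0" "p \<in> carrier (dg_hom C A' A' 1)"
      "dg_comp C A' A A' 0 0 a a' = dg_id C A' \<oplus>\<^bsub>dg_hom C A' A' 0\<^esub> dg_diff C A' A' 1 p"
    and b: "b \<in> cycles C B B' 0" "b' \<in> cycles C B' B 0" "q \<in> carrier (dg_hom C B B 1)"
      "dg_comp C B B' B 0 0 b' b = dg_id C B \<oplus>\<^bsub>dg_hom C B B 0\<^esub> dg_diff C B B 1 q"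
    and r: "r \<in> carrier (dg_hom C A B' 1)"
      "dg_comp C A B B' 0 0 b x = dg_comp C A A' B' 0 0 f a \<oplus>\<^bsub>dg_hom C A B' 0\<^esub> dg_diff C A B' 1 r"
    and c: "c0 \<in> carrier (dg_hom C K B' 0)" "c1 \<in> cycles C K A' (-1)"
      "dg_diff C K B' 0 c0 \<oplus>\<^bsub>dg_hom C K B' (-1)\<^esub> dg_comp C K A' B' 0 (-1) f c1 = \<zero>\<^bsub>dg_hom C K B' (-1)\<^esub>"
    and u: "u0 \<in> carrier (dg_hom C B B' 1)" "u1 \<in> carrier (dg_hom C B A' 0)"
      "dg_comp C B K B' 0 0 c0 y = b \<oplus>\<^bsub>dg_hom C B B' 0\<^esub> (dg_diff C B B' 1 u0 \<oplus>\<^bsub>dg_hom C B B' 0\<^esub> dg_comp C B A' B' 0 0 f u1)"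
      "dg_comp C B K A' (-1) 0 c1 y = \<ominus>\<^bsub>dg_hom C B A' (-1)\<^esub> dg_diff C B A' 0 u1"
  shows "contractible C B"
proof -
  have cl: "f \<in> carrier (dg_hom C A' B' 0)" "a \<in> carrier (dg_hom C A A' 0)" "a' \<in> carrier (dg_hom C A' A 0)"
    "b \<in> carrier (dg_hom C B B' 0)" "b' \<in> carrier (dg_hom C B' B 0)" "c1 \<in> carrier (dg_hom C K A' (-1))"
    and d: "dg_diff C A' B' 0 f = \<zero>\<^bsub>dg_hom C A' B' (-1)\<^esub>" "dg_diff C A A' 0 a = \<zero>\<^bsub>dg_hom C A A' (-1)\<^esub>"
    "dg_diff C A' A 0 a' = \<zero>\<^bsub>dg_hom C A' A (-1)\<^esub>" "dg_diff C B B' 0 b = \<zero>\<^bsub>dg_hom C B B' (-1)\<^esub>"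
    "dg_diff C B' B 0 b' = \<zero>\<^bsub>dg_hom C B' B (-1)\<^esub>" "dg_diff C K A' (-1) c1 = \<zero>\<^bsub>dg_hom C K A' (-2)\<^esub>"
    using f a b c by (simp_all add: cycles_def)
  \<comment> \<open>The component of the null homotopy that maps to the source of \<open>f\<close>; it is a cycle because \<open>d u1 = - c1 y\<close>.\<close>
  define g where "g = dg_comp C B K A' (-1) 1 c1 t \<oplus>\<^bsub>dg_hom C B A' 0\<^esub> \<ominus>\<^bsub>dg_hom C B A' 0\<^esub> u1"
  have g: "g \<in> carrier (dg_hom C B A' 0)" "dg_diff C B A' 0 g = \<zero>\<^bsub>dg_hom C B A' (-1)\<^esub>"
    using ob cl y u d by (auto simp: g_def leibniz' ksgn_def)
  define v where "v = dg_comp C B K B' 0 1 c0 t \<oplus>\<^bsub>dg_hom C B B' 1\<^esub> \<ominus>\<^bsub>dg_hom C B B' 1\<^esub> u0"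
  have v: "v \<in> carrier (dg_hom C B B' 1)" using ob cl y u c by (simp add: v_def)
  have dc0: "dg_diff C K B' 0 c0 = \<ominus>\<^bsub>dg_hom C K B' (-1)\<^esub> dg_comp C K A' B' 0 (-1) f c1"
    by (rule hom_eqI[of K B' _ "-1"]) (use ob cl c in simp_all)
  have b_eq: "b = dg_diff C B B' 1 v \<oplus>\<^bsub>dg_hom C B B' 0\<^esub> dg_comp C B A' B' 0 0 f g"
    using ob cl y u c by (simp add: g_def v_def leibniz' ksgn_def dc0 comp_assoc' hom_ac hom_cancel)
  \<comment> \<open>A null homotopy of \<open>f a\<close>, since \<open>f a = b x - d r\<close> and \<open>b x = d (b s)\<close>.\<close>
  define w where "w = dg_comp C A B B' 0 1 b s \<oplus>\<^bsub>dg_hom C A B' 1\<^esub> \<ominus>\<^bsub>dg_hom C A B' 1\<^esub> r"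
  have x': "x \<in> carrier (dg_hom C A B 0)" using x ob by auto
  have w: "w \<in> carrier (dg_hom C A B' 1)" "dg_diff C A B' 1 w = dg_comp C A A' B' 0 0 f a"
    using ob cl x x' r d by (simp_all add: w_def leibniz' ksgn_def hom_add_assoc)
  \<comment> \<open>A null homotopy of \<open>f\<close>, since \<open>f = f a a' - f (d p)\<close>.\<close>
  define l where "l = dg_comp C A' A B' 1 0 w a'
    \<oplus>\<^bsub>dg_hom C A' B' 1\<^esub> \<ominus>\<^bsub>dg_hom C A' B' 1\<^esub> dg_comp C A' A' B' 0 1 f p"
  have l: "l \<in> carrier (dg_hom C A' B' 1)" using ob cl w a by (simp add: l_def)
  have "dg_diff C A' B' 1 l = f"
    using ob cl w a d by (simp add: l_def leibniz' ksgn_def comp_assoc' hom_add_assoc)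
  then have b_bd: "b = dg_diff C B B' 1 (v \<oplus>\<^bsub>dg_hom C B B' 1\<^esub> dg_comp C B A' B' 1 0 l g)"
    using b_eq ob v l g cl(1) by (simp add: leibniz' ksgn_def)
  define e where "e = dg_comp C B B' B 0 1 b' (v \<oplus>\<^bsub>dg_hom C B B' 1\<^esub> dg_comp C B A' B' 1 0 l g)
    \<oplus>\<^bsub>dg_hom C B B 1\<^esub> \<ominus>\<^bsub>dg_hom C B B 1\<^esub> q"
  have "e \<in> carrier (dg_hom C B B 1)" using ob cl v l g b by (simp add: e_def)
  moreover have "dg_diff C B B 1 e = dg_comp C B B' B 0 0 b' b \<oplus>\<^bsub>dg_hom C B B 0\<^esub> \<ominus>\<^bsub>dg_hom C B B 0\<^esub> dg_diff C B B 1 q"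
    using ob cl v l g b d by (subst b_bd) (simp add: e_def leibniz' ksgn_def)
  then have "dg_diff C B B 1 e = dg_id C B"
    using b ob by (simp add: hom_ac)
  ultimately show ?thesis using ob by (force simp: contractible_def boundaries_def)
qed

end

lemma (in dg_category) pretr_id_single: "dg_id (pretr C) (\<iota> X) 0 0 = dg_id C X"
  by (simp add: pretr_def tw_single_def matrix_def)

text \<open>
  The data of the triangle live in \<open>C\<close> and are transported along \<open>J\<close>, where \<open>x\<close> and \<open>y\<close> have become
  boundaries.
\<close>

lemma exact_triangle_contractible:
  assumes "dg_category R C" and triangle: "exact_triangle C A B K S \<sigma> x y z"
    and "dg_category R E" and J: "dg_functor R C E J"
    and x: "fun_mor J A B 0 x \<in> boundaries E (fun_ob J A) (fun_ob J B) 0"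
    and y: "fun_mor J B K 0 y \<in> boundaries E (fun_ob J B) (fun_ob J K) 0"
  shows "contractible E (fun_ob J B)"
proof -
  interpret C: dg_category R C by fact
  interpret E: dg_category R E by fact
  let ?P = "pretr C"
  have ob: "A \<in> dg_ob C" "B \<in> dg_ob C" "K \<in> dg_ob C" and xy: "x \<in> cycles C A B 0" "y \<in> cycles C B K 0"
    using triangle by (auto simp: exact_triangle_def)
  obtain A' B' f a b c where ob': "A' \<in> dg_ob C" "B' \<in> dg_ob C" and f: "f \<in> cycles C A' B' 0"
    and a: "H0_iso ?P (C.\<iota> A) (C.\<iota> A') a" and b: "H0_iso ?P (C.\<iota> B) (C.\<iota> B') b"
    and c: "H0_iso ?P (C.\<iota> K) (tw_cone C A' B' f) c"
    and bx: "homologous ?P (C.\<iota> A) (C.\<iota> B') 0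
        (dg_comp ?P (C.\<iota> A) (C.\<iota> B) (C.\<iota> B') 0 0 b (matrix 1 1 (\<lambda>i j. x)))
        (dg_comp ?P (C.\<iota> A) (C.\<iota> A') (C.\<iota> B') 0 0 (matrix 1 1 (\<lambda>i j. f)) a)"
    and cy: "homologous ?P (C.\<iota> B) (tw_cone C A' B' f) 0
        (dg_comp ?P (C.\<iota> B) (C.\<iota> K) (tw_cone C A' B' f) 0 0 c (matrix 1 1 (\<lambda>i j. y)))
        (dg_comp ?P (C.\<iota> B) (C.\<iota> B') (tw_cone C A' B' f) 0 0 (cone_in C A' B') b)"
    using triangle by (auto simp: exact_triangle_def Let_def)
  obtain a' where a': "a \<in> cycles ?P (C.\<iota> A) (C.\<iota> A') 0" "a' \<in> cycles ?P (C.\<iota> A') (C.\<iota> A) 0"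
    "homologous ?P (C.\<iota> A') (C.\<iota> A') 0 (dg_comp ?P (C.\<iota> A') (C.\<iota> A) (C.\<iota> A') 0 0 a a') (dg_id ?P (C.\<iota> A'))"
    using a by (auto simp: H0_iso_def)
  obtain b' where b': "b \<in> cycles ?P (C.\<iota> B) (C.\<iota> B') 0" "b' \<in> cycles ?P (C.\<iota> B') (C.\<iota> B) 0"
    "homologous ?P (C.\<iota> B) (C.\<iota> B) 0 (dg_comp ?P (C.\<iota> B) (C.\<iota> B') (C.\<iota> B) 0 0 b' b) (dg_id ?P (C.\<iota> B))"
    using b by (auto simp: H0_iso_def)
  have c': "c \<in> cycles ?P (C.\<iota> K) (tw_cone C A' B' f) 0" using c by (simp add: H0_iso_def)
  have f': "f \<in> carrier (dg_hom C A' B' 0)" using f by (simp add: cycles_def)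
  have single: "matrix 1 1 (\<lambda>i j. u) \<in> carrier (tw_hom C (C.\<iota> X) (C.\<iota> Y) 0)"
    if "u \<in> cycles C X Y 0" for u X Y
    using that by (simp add: C.hom_single_single cycles_def)
  have carr: "u \<in> carrier (tw_hom C S T n)" if "u \<in> cycles ?P S T n" for u S T n
    using that by (simp add: cycles_def)
  have "cone_in C A' B' \<in> carrier (tw_hom C (C.\<iota> B') (tw_cone C A' B' f) 0)"
    using ob' by (simp add: C.hom_single_cone cone_in_def)
  note entries = carr[OF a'(1)] carr[OF a'(2)] carr[OF b'(1)] carr[OF b'(2)] carr[OF c'] single[OF xy(1)] single[OF xy(2)]
    single[OF f] this
  let ?a = "a 0 0" and ?a' = "a' 0 0" and ?b = "b 0 0" and ?b' = "b' 0 0" and ?c0 = "c 0 0" and ?c1 = "c 1 0"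
  have cyc: "?a \<in> cycles C A A' 0" "?a' \<in> cycles C A' A 0" "?b \<in> cycles C B B' 0" "?b' \<in> cycles C B' B 0"
    using C.cycles_single a' b' ob ob' by auto
  have cl: "x \<in> carrier (dg_hom C A B 0)" "y \<in> carrier (dg_hom C B K 0)" "f \<in> carrier (dg_hom C A' B' 0)"
    "?a \<in> carrier (dg_hom C A A' 0)" "?a' \<in> carrier (dg_hom C A' A 0)" "?b \<in> carrier (dg_hom C B B' 0)"
    "?b' \<in> carrier (dg_hom C B' B 0)" "?c0 \<in> carrier (dg_hom C K B' 0)" "?c1 \<in> carrier (dg_hom C K A' (-1))"
    using xy f cyc carr[OF c'] by (auto simp: cycles_def C.hom_single_cone)
  note c_closed = C.cycles_cone[OF ob(3) ob' f' c']
  obtain p where p: "p \<in> carrier (dg_hom C A' A' 1)"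
      "dg_comp C A' A A' 0 0 ?a ?a' = dg_id C A' \<oplus>\<^bsub>dg_hom C A' A' 0\<^esub> dg_diff C A' A' 1 p"
    using C.homologous_single[OF ob'(1) ob'(1) a'(3)] ob ob' entries by (auto simp: C.pretr_comp_single C.pretr_id_single)
  obtain q where q: "q \<in> carrier (dg_hom C B B 1)"
      "dg_comp C B B' B 0 0 ?b' ?b = dg_id C B \<oplus>\<^bsub>dg_hom C B B 0\<^esub> dg_diff C B B 1 q"
    using C.homologous_single[OF ob(2) ob(2) b'(3)] ob ob' entries by (auto simp: C.pretr_comp_single C.pretr_id_single)
  obtain r where r: "r \<in> carrier (dg_hom C A B' 1)"
      "dg_comp C A B B' 0 0 ?b x = dg_comp C A A' B' 0 0 f ?a \<oplus>\<^bsub>dg_hom C A B' 0\<^esub> dg_diff C A B' 1 r"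
    using C.homologous_single[OF ob(1) ob'(2) bx] ob ob' entries by (auto simp: C.pretr_comp_single)
  obtain u0 u1 where u: "u0 \<in> carrier (dg_hom C B B' 1)" "u1 \<in> carrier (dg_hom C B A' 0)"
      "dg_comp C B K B' 0 0 ?c0 y = ?b \<oplus>\<^bsub>dg_hom C B B' 0\<^esub> (dg_diff C B B' 1 u0 \<oplus>\<^bsub>dg_hom C B B' 0\<^esub> dg_comp C B A' B' 0 0 f u1)"
      "dg_comp C B K A' (-1) 0 ?c1 y = \<ominus>\<^bsub>dg_hom C B A' (-1)\<^esub> dg_diff C B A' 0 u1"
    using C.homologous_cone[OF ob(2) ob' f' cy] ob ob' entries cl by (auto simp: C.pretr_comp_cone cone_in_def)
  obtain s t where s: "s \<in> carrier (dg_hom E (fun_ob J A) (fun_ob J B) 1)" "dg_diff E (fun_ob J A) (fun_ob J B) 1 s = fun_mor J A B 0 x"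
    and t: "t \<in> carrier (dg_hom E (fun_ob J B) (fun_ob J K) 1)" "dg_diff E (fun_ob J B) (fun_ob J K) 1 t = fun_mor J B K 0 y"
    using x y by (auto simp: boundaries_def)
  have JG: "graded_functor R C E J" using J by (simp add: dg_functor_iff)
  have J_comp: "fun_mor J X Z k (dg_comp C X Y Z m n g f) =
      dg_comp E (fun_ob J X) (fun_ob J Y) (fun_ob J Z) m n (fun_mor J Y Z m g) (fun_mor J X Y n f)"
    if "X \<in> dg_ob C" "Y \<in> dg_ob C" "Z \<in> dg_ob C" "g \<in> carrier (dg_hom C Y Z m)" "f \<in> carrier (dg_hom C X Y n)" "k = m + n"
    for X Y Z k m n g f
    using graded_functorD(4)[OF JG] that by simp
  have J_diff: "fun_mor J X Y k (dg_diff C X Y n f) = dg_diff E (fun_ob J X) (fun_ob J Y) n (fun_mor J X Y n f)"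
    if "X \<in> dg_ob C" "Y \<in> dg_ob C" "f \<in> carrier (dg_hom C X Y n)" "k = n - 1" for X Y k n f
    using dg_functorD(4)[OF J] that by simp
  note J_simps = J_comp J_diff graded_functorD(1,3,5,6)[OF JG]
    graded_functor_zero[OF JG C.graded_category_axioms E.graded_category_axioms]
    graded_functor_minus[OF JG C.graded_category_axioms E.graded_category_axioms]
  note J_cycles = dg_functor_cycles[OF assms(1,3) J]
  show ?thesis
  proof (rule E.contractible_of_cone[OF _ _ _ _ _ s t J_cycles[OF _ _ f] J_cycles[OF _ _ cyc(1)] J_cycles[OF _ _ cyc(2)]
        _ _ J_cycles[OF _ _ cyc(3)] J_cycles[OF _ _ cyc(4)] _ _ _ _ _ J_cycles[OF _ _ c_closed(2)]])
    show "dg_comp E (fun_ob J A') (fun_ob J A) (fun_ob J A') 0 0 (fun_mor J A A' 0 ?a) (fun_mor J A' A 0 ?a') =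
      dg_id E (fun_ob J A') \<oplus>\<^bsub>dg_hom E (fun_ob J A') (fun_ob J A') 0\<^esub> dg_diff E (fun_ob J A') (fun_ob J A') 1 (fun_mor J A' A' 1 p)"
      using arg_cong[OF p(2), of "fun_mor J A' A' 0"] ob ob' cl p(1) by (simp add: J_simps)
    show "dg_comp E (fun_ob J B) (fun_ob J B') (fun_ob J B) 0 0 (fun_mor J B' B 0 ?b') (fun_mor J B B' 0 ?b) =
      dg_id E (fun_ob J B) \<oplus>\<^bsub>dg_hom E (fun_ob J B) (fun_ob J B) 0\<^esub> dg_diff E (fun_ob J B) (fun_ob J B) 1 (fun_mor J B B 1 q)"
      using arg_cong[OF q(2), of "fun_mor J B B 0"] ob ob' cl q(1) by (simp add: J_simps)
    show "dg_comp E (fun_ob J A) (fun_ob J B) (fun_ob J B') 0 0 (fun_mor J B B' 0 ?b) (fun_mor J A B 0 x) =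
      dg_comp E (fun_ob J A) (fun_ob J A') (fun_ob J B') 0 0 (fun_mor J A' B' 0 f) (fun_mor J A A' 0 ?a)
      \<oplus>\<^bsub>dg_hom E (fun_ob J A) (fun_ob J B') 0\<^esub> dg_diff E (fun_ob J A) (fun_ob J B') 1 (fun_mor J A B' 1 r)"
      using arg_cong[OF r(2), of "fun_mor J A B' 0"] ob ob' cl r(1) by (simp add: J_simps)
    show "dg_diff E (fun_ob J K) (fun_ob J B') 0 (fun_mor J K B' 0 ?c0) \<oplus>\<^bsub>dg_hom E (fun_ob J K) (fun_ob J B') (-1)\<^esub>
      dg_comp E (fun_ob J K) (fun_ob J A') (fun_ob J B') 0 (-1) (fun_mor J A' B' 0 f) (fun_mor J K A' (-1) ?c1) =
      \<zero>\<^bsub>dg_hom E (fun_ob J K) (fun_ob J B') (-1)\<^esub>"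
      using arg_cong[OF c_closed(1), of "fun_mor J K B' (-1)"] ob ob' cl by (simp add: J_simps)
    show "dg_comp E (fun_ob J B) (fun_ob J K) (fun_ob J B') 0 0 (fun_mor J K B' 0 ?c0) (fun_mor J B K 0 y) =
      fun_mor J B B' 0 ?b \<oplus>\<^bsub>dg_hom E (fun_ob J B) (fun_ob J B') 0\<^esub>
      (dg_diff E (fun_ob J B) (fun_ob J B') 1 (fun_mor J B B' 1 u0) \<oplus>\<^bsub>dg_hom E (fun_ob J B) (fun_ob J B') 0\<^esub>
      dg_comp E (fun_ob J B) (fun_ob J A') (fun_ob J B') 0 0 (fun_mor J A' B' 0 f) (fun_mor J B A' 0 u1))"
      using arg_cong[OF u(3), of "fun_mor J B B' 0"] ob ob' cl u(1,2) by (simp add: J_simps)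
    show "dg_comp E (fun_ob J B) (fun_ob J K) (fun_ob J A') (-1) 0 (fun_mor J K A' (-1) ?c1) (fun_mor J B K 0 y) =
      \<ominus>\<^bsub>dg_hom E (fun_ob J B) (fun_ob J A') (-1)\<^esub> dg_diff E (fun_ob J B) (fun_ob J A') 0 (fun_mor J B A' 0 u1)"
      using arg_cong[OF u(4), of "fun_mor J B A' (-1)"] ob ob' cl u(1,2) by (simp add: J_simps)
  qed (use ob ob' p q r u cl in \<open>simp_all add: J_simps\<close>)
qed

section \<open>Maps under the base category\<close>

text \<open>
  All categories compared below have the objects of \<open>C\<close>, and maps between them are taken to be the identity
  on objects. So composites are equal, and not merely isomorphic, to identities on objects, as
  \<^const>\<open>dg_homotopic\<close> demands.
\<close>

definition under_map :: "('k, 'r) ring_scheme \<Rightarrow> ('k, 'o, 'm) dgcat \<Rightarrow>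
    ('k, 'o, 'm, 'o, 'n) under \<Rightarrow> ('k, 'o, 'm, 'o, 'l) under \<Rightarrow> ('o, 'n, 'o, 'l) dgfun \<Rightarrow> bool"
  where "under_map R C U U' F \<longleftrightarrow> dg_functor R (fst U) (fst U') F \<and> fun_ob F = (\<lambda>X. X) \<and>
    dgfun_eq C (dgfun_comp F (snd U)) (snd U')"

definition unique_under :: "('k, 'r) ring_scheme \<Rightarrow> ('k, 'o, 'm) dgcat \<Rightarrow>
    ('k, 'o, 'm, 'o, 'n) under \<Rightarrow> ('k, 'o, 'm, 'o, 'l) under \<Rightarrow> bool"
  where "unique_under R C U U' \<longleftrightarrow> (\<exists>F. under_map R C U U' F) \<and>
    (\<forall>F F'. under_map R C U U' F \<longrightarrow> under_map R C U U' F' \<longrightarrow> dg_homotopic R (fst U) (fst U') F F')"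

definition wide_under :: "('k, 'r) ring_scheme \<Rightarrow> ('k, 'o, 'm) dgcat \<Rightarrow> ('k, 'o, 'm, 'o, 'n) under \<Rightarrow> bool"
  where "wide_under R C U \<longleftrightarrow> under_object R C U \<and> dg_ob (fst U) = dg_ob C \<and> fun_ob (snd U) = (\<lambda>X. X)"

text \<open>
  Uniqueness up to homotopy of endomorphisms makes the maps in the two directions homotopy inverse to
  each other, as for objects with a universal property.
\<close>

lemma weq_under_of_unique:
  assumes U: "wide_under R C U" and U': "wide_under R C U'"
    and "unique_under R C U U'" "unique_under R C U' U" "unique_under R C U U" "unique_under R C U' U'"
  shows "weq_under R C U U'"
proof -
  have cat: "dg_category R (fst U)" "dg_category R (fst U')"
    and funs: "dg_functor R C (fst U) (snd U)" "dg_functor R C (fst U') (snd U')"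
    and ob: "fun_ob (snd U) = (\<lambda>X. X)" "fun_ob (snd U') = (\<lambda>X. X)"
    using U U' by (auto simp: wide_under_def under_object_def)
  obtain F G where F: "under_map R C U U' F" and G: "under_map R C U' U G"
    using assms by (auto simp: unique_under_def)
  have id: "under_map R C U U dgfun_id" "under_map R C U' U' dgfun_id"
    by (auto simp: under_map_def dg_functor_id dgfun_eq_def)
  have GF: "under_map R C U U (dgfun_comp G F)" "under_map R C U' U' (dgfun_comp F G)"
    using F G ob by (auto simp: under_map_def dgfun_eq_def dg_functor_comp)
  have "quasi_equivalence R (fst U) (fst U') F"
    using homotopy_equivalence_quasi_equivalence[OF cat] F G GF id assms(5,6)
    by (auto simp: unique_under_def under_map_def)
  then show ?thesis using U U' F by (auto simp: weq_under_def wide_under_def under_map_def)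
qed

lemma unique_under_base:
  assumes "dg_category R C" and U: "wide_under R C U"
  shows "unique_under R C (C, dgfun_id) U"
  unfolding unique_under_def
proof (intro conjI allI impI)
  show "\<exists>F. under_map R C (C, dgfun_id) U F"
    using U by (intro exI[of _ "snd U"]) (auto simp: under_map_def wide_under_def under_object_def dgfun_eq_def)
  fix F F' assume "under_map R C (C, dgfun_id) U F" "under_map R C (C, dgfun_id) U F'"
  then show "dg_homotopic R (fst (C, dgfun_id)) (fst U) F F'"
    using U assms(1) by (intro dg_homotopic_of_eq) (auto simp: under_map_def wide_under_def under_object_def dgfun_eq_def)
qed

lemma wide_under_base: "dg_category R C \<Longrightarrow> wide_under R C (C, dgfun_id)"
  by (simp add: wide_under_def under_object_def dg_functor_id)

text \<open>
  One step of an iterated extension: for \<open>(C/x)/y\<close> the second step starts from \<open>D = C/x\<close> but is still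
  viewed under \<open>C\<close>.
\<close>

locale under_extension = free_extension R D V
  for R :: "('k, 'r) ring_scheme" (structure) and D :: "('k, 'o, 'n) dgcat" and V +
  fixes C :: "('k, 'o, 'm) dgcat" and I :: "('o, 'm, 'o, 'n) dgfun"
  assumes wide: "wide_under R C (D, I)"
begin

abbreviation "J \<equiv> dgfun_comp (adjoin_incl R D V) I"

lemma wide_extension: "wide_under R C (G, J)"
  using wide dg_functor_comp[OF _ incl_dg_functor] adjoin_dg_category
  by (auto simp: wide_under_def under_object_def)

lemma J_generator_boundary:
  assumes "X \<in> dg_ob D" "Y \<in> dg_ob D" "(X, Y, n, fun_mor I X Y n v) \<in> V"
  shows "fun_mor J X Y n v \<in> boundaries G X Y n"
  using wide new_closed[OF assms(3)] diff_new[OF assms(3)]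
  by (force simp: boundaries_def wide_under_def)

lemma J_boundary:
  assumes "X \<in> dg_ob D" "Y \<in> dg_ob D" "fun_mor I X Y n v \<in> boundaries D X Y n"
  shows "fun_mor J X Y n v \<in> boundaries G X Y n"
proof -
  obtain k where k: "k \<in> carrier (dg_hom D X Y (n + 1))" "fun_mor I X Y n v = dg_diff D X Y (n + 1) k"
    using assms(3) by (auto simp: boundaries_def)
  then have "fun_mor J X Y n v = dg_diff G X Y (n + 1) (old X Y (n + 1) k)"
    using wide assms(1,2) by (simp add: wide_under_def is_expr.Old)
  then show ?thesis using k(1) assms(1,2) by (auto simp: boundaries_def)
qed

text \<open>
  Extending a map from \<open>D\<close> to \<open>G\<close>, and a homotopy on \<open>D\<close> to one on \<open>G\<close>, means solving \<open>d k = c\<close> in homs of the target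
  between the ends of the adjoined morphisms. These are acyclic if one of the ends is contractible.
\<close>

lemma unique_extension:
  assumes U: "wide_under R C U" and unique: "unique_under R C (D, I) U"
    and B: "contractible (fst U) B" and V: "\<And>X Y n v. (X, Y, n, v) \<in> V \<Longrightarrow> B = X \<or> B = Y"
  shows "unique_under R C (G, J) U"
  unfolding unique_under_def
proof (intro conjI allI impI)
  let ?E = "fst U"
  have E: "dg_category R ?E" using U by (simp add: wide_under_def under_object_def)
  interpret E: dg_category R ?E by (rule E)
  have ob: "dg_ob D = dg_ob C" "dg_ob ?E = dg_ob C" "fun_ob I = (\<lambda>X. X)" "fun_ob (snd U) = (\<lambda>X. X)"
    and I: "dg_functor R C D I"
    using wide U by (auto simp: wide_under_def under_object_def)
  note I_closed = dg_functorD(2)[OF I, unfolded ob]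
  have acyclic: "\<exists>k\<in>carrier (dg_hom ?E X Y (m + 1)). dg_diff ?E X Y (m + 1) k = f"
    if "(X, Y, n, v) \<in> V" "f \<in> cycles ?E X Y m" for X Y n v m f
    using E.contractible_acyclic[OF B _ _ V[OF that(1)] that(2)] generators[OF that(1)] ob by auto
  obtain F where F: "under_map R C (D, I) U F" using unique by (auto simp: unique_under_def)
  then have F': "dg_functor R D ?E F" "fun_ob F = (\<lambda>X. X)" by (auto simp: under_map_def)
  define W where "W X Y n v = (SOME k. k \<in> carrier (dg_hom ?E X Y (n + 1)) \<and>
    dg_diff ?E X Y (n + 1) k = fun_mor F X Y n v)" for X Y n v
  have "W X Y n v \<in> carrier (dg_hom ?E (fun_ob F X) (fun_ob F Y) (n + 1)) \<and>
      dg_diff ?E (fun_ob F X) (fun_ob F Y) (n + 1) (W X Y n v) = fun_mor F X Y n v"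
    if "(X, Y, n, v) \<in> V" for X Y n v
  proof -
    have "fun_mor F X Y n v \<in> cycles ?E X Y n"
      using dg_functor_cycles[OF dg_category_axioms E F'(1)] generators[OF that] F'(2) by auto
    from acyclic[OF that this]
    have "\<exists>k. k \<in> carrier (dg_hom ?E X Y (n + 1)) \<and> dg_diff ?E X Y (n + 1) k = fun_mor F X Y n v" by blast
    then show ?thesis unfolding F'(2) W_def by (rule someI_ex)
  qed
  then obtain K where "dg_functor R G ?E K" "fun_ob K = fun_ob F"
    "\<And>X Y n f. \<lbrakk>X \<in> dg_ob D; Y \<in> dg_ob D; f \<in> carrier (dg_hom D X Y n)\<rbrakk> \<Longrightarrow>
      fun_mor K X Y n (old X Y n f) = fun_mor F X Y n f"
    using extension_exists[OF E F'(1), of W] by metis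
  then have "under_map R C (G, J) U K"
    using F ob I_closed by (simp add: under_map_def dgfun_eq_def)
  then show "\<exists>K. under_map R C (G, J) U K" ..
next
  let ?E = "fst U"
  have E: "dg_category R ?E" using U by (simp add: wide_under_def under_object_def)
  interpret E: dg_category R ?E by (rule E)
  have ob: "dg_ob D = dg_ob C" "dg_ob ?E = dg_ob C"
    using wide U by (auto simp: wide_under_def)
  fix K K' assume K: "under_map R C (G, J) U K" and K': "under_map R C (G, J) U K'"
  have "under_map R C (D, I) U (dgfun_comp K (adjoin_incl R D V))" "under_map R C (D, I) U (dgfun_comp K' (adjoin_incl R D V))"
    using K K' by (auto simp: under_map_def dgfun_eq_def dg_functor_comp[OF incl_dg_functor])
  then have "dg_homotopic R D ?E (dgfun_comp K (adjoin_incl R D V)) (dgfun_comp K' (adjoin_incl R D V))"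
    using unique by (simp add: unique_under_def)
  then have "dg_homotopic R G ?E K K'"
  proof (rule homotopic_extension[OF E, rotated 2])
    fix X Y n v f assume XY: "(X, Y, n, v) \<in> V" and f: "f \<in> cycles ?E (fun_ob K X) (fun_ob K Y) (n + 1)"
    show "\<exists>k\<in>carrier (dg_hom ?E (fun_ob K X) (fun_ob K Y) (n + 2)). dg_diff ?E (fun_ob K X) (fun_ob K Y) (n + 2) k = f"
      using E.contractible_acyclic[OF B _ _ V[OF XY], of f "n + 1"] f generators[OF XY] ob K
      by (auto simp: under_map_def add.commute)
  qed (use K K' in \<open>simp_all add: under_map_def\<close>)
  then show "dg_homotopic R (fst (G, J)) (fst U) K K'" by simp
qed

end

section \<open>Killing one or two morphisms\<close>

lemma (in dg_category) kill_free_extension: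
  "X \<in> dg_ob C \<Longrightarrow> Y \<in> dg_ob C \<Longrightarrow> v \<in> cycles C X Y n \<Longrightarrow> free_extension R C {(X, Y, n, v)}"
  by unfold_locales auto

lemma kill_properties:
  assumes C: "dg_category R C" and v: "X \<in> dg_ob C" "Y \<in> dg_ob C" "v \<in> cycles C X Y n"
  shows "wide_under R C (kill R C X Y n v)"
    and "fun_mor (snd (kill R C X Y n v)) X Y n v \<in> boundaries (fst (kill R C X Y n v)) X Y n"
    and "\<lbrakk>wide_under R C U; contractible (fst U) B; B = X \<or> B = Y\<rbrakk> \<Longrightarrow> unique_under R C (kill R C X Y n v) U"
proof -
  interpret C: dg_category R C by (rule C)
  interpret free_extension R C "{(X, Y, n, v)}" using v by (rule C.kill_free_extension)
  interpret under_extension R C "{(X, Y, n, v)}" C dgfun_id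
    by unfold_locales (rule wide_under_base[OF C])
  have [simp]: "dgfun_comp F dgfun_id = F" for F
    by (simp add: dgfun_comp_def dgfun_id_def comp_def)
  have kill: "kill R C X Y n v = (G, J)" by (simp add: kill_def adjoin_under_def)
  show "wide_under R C (kill R C X Y n v)" unfolding kill by (rule wide_extension)
  show "fun_mor (snd (kill R C X Y n v)) X Y n v \<in> boundaries (fst (kill R C X Y n v)) X Y n"
    unfolding kill using J_generator_boundary[of X Y n v] v by simp
  show "unique_under R C (kill R C X Y n v) U"
    if "wide_under R C U" "contractible (fst U) B" "B = X \<or> B = Y"
    unfolding kill using that by (intro unique_extension[where B = B] unique_under_base C) auto
qed

text \<open>
  Two extension steps. A single contractible object \<open>B\<close> serves both of them, so \<open>B\<close> has to be an end of
  either killed morphism.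
\<close>

lemma kill2_properties:
  fixes X' Y' :: 'o and v' :: 'm
  assumes C: "dg_category R C" and v: "X \<in> dg_ob C" "Y \<in> dg_ob C" "v \<in> cycles C X Y n"
    and v': "X' \<in> dg_ob C" "Y' \<in> dg_ob C" "v' \<in> cycles C X' Y' n'"
  defines "Q \<equiv> kill2 R C X Y n v X' Y' n' v'"
  shows "wide_under R C Q"
    and "fun_mor (snd Q) X Y n v \<in> boundaries (fst Q) X Y n"
    and "fun_mor (snd Q) X' Y' n' v' \<in> boundaries (fst Q) X' Y' n'"
    and "\<lbrakk>wide_under R C U; contractible (fst U) B; B = X \<or> B = Y; B = X' \<or> B = Y'\<rbrakk> \<Longrightarrow> unique_under R C Q U"
proof -
  obtain D I where DI: "kill R C X Y n v = (D, I)" by (cases "kill R C X Y n v")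
  note K = kill_properties[OF C v, unfolded DI]
  have D: "dg_category R D" "dg_functor R C D I" and ob: "dg_ob D = dg_ob C" "fun_ob I = (\<lambda>X. X)"
    using K(1) by (auto simp: wide_under_def under_object_def)
  interpret D: dg_category R D by (rule D(1))
  have w: "fun_mor I X' Y' n' v' \<in> cycles D X' Y' n'"
    using dg_functor_cycles[OF C D v'] ob by simp
  let ?V = "{(X', Y', n', fun_mor I X' Y' n' v')}"
  interpret free_extension R D ?V using v' ob w by (intro D.kill_free_extension) auto
  interpret under_extension R D ?V C I
    by unfold_locales (use K(1) in simp)
  have Q: "Q = (G, J)" by (simp add: Q_def kill2_def DI kill_def[of R D] adjoin_under_def ob)
  show "wide_under R C Q" unfolding Q by (rule wide_extension)
  show "fun_mor (snd Q) X Y n v \<in> boundaries (fst Q) X Y n"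
    unfolding Q using J_boundary[of X Y n v] v K(2) ob by simp
  show "fun_mor (snd Q) X' Y' n' v' \<in> boundaries (fst Q) X' Y' n'"
    unfolding Q using J_generator_boundary[of X' Y' n' v'] v' ob by simp
  show "unique_under R C Q U"
    if "wide_under R C U" "contractible (fst U) B" "B = X \<or> B = Y" "B = X' \<or> B = Y'"
    unfolding Q using that K(3)[of U B] by (intro unique_extension[where B = B]) auto
qed

text \<open>
  The Drinfeld quotient kills \<open>1 : B \<rightarrow> B\<close>, and the other two categories kill \<open>x : A \<rightarrow> B\<close> and
  \<open>y : B \<rightarrow> K\<close>. The object \<open>B\<close> is an end of each of these morphisms, and it is contractible in all
  three categories. So each of them has an essentially unique map under \<open>C\<close> to each of them.
\<close>

theorem corollary6p3:
  fixes R :: "('k, 'r) ring_scheme" and C :: "('k, 'o, 'm) dgcat"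
    and A B K S :: 'o and x y z :: 'm and \<sigma> :: "nat \<Rightarrow> nat \<Rightarrow> 'm"
  assumes "cring R"
    and "flat_dgcat R C"
    and "pretriangulated R C"
    and "exact_triangle C A B K S \<sigma> x y z"
  shows "(weakly_equivalent_under R C
           (drinfeld_quotient R C (full_dg_sub C {B}))
           (kill2 R C A B 0 x B K 0 y))
    \<and> (weakly_equivalent_under R C
           (kill2 R C A B 0 x B K 0 y)
           (kill2 R C B K 0 y A B 0 x))"
proof -
  have C: "dg_category R C" using assms(3) by (simp add: pretriangulated_def)
  interpret C: dg_category R C by (rule C)
  have ob: "A \<in> dg_ob C" "B \<in> dg_ob C" "K \<in> dg_ob C" and x: "x \<in> cycles C A B 0" and y: "y \<in> cycles C B K 0"
    using assms(4) by (auto simp: exact_triangle_def)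
  let ?Q0 = "drinfeld_quotient R C (full_dg_sub C {B})"
  let ?Q1 = "kill2 R C A B 0 x B K 0 y" and ?Q2 = "kill2 R C B K 0 y A B 0 x"
  have Q0: "?Q0 = kill R C B B 0 (dg_id C B)"
    by (simp add: drinfeld_quotient_def full_dg_sub_def kill_def)
  have id: "dg_id C B \<in> cycles C B B 0" using ob by (simp add: cycles_def)
  note K0 = kill_properties[OF C ob(2) ob(2) id, folded Q0]
  note K1 = kill2_properties[OF C ob(1,2) x ob(2,3) y]
  note K2 = kill2_properties[OF C ob(2,3) y ob(1,2) x]
  \<comment> \<open>Here the killed morphism is the identity of \<open>B\<close>.\<close>
  have c0: "contractible (fst ?Q0) B"
    using K0(1,2) ob dg_functorD[of R C "fst ?Q0" "snd ?Q0" B]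
    by (auto simp: contractible_def wide_under_def under_object_def dg_functor_def)
  have c: "contractible (fst Q) B"
    if "wide_under R C Q" "fun_mor (snd Q) A B 0 x \<in> boundaries (fst Q) A B 0"
      "fun_mor (snd Q) B K 0 y \<in> boundaries (fst Q) B K 0" for Q :: "('k, 'o, 'm, 'o, ('k, 'o, ('k, 'o, 'm) expr set) expr set) under"
    using exact_triangle_contractible[OF C assms(4), of "fst Q" "snd Q"] that
    by (simp add: wide_under_def under_object_def)
  note c1 = c[OF K1(1,2,3)] and c2 = c[OF K2(1,3,2)]
  have "weq_under R C ?Q0 ?Q1"
    using K0(1) K1(1) K0(3)[OF K0(1) c0] K0(3)[OF K1(1) c1] K1(4)[OF K0(1) c0] K1(4)[OF K1(1) c1]
    by (intro weq_under_of_unique) simp_all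
  moreover have "weq_under R C ?Q1 ?Q2"
    using K1(1) K2(1) K1(4)[OF K1(1) c1] K1(4)[OF K2(1) c2] K2(4)[OF K1(1) c1] K2(4)[OF K2(1) c2]
    by (intro weq_under_of_unique) simp_all
  ultimately show ?thesis by (simp add: weakly_equivalent_under_def link_under_def)
qed

end
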